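(* If $A$ is an abelian group with $r_0(A)<\infty$ and either $T:=T(A)$ is bounded or $A/T$ is finitely generated, then there are subgroups $\Sigma$ and $\Gamma_1$ of $\mathrm{IAut}_1(A)$ such that $$\mathrm{IAut}_1(A)=\Sigma\rtimes\Gamma_1,$$ where $\Sigma$ is a periodic abelian group, $\Gamma_1\simeq\mathrm{IAut}(T)$ and the automorphisms induced by $\Gamma_1$ via conjugation on $\Sigma$ are inertial.
   Context: Abelian groups $A$ are written additively; endomorphisms act on the right. An automorphism $\gamma$ of an abelian group $A$ is called inertial if $(H+H\gamma)/H$ is finite for each subgroup $H\le A$. $\mathrm{IAut}(A)$ denotes the subgroup of $\mathrm{Aut}(A)$ generated by all inertial automorphisms of $A$. $T(A)$ denotes the torsion subgroup of $A$, $r_0(A)$ its torsion-free rank (cardinality of a maximal $\mathbb{Z}$-independent subset), and $\mathrm{IAut}_1(A)$ denotes the subgroup of $\mathrm{IAut}(A)$ consisting of the inertial automorphisms of $A$ that act as the identity map on $A/T(A)$. Bounded means of finite exponent. *)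

theory Defs
  imports "HOL-Algebra.Algebra"
begin

text \<open>
  Abelian groups are groups in the sense of \<^locale>\<open>comm_group\<close>, hence written
  multiplicatively: \<open>n x\<close> is \<open>x [^] n\<close>, and \<open>H + K\<close> is \<open>H <#> K\<close>.

  Composition in \<^const>\<open>AutoGroup\<close> is \<open>\<gamma> \<otimes> \<delta> = \<gamma> \<circ> \<delta>\<close> (maps on the left). With maps written on
  the right one obtains the opposite group; its subgroups, normal subgroups, semidirect
  decompositions and isomorphism type correspond to those used here.
\<close>

definition inertial :: "('a, 'b) monoid_scheme \<Rightarrow> ('a \<Rightarrow> 'a) \<Rightarrow> bool" where
  "inertial A \<gamma> \<longleftrightarrow> \<gamma> \<in> auto A \<and>
     (\<forall>H. subgroup H A \<longrightarrow>
        finite (carrier ((A\<lparr>carrier := H <#>\<^bsub>A\<^esub> (\<gamma> ` H)\<rparr>) Mod H)))"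

definition IAut :: "('a, 'b) monoid_scheme \<Rightarrow> ('a \<Rightarrow> 'a) monoid" where
  "IAut A = subgroup_generated (AutoGroup A) {\<gamma>. inertial A \<gamma>}"

definition torsion_part :: "('a, 'b) monoid_scheme \<Rightarrow> 'a set" where
  "torsion_part A = {x \<in> carrier A. \<exists>n::nat. n > 0 \<and> x [^]\<^bsub>A\<^esub> n = \<one>\<^bsub>A\<^esub>}"

definition periodic :: "('a, 'b) monoid_scheme \<Rightarrow> bool" where
  "periodic A \<longleftrightarrow> torsion_part A = carrier A"

definition bounded_group :: "('a, 'b) monoid_scheme \<Rightarrow> bool" where
  "bounded_group A \<longleftrightarrow> (\<exists>n::nat. n > 0 \<and> (\<forall>x\<in>carrier A. x [^]\<^bsub>A\<^esub> n = \<one>\<^bsub>A\<^esub>))"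

definition finitely_generated :: "('a, 'b) monoid_scheme \<Rightarrow> bool" where
  "finitely_generated A \<longleftrightarrow>
     (\<exists>S. finite S \<and> S \<subseteq> carrier A \<and> generate A S = carrier A)"

definition Z_independent :: "('a, 'b) monoid_scheme \<Rightarrow> 'a set \<Rightarrow> bool" where
  "Z_independent A S \<longleftrightarrow> S \<subseteq> carrier A \<and>
     (\<forall>F n. finite F \<and> F \<subseteq> S \<and> finprod A (\<lambda>x. x [^]\<^bsub>A\<^esub> (n x :: int)) F = \<one>\<^bsub>A\<^esub>
        \<longrightarrow> (\<forall>x\<in>F. n x = 0))"

definition maximal_Z_independent :: "('a, 'b) monoid_scheme \<Rightarrow> 'a set \<Rightarrow> bool" where
  "maximal_Z_independent A S \<longleftrightarrow> Z_independent A S \<and>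
     (\<forall>S'. Z_independent A S' \<and> S \<subseteq> S' \<longrightarrow> S' = S)"

text \<open>\<open>r\<^sub>0(A) < \<infinity>\<close>; all maximal independent subsets have the same cardinality.\<close>

definition finite_torsion_free_rank :: "('a, 'b) monoid_scheme \<Rightarrow> bool" where
  "finite_torsion_free_rank A \<longleftrightarrow> (\<exists>S. maximal_Z_independent A S \<and> finite S)"

text \<open>The map induced by \<open>\<gamma>\<close> on \<open>A/T(A)\<close> sends a coset \<open>C\<close> to its image \<open>\<gamma> ` C\<close>.\<close>

definition IAut1 :: "('a, 'b) monoid_scheme \<Rightarrow> ('a \<Rightarrow> 'a) monoid" where
  "IAut1 A = (IAut A)\<lparr>carrier :=
     {\<gamma> \<in> carrier (IAut A). inertial A \<gamma> \<and>
        (\<forall>C\<in>carrier (A Mod torsion_part A). \<gamma> ` C = C)}\<rparr>"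

definition internal_semidirect :: "('a, 'b) monoid_scheme \<Rightarrow> 'a set \<Rightarrow> 'a set \<Rightarrow> bool" where
  "internal_semidirect G N K \<longleftrightarrow>
     N \<lhd> G \<and> subgroup K G \<and> N \<inter> K = {\<one>\<^bsub>G\<^esub>} \<and> N <#>\<^bsub>G\<^esub> K = carrier G"

text \<open>With maps on the right, \<open>\<sigma>\<^sup>\<gamma> = \<gamma>\<inverse>\<sigma>\<gamma>\<close> is the map \<open>\<gamma> \<circ> \<sigma> \<circ> \<gamma>\<inverse>\<close>.\<close>

definition conj_on :: "('a, 'b) monoid_scheme \<Rightarrow> 'a set \<Rightarrow> 'a \<Rightarrow> 'a \<Rightarrow> 'a" where
  "conj_on G N g = (\<lambda>x\<in>N. g \<otimes>\<^bsub>G\<^esub> x \<otimes>\<^bsub>G\<^esub> inv\<^bsub>G\<^esub> g)"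

end

theory Submission
  imports Defs
begin

text \<open>
  Either hypothesis makes the torsion subgroup \<open>T\<close> a direct summand, \<open>A = T \<oplus> K\<close>, and both have the same
  consequence for quotients: certain periodic quotients of subgroups of \<open>A/T\<close> are finite
  (\<open>finite_index_of_torsion_quotient\<close>). In particular every homomorphism from \<open>A/T\<close> to \<open>T\<close> has finite image and
  is determined by its values on a finite set, and every subgroup \<open>H\<close> contains
  \<open>(H \<inter> T) + (H \<inter> K)\<close> with finite index. It follows that an automorphism that is trivial on \<open>A/T\<close> is inertial if and only
  if its restriction to \<open>T\<close> is (\<open>inertial_res\<close>, \<open>inertial_of_res\<close>). So \<open>\<Sigma>\<close>, the group of all automorphisms
  trivial on \<open>A/T\<close> and on \<open>T\<close>, is the kernel of the restriction map from \<open>IAut\<^sub>1(A)\<close> onto \<open>IAut(T)\<close>, which is split by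
  extending automorphisms of \<open>T\<close> by the identity on \<open>K\<close>; the image of this splitting is \<open>\<Gamma>\<^sub>1\<close>.

  The map \<open>\<sigma> \<mapsto> \<sigma> - 1\<close> identifies \<open>\<Sigma>\<close> with \<open>Hom(A/T, T)\<close>, and the values on a finite set embed it in a finite power
  \<open>T\<^sup>m\<close>. Thus \<open>\<Sigma>\<close> is abelian and periodic, and conjugation by \<open>\<gamma>\<close> is induced by the diagonal action of \<open>\<gamma>\<close> on
  \<open>T\<^sup>m\<close>. What remains is a statement on torsion groups: if \<open>\<gamma>\<close> is inertial on \<open>T\<close>, so is the diagonal
  action on \<open>T\<^sup>m\<close> (\<open>all_stable\<close>). With \<open>m = 1\<close> the proof also shows that inverses of
  inertial automorphisms of \<open>T\<close> are inertial, and hence that \<open>IAut(T)\<close> consists of inertial automorphisms.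

  This rests on the fact that there are a finite set \<open>W\<close> of nonzero elements and a finite subgroup \<open>E\<close> such that an
  inertial automorphism of a torsion group maps every element with no multiple in \<open>W\<close> to one of its multiples modulo \<open>E\<close>
  (\<open>local_powers_outside_finite\<close>). Where this holds for all \<open>p\<close>-elements of a subgroup, the coordinates of a tuple
  of such elements are multiplied by a common integer modulo \<open>E\<close> (\<open>uniform_power_mod\<close>). For all but finitely many
  primes \<open>p\<close> there is no exception among the \<open>p\<close>-elements. For a remaining prime, either \<open>p\<^sup>k T\<close> has an
  infinite \<open>p\<close>-socle for every \<open>k\<close>, and generic elements of large order remove the exceptions
  (\<open>generic_element_power\<close>), or each \<open>p\<close>-subgroup of \<open>T\<^sup>m\<close> is the sum of a divisible and a bounded group, which are
  treated separately (\<open>stable_divisible\<close>, \<open>stable_bounded\<close>).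

  The comments use additive notation and write automorphisms on the right of their arguments.
\<close>

section \<open>Calculations in abelian groups\<close>

context comm_group
begin

text \<open>
  Simplification modulo the axioms of abelian groups: every word in \<open>x\<close>, \<open>y\<close>, \<open>z\<close>, \<open>w\<close> is written
  as \<open>L a b c d\<close>, standing for \<open>a x + b y + c z + d w\<close>. As \<open>L\<close> is opaque, rewriting the letters terminates, and an
  identity between words becomes one between integer exponents.
\<close>

lemma abelian_normal_form4:
  assumes "x \<in> carrier G" "y \<in> carrier G" "z \<in> carrier G" "w \<in> carrier G"
    and "\<And>L :: int \<Rightarrow> int \<Rightarrow> int \<Rightarrow> int \<Rightarrow> 'a.
      \<lbrakk>\<And>a b c d a' b' c' d'. L a b c d \<otimes> L a' b' c' d' = L (a + a') (b + b') (c + c') (d + d');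
       \<And>a b c d. inv (L a b c d) = L (- a) (- b) (- c) (- d);
       \<And>a b c d i. L a b c d [^] (i :: int) = L (a * i) (b * i) (c * i) (d * i);
       \<one> = L 0 0 0 0; x = L 1 0 0 0; y = L 0 1 0 0; z = L 0 0 1 0; w = L 0 0 0 1\<rbrakk> \<Longrightarrow> P"
  shows P
  by (rule assms(5)[of "\<lambda>a b c d. x [^] a \<otimes> (y [^] b \<otimes> (z [^] c \<otimes> w [^] d))"])
    (use assms(1-4) in \<open>simp_all add: int_pow_mult int_pow_neg int_pow_pow int_pow_distrib inv_mult m_ac\<close>)

lemma abelian_normal_form3:
  assumes "x \<in> carrier G" "y \<in> carrier G" "z \<in> carrier G"
    and "\<And>L :: int \<Rightarrow> int \<Rightarrow> int \<Rightarrow> 'a.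
      \<lbrakk>\<And>a b c a' b' c'. L a b c \<otimes> L a' b' c' = L (a + a') (b + b') (c + c');
       \<And>a b c. inv (L a b c) = L (- a) (- b) (- c);
       \<And>a b c i. L a b c [^] (i :: int) = L (a * i) (b * i) (c * i);
       \<one> = L 0 0 0; x = L 1 0 0; y = L 0 1 0; z = L 0 0 1\<rbrakk> \<Longrightarrow> P"
  shows P
  by (rule assms(4)[of "\<lambda>a b c. x [^] a \<otimes> (y [^] b \<otimes> z [^] c)"])
    (use assms(1-3) in \<open>simp_all add: int_pow_mult int_pow_neg int_pow_pow int_pow_distrib inv_mult m_ac\<close>)

lemma abelian_normal_form2:
  assumes "x \<in> carrier G" "y \<in> carrier G"
    and "\<And>L :: int \<Rightarrow> int \<Rightarrow> 'a.
      \<lbrakk>\<And>a b a' b'. L a b \<otimes> L a' b' = L (a + a') (b + b');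
       \<And>a b. inv (L a b) = L (- a) (- b);
       \<And>a b i. L a b [^] (i :: int) = L (a * i) (b * i);
       \<one> = L 0 0; x = L 1 0; y = L 0 1\<rbrakk> \<Longrightarrow> P"
  shows P
  by (rule assms(3)[of "\<lambda>a b. x [^] a \<otimes> y [^] b"])
    (use assms(1-2) in \<open>simp_all add: int_pow_mult int_pow_neg int_pow_pow int_pow_distrib inv_mult m_ac\<close>)

text \<open>
  Integer exponents are used throughout; the torsion subgroup is described by them as well.
\<close>

lemma torsion_part_int: "torsion_part G = {x \<in> carrier G. \<exists>n::int. n \<noteq> 0 \<and> x [^] n = \<one>}"
proof -
  have "\<exists>m::nat. m > 0 \<and> x [^] m = \<one>" if "x \<in> carrier G" "n \<noteq> 0" "x [^] n = \<one>" for x and n :: int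
  proof (cases "n > 0")
    case True
    then show ?thesis using that by (intro exI[of _ "nat n"]) (simp add: pow_nat)
  next
    case False
    have "x [^] (- n) = \<one>" using that by (simp add: int_pow_neg)
    then show ?thesis using that False by (intro exI[of _ "nat (- n)"]) (simp add: pow_nat)
  qed
  moreover have "\<exists>n::int. n \<noteq> 0 \<and> x [^] n = \<one>" if "m > 0" "x [^] m = \<one>" for x and m :: nat
    using that by (intro exI[of _ "int m"]) (simp add: int_pow_int)
  ultimately show ?thesis unfolding torsion_part_def by blast
qed

text \<open>
  Congruence of \<open>x\<close> and \<open>y\<close> modulo a subgroup \<open>H\<close> is expressed as \<open>x \<otimes> inv y \<in> H\<close>.
\<close>

lemma diff_sym:
  assumes "subgroup H G" "x \<in> carrier G" "y \<in> carrier G" "x \<otimes> inv y \<in> H"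
  shows "y \<otimes> inv x \<in> H"
proof -
  have "y \<otimes> inv x = inv (x \<otimes> inv y)"
    by (rule abelian_normal_form2[of x y]) (use assms in simp_all)
  then show ?thesis using assms(1,4) subgroup.m_inv_closed by metis
qed

lemma diff_trans:
  assumes "subgroup H G" "x \<in> carrier G" "y \<in> carrier G" "z \<in> carrier G"
    "x \<otimes> inv y \<in> H" "y \<otimes> inv z \<in> H"
  shows "x \<otimes> inv z \<in> H"
proof -
  have "x \<otimes> inv z = (x \<otimes> inv y) \<otimes> (y \<otimes> inv z)"
    by (rule abelian_normal_form3[of x y z]) (use assms in simp_all)
  then show ?thesis using assms(1,5,6) subgroup.m_closed by metis
qed

lemma diff_mem:
  assumes "subgroup H G" "x \<in> carrier G" "y \<in> H" "x \<otimes> inv y \<in> H"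
  shows "x \<in> H"
proof -
  have y: "y \<in> carrier G" using assms subgroup.mem_carrier by metis
  have "x = (x \<otimes> inv y) \<otimes> y"
    by (rule abelian_normal_form2[of x y]) (use assms y in simp_all)
  then show ?thesis using assms subgroup.m_closed by metis
qed

lemma subgroup_power_preimage:
  assumes "subgroup M G"
  shows "subgroup {x \<in> carrier G. x [^] (n::int) \<in> M} G"
proof (rule subgroupI)
  show "{x \<in> carrier G. x [^] n \<in> M} \<noteq> {}"
    using assms subgroup.one_closed by fastforce
  show "inv x \<in> {x \<in> carrier G. x [^] n \<in> M}" if "x \<in> {x \<in> carrier G. x [^] n \<in> M}" for x
    using that assms by (auto simp: int_pow_inv subgroup.m_inv_closed)
  show "x \<otimes> y \<in> {x \<in> carrier G. x [^] n \<in> M}" if "x \<in> {x \<in> carrier G. x [^] n \<in> M}" "y \<in> {x \<in> carrier G. x [^] n \<in> M}" for x y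
    using that assms by (auto simp: int_pow_distrib subgroup.m_closed)
qed auto

lemma subgroup_powers: 
  assumes "subgroup H G"
  shows "subgroup ((\<lambda>x. x [^] (n::int)) ` H) G"
proof (rule subgroupI)
  have c: "x \<in> carrier G" if "x \<in> H" for x using that assms subgroup.mem_carrier by metis
  then show "(\<lambda>x. x [^] n) ` H \<subseteq> carrier G" by auto
  show "(\<lambda>x. x [^] n) ` H \<noteq> {}" using assms subgroup.one_closed by fastforce
  show "inv x \<in> (\<lambda>x. x [^] n) ` H" if "x \<in> (\<lambda>x. x [^] n) ` H" for x
    using that c assms by (auto simp: int_pow_inv[symmetric] subgroup.m_inv_closed)
  show "x \<otimes> y \<in> (\<lambda>x. x [^] n) ` H" if "x \<in> (\<lambda>x. x [^] n) ` H" "y \<in> (\<lambda>x. x [^] n) ` H" for x y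
    using that c assms by (auto simp: int_pow_distrib[symmetric] subgroup.m_closed)
qed

lemma subgroup_cyclic:
  assumes "x \<in> carrier G"
  shows "subgroup (range (\<lambda>i::int. x [^] i)) G"
proof -
  have "range (\<lambda>i::int. x [^] i) = generate G {x}"
    using generate_pow[OF assms] by auto
  then show ?thesis using generate_is_subgroup assms by simp
qed

lemma mem_set_mult: "x \<in> H <#> K \<longleftrightarrow> (\<exists>h\<in>H. \<exists>k\<in>K. x = h \<otimes> k)"
  by (auto simp: set_mult_def)

lemma subset_set_mult_left:
  assumes "subgroup H G" "subgroup K G" shows "H \<subseteq> H <#> K"
proof
  fix h assume "h \<in> H"
  then have "h = h \<otimes> \<one>" using assms subgroup.mem_carrier by fastforce
  then show "h \<in> H <#> K" using assms \<open>h \<in> H\<close> subgroup.one_closed unfolding mem_set_mult by blast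
qed

lemma subset_set_mult_right:
  assumes "subgroup H G" "subgroup K G" shows "K \<subseteq> H <#> K"
proof
  fix h assume "h \<in> K"
  then have "h = \<one> \<otimes> h" using assms subgroup.mem_carrier by fastforce
  then show "h \<in> H <#> K" using assms \<open>h \<in> K\<close> subgroup.one_closed unfolding mem_set_mult by blast
qed

lemma set_mult_least:
  assumes "subgroup L G" "H \<subseteq> L" "K \<subseteq> L" shows "H <#> K \<subseteq> L"
  using assms subgroup.m_closed unfolding set_mult_def by fastforce

lemma finite_set_mult:
  assumes "finite H" "finite K" shows "finite (H <#> K)"
  using assms unfolding set_mult_def by blast

lemma finite_cyclic:
  assumes "x \<in> torsion_part G"
  shows "finite (range (\<lambda>i::int. x [^] i))"
proof -
  obtain n :: int where n: "n \<noteq> 0" "x [^] n = \<one>" and x: "x \<in> carrier G"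
    using assms torsion_part_int by auto
  have "x [^] i \<in> (\<lambda>i. x [^] i) ` {- \<bar>n\<bar>..\<bar>n\<bar>}" for i :: int
  proof -
    have "x [^] i = x [^] (n * (i div n) + i mod n)" by simp
    also have "\<dots> = (x [^] n) [^] (i div n) \<otimes> x [^] (i mod n)"
      using x by (simp only: int_pow_mult int_pow_pow)
    also have "\<dots> = x [^] (i mod n)" using n x by simp
    finally show ?thesis using n abs_mod_less[of n i] by (intro image_eqI) auto
  qed
  then have "range (\<lambda>i::int. x [^] i) \<subseteq> (\<lambda>i. x [^] i) ` {- \<bar>n\<bar>..\<bar>n\<bar>}" by blast
  then show ?thesis using finite_subset by blast
qed

text \<open>
  An abelian torsion group is locally finite.
\<close>

lemma finite_subgroup_cover:
  assumes "finite S" "S \<subseteq> torsion_part G" "subgroup U G" "S \<subseteq> U"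
  shows "\<exists>W. subgroup W G \<and> finite W \<and> S \<subseteq> W \<and> W \<subseteq> U"
  using assms(1,2,4)
proof (induction S)
  case empty
  then show ?case using triv_subgroup assms(3) subgroup.one_closed by (intro exI[of _ "{\<one>}"]) auto
next
  case (insert x S)
  then obtain W where W: "subgroup W G" "finite W" "S \<subseteq> W" "W \<subseteq> U" by auto
  let ?C = "range (\<lambda>i::int. x [^] i)"
  have x: "x \<in> torsion_part G" "x \<in> carrier G" using insert.prems unfolding torsion_part_def by auto
  have C: "subgroup ?C G" "finite ?C" using subgroup_cyclic finite_cyclic x by auto
  have "x \<in> ?C" using int_pow_1[OF x(2)] by (metis rangeI)
  moreover have "?C \<subseteq> U" using insert.prems subgroup_int_pow_closed[OF assms(3)] by auto
  ultimately show ?case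
    using W C mult_subgroups finite_set_mult subset_set_mult_left[OF W(1) C(1)]
      subset_set_mult_right[OF W(1) C(1)] set_mult_least[OF assms(3)]
    by (intro exI[of _ "W <#> ?C"]) auto
qed

text \<open>
  Finitely many elements of \<open>H\<close> represent all cosets of \<open>M\<close> that meet \<open>H\<close>. The set \<open>M\<close> need not be
  contained in \<open>H\<close>.
\<close>

definition finite_index :: "'a set \<Rightarrow> 'a set \<Rightarrow> bool" where
  "finite_index H M \<longleftrightarrow> (\<exists>R. finite R \<and> R \<subseteq> H \<and> (\<forall>h\<in>H. \<exists>r\<in>R. h \<otimes> inv r \<in> M))"

lemma finite_index_by_map:
  assumes "finite (f ` H)" "\<And>h h'. h \<in> H \<Longrightarrow> h' \<in> H \<Longrightarrow> f h = f h' \<Longrightarrow> h \<otimes> inv h' \<in> M"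
  shows "finite_index H M"
proof -
  define g where "g c = (SOME h. h \<in> H \<and> f h = c)" for c
  have g: "g (f h) \<in> H \<and> f (g (f h)) = f h" if "h \<in> H" for h
    using someI[of "\<lambda>k. k \<in> H \<and> f k = f h" h] that unfolding g_def by auto
  show ?thesis unfolding finite_index_def
    using assms g by (intro exI[of _ "g ` (f ` H)"]) (auto, metis)
qed

lemma finite_index_cover:
  assumes "subgroup M G" "H \<subseteq> carrier G" "finite R" "R \<subseteq> carrier G"
    "\<And>h. h \<in> H \<Longrightarrow> \<exists>r\<in>R. h \<otimes> inv r \<in> M"
  shows "finite_index H M"
proof -
  define f where "f h = (SOME r. r \<in> R \<and> h \<otimes> inv r \<in> M)" for h
  have f: "f h \<in> R \<and> h \<otimes> inv (f h) \<in> M" if "h \<in> H" for h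
    using someI_ex[of "\<lambda>r. r \<in> R \<and> h \<otimes> inv r \<in> M"] assms(5)[OF that] unfolding f_def by auto
  show ?thesis
  proof (rule finite_index_by_map)
    have "f ` H \<subseteq> R" using f by auto
    then show "finite (f ` H)" using assms(3) finite_subset by blast
    fix h h' assume h: "h \<in> H" "h' \<in> H" "f h = f h'"
    then have "h \<otimes> inv (f h) \<in> M" "f h \<otimes> inv h' \<in> M"
      using f[of h] f[of h'] diff_sym[OF assms(1), of h' "f h"] assms(2,4) by auto
    then show "h \<otimes> inv h' \<in> M"
      using diff_trans[OF assms(1), of h "f h" h'] f[of h] h assms(2,4) by auto
  qed
qed

lemma finite_index_trans:
  assumes "finite_index H M" "finite_index M N" "subgroup N G" "subgroup M G" "subgroup H G" 
  shows "finite_index H N"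
proof -
  have c: "H \<subseteq> carrier G" "M \<subseteq> carrier G" using assms subgroup.subset by auto
  obtain R where R: "finite R" "R \<subseteq> H" "\<And>h. h \<in> H \<Longrightarrow> \<exists>r\<in>R. h \<otimes> inv r \<in> M"
    using assms(1) unfolding finite_index_def by auto
  obtain S where S: "finite S" "S \<subseteq> M" "\<And>h. h \<in> M \<Longrightarrow> \<exists>r\<in>S. h \<otimes> inv r \<in> N"
    using assms(2) unfolding finite_index_def by auto
  show ?thesis
  proof (rule finite_index_cover[OF assms(3) c(1)])
    show "finite (R <#> S)" using R S finite_set_mult by auto
    show "R <#> S \<subseteq> carrier G" using R(2) S(2) c by (intro setmult_subset_G) auto
    fix h assume h: "h \<in> H"
    then obtain r s where rs: "r \<in> R" "h \<otimes> inv r \<in> M" "s \<in> S" "h \<otimes> inv r \<otimes> inv s \<in> N"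
      using R(3) S(3) by meson
    have eq: "h \<otimes> inv r \<otimes> inv s = h \<otimes> inv (r \<otimes> s)"
      by (rule abelian_normal_form3[of h r s]) (use rs(1,3) h c R(2) S(2) in auto)
    have "r \<otimes> s \<in> R <#> S" using rs(1,3) unfolding mem_set_mult by blast
    then show "\<exists>r\<in>R <#> S. h \<otimes> inv r \<in> N" using rs(4)[unfolded eq] by blast
  qed
qed

lemma finite_index_mono:
  assumes "finite_index H M" "M \<subseteq> N" shows "finite_index H N"
  using assms unfolding finite_index_def by (meson subsetD)

lemma finite_index_refl:
  assumes "subgroup M G" "H \<subseteq> M" "subgroup H G" shows "finite_index H M"
  unfolding finite_index_def using assms
  by (intro exI[of _ "{\<one>}"]) (auto simp: subgroup.one_closed subgroup.mem_carrier)

end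

section \<open>Inertial automorphisms elementwise\<close>

text \<open>
  \<open>H\<gamma> \<subseteq> H + \<Phi>\<close> for a finite set \<open>\<Phi>\<close>, that is, \<open>(H + H\<gamma>)/H\<close> is finite when \<open>H\<close> is a subgroup. The map \<open>\<gamma>\<close>
  is arbitrary.
\<close>

definition almost_preserves :: "('a, 'b) monoid_scheme \<Rightarrow> ('a \<Rightarrow> 'a) \<Rightarrow> 'a set \<Rightarrow> bool" where
  "almost_preserves A \<gamma> H \<longleftrightarrow> (\<exists>\<Phi>. finite \<Phi> \<and> \<Phi> \<subseteq> carrier A \<and>
     (\<forall>h\<in>H. \<exists>h'\<in>H. \<exists>f\<in>\<Phi>. \<gamma> h = h' \<otimes>\<^bsub>A\<^esub> f))"

lemma inertial_iff:
  fixes A :: "('a, 'b) monoid_scheme"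
  assumes "comm_group A"
  shows "inertial A \<gamma> \<longleftrightarrow> \<gamma> \<in> auto A \<and>
    (\<forall>H. subgroup H A \<longrightarrow> almost_preserves A \<gamma> H)"
proof -
  interpret comm_group A by fact
  have "finite (carrier ((A\<lparr>carrier := H <#>\<^bsub>A\<^esub> (\<gamma> ` H)\<rparr>) Mod H)) \<longleftrightarrow>
    (\<exists>\<Phi>. finite \<Phi> \<and> \<Phi> \<subseteq> carrier A \<and> (\<forall>h\<in>H. \<exists>h'\<in>H. \<exists>f\<in>\<Phi>. \<gamma> h = h' \<otimes>\<^bsub>A\<^esub> f))" (is "?l \<longleftrightarrow> ?r")
    if g: "\<gamma> \<in> auto A" and H: "subgroup H A" for H
  proof -
    have Hc: "H \<subseteq> carrier A" using H subgroup.subset by auto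
    have gc: "\<gamma> x \<in> carrier A" if "x \<in> carrier A" for x
      using g that unfolding auto_def hom_def by auto
    let ?Q = "(\<lambda>a. H #>\<^bsub>A\<^esub> a) ` (\<gamma> ` H)"
    \<comment> \<open>Every coset of \<open>H\<close> in \<open>H + H\<gamma>\<close> is represented by an element of \<open>H\<gamma>\<close>.\<close>
    have eq: "carrier ((A\<lparr>carrier := H <#>\<^bsub>A\<^esub> (\<gamma> ` H)\<rparr>) Mod H) = ?Q"
    proof -
      have 1: "carrier ((A\<lparr>carrier := H <#>\<^bsub>A\<^esub> (\<gamma> ` H)\<rparr>) Mod H) = (\<lambda>a. H #>\<^bsub>A\<^esub> a) ` (H <#>\<^bsub>A\<^esub> (\<gamma> ` H))"
        unfolding FactGroup_def RCOSETS_def r_coset_def by auto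
      have "H #>\<^bsub>A\<^esub> (h \<otimes>\<^bsub>A\<^esub> \<gamma> k) = H #>\<^bsub>A\<^esub> \<gamma> k" if "h \<in> H" "k \<in> H" for h k
        using that Hc gc H by (metis coset_join2 coset_mult_assoc subsetD)
      then have "(\<lambda>a. H #>\<^bsub>A\<^esub> a) ` (H <#>\<^bsub>A\<^esub> (\<gamma> ` H)) \<subseteq> ?Q"
        by (auto simp: set_mult_def)
      moreover have "?Q \<subseteq> (\<lambda>a. H #>\<^bsub>A\<^esub> a) ` (H <#>\<^bsub>A\<^esub> (\<gamma> ` H))"
      proof -
        have "\<gamma> k \<in> H <#>\<^bsub>A\<^esub> (\<gamma> ` H)" if "k \<in> H" for k
        proof -
          have "\<gamma> k = \<one>\<^bsub>A\<^esub> \<otimes>\<^bsub>A\<^esub> \<gamma> k" using that gc Hc by auto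
          then show ?thesis using that H subgroup.one_closed unfolding mem_set_mult by blast
        qed
        then show ?thesis by auto
      qed
      ultimately show ?thesis using 1 by auto
    qed
    show ?thesis unfolding eq
    proof
      assume fin: "finite ?Q"
      then have "\<exists>F. finite F \<and> F \<subseteq> \<gamma> ` H \<and> ?Q = (\<lambda>a. H #>\<^bsub>A\<^esub> a) ` F"
        by (meson finite_subset_image order_refl)
      then obtain F where F: "finite F" "F \<subseteq> \<gamma> ` H" "?Q = (\<lambda>a. H #>\<^bsub>A\<^esub> a) ` F" by auto
      show ?r
      proof (intro exI conjI ballI)
        show "finite F" by fact
        show "F \<subseteq> carrier A" using F(2) gc Hc by auto
        fix h assume h: "h \<in> H"
        then have "H #>\<^bsub>A\<^esub> \<gamma> h \<in> (\<lambda>a. H #>\<^bsub>A\<^esub> a) ` F" unfolding F(3)[symmetric] by blast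
        then obtain f where f: "f \<in> F" "H #>\<^bsub>A\<^esub> \<gamma> h = H #>\<^bsub>A\<^esub> f" by blast
        have "\<gamma> h \<in> H #>\<^bsub>A\<^esub> \<gamma> h" using rcos_self[OF _ H] h Hc gc by auto
        then show "\<exists>h'\<in>H. \<exists>f\<in>F. \<gamma> h = h' \<otimes>\<^bsub>A\<^esub> f" using f unfolding r_coset_def by auto
      qed
    next
      assume ?r
      then obtain F where F: "finite F" "F \<subseteq> carrier A" "\<And>h. h \<in> H \<Longrightarrow> \<exists>h'\<in>H. \<exists>f\<in>F. \<gamma> h = h' \<otimes>\<^bsub>A\<^esub> f"
        by blast
      have "?Q \<subseteq> (\<lambda>a. H #>\<^bsub>A\<^esub> a) ` F"
      proof clarify
        fix h assume "h \<in> H"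
        then obtain k f where kf: "k \<in> H" "f \<in> F" "\<gamma> h = k \<otimes>\<^bsub>A\<^esub> f" using F(3) by blast
        have "H #>\<^bsub>A\<^esub> \<gamma> h = H #>\<^bsub>A\<^esub> f"
          unfolding kf(3) using kf(1,2) F(2) Hc H by (metis coset_join2 coset_mult_assoc subsetD)
        then show "H #>\<^bsub>A\<^esub> \<gamma> h \<in> (\<lambda>a. H #>\<^bsub>A\<^esub> a) ` F" using kf by auto
      qed
      then show "finite ?Q" using finite_imageI[OF F(1)] finite_subset by metis
    qed
  qed
  then show ?thesis unfolding inertial_def almost_preserves_def by (simp cong: conj_cong imp_cong)
qed

section \<open>Torsion groups: powers outside a finite set\<close>

context comm_group
begin

text \<open>
  The compactness argument on which everything about torsion groups rests. If no finite \<open>E\<close> and \<open>F\<close>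
  worked, one could choose \<open>x\<^sub>0, x\<^sub>1, \<dots>\<close> in an increasing chain of finite subgroups \<open>E\<^sub>n\<close> such that the
  differences of the \<open>x\<^sub>n\<gamma>\<close> lie in finite sets \<open>F\<^sub>n\<close> that all later subgroups avoid. Then the images of the
  \<open>x\<^sub>n\<close> are pairwise incongruent modulo \<open>H = \<Union>E\<^sub>n\<close>, and \<open>(H + H\<gamma>)/H\<close> is infinite.
\<close>

lemma greedy_finite_witness:
  assumes hom: "\<gamma> \<in> hom G G" and tor: "carrier G = torsion_part G"
    and ap: "\<And>H. subgroup H G \<Longrightarrow> almost_preserves G \<gamma> H"
  shows "\<exists>E F. subgroup E G \<and> finite E \<and> finite F \<and> E \<inter> F = {} \<and>
    (\<forall>H. subgroup H G \<longrightarrow> E \<subseteq> H \<longrightarrow> H \<inter> F = {} \<longrightarrow> (\<forall>h\<in>H. \<exists>h'\<in>H. \<exists>e\<in>E. \<gamma> h = h' \<otimes> \<gamma> e))"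
proof (rule ccontr)
  assume neg: "\<not> ?thesis"
  have gc: "\<gamma> x \<in> carrier G" if "x \<in> carrier G" for x using hom_in_carrier[OF hom that] .
  define P where "P = (\<lambda>(n::nat) (E, F, x). subgroup E G \<and> finite E \<and> finite F \<and> E \<inter> F = {} \<and> x \<in> E)"
  define Q where "Q = (\<lambda>(n::nat) (E, F, x::'a) (E', F', x'). E \<subseteq> E' \<and> F \<subseteq> F' \<and> (\<forall>e\<in>E. \<gamma> x' \<otimes> inv (\<gamma> e) \<in> F'))"
  \<comment> \<open>A state consists of \<open>E\<^sub>n\<close>, \<open>F\<^sub>n\<close> and the element chosen last.\<close>
  have "\<exists>s. \<forall>n. P n (s n) \<and> Q n (s n) (s (Suc n))"
  proof (rule dependent_nat_choice)
    show "\<exists>s. P 0 s" unfolding P_def using triv_subgroup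
      by (intro exI[of _ "({\<one>}, {}, \<one>)"]) auto
    fix s n assume s: "P n s"
    obtain E F x where sE: "s = (E, F, x)" by (cases s)
    have E: "subgroup E G" "finite E" "finite F" "E \<inter> F = {}" using s unfolding P_def sE by auto
    obtain H y where H: "subgroup H G" "E \<subseteq> H" "H \<inter> F = {}" "y \<in> H"
      and y: "\<And>h' e. h' \<in> H \<Longrightarrow> e \<in> E \<Longrightarrow> \<gamma> y \<noteq> h' \<otimes> \<gamma> e"
      using neg E by metis
    have Hc: "H \<subseteq> carrier G" using subgroup.subset[OF H(1)] .
    have "insert y E \<subseteq> torsion_part G" using H Hc tor by blast
    then obtain E' where E': "subgroup E' G" "finite E'" "insert y E \<subseteq> E'" "E' \<subseteq> H"
      using finite_subgroup_cover[of "insert y E" H] E H by auto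
    define F' where "F' = F \<union> (\<lambda>e. \<gamma> y \<otimes> inv (\<gamma> e)) ` E"
    have "\<gamma> y \<otimes> inv (\<gamma> e) \<notin> H" if "e \<in> E" for e
    proof
      assume *: "\<gamma> y \<otimes> inv (\<gamma> e) \<in> H"
      have "\<gamma> y = (\<gamma> y \<otimes> inv (\<gamma> e)) \<otimes> \<gamma> e"
        by (rule abelian_normal_form2[of "\<gamma> y" "\<gamma> e"]) (use that H Hc gc in auto)
      then show False using y[OF * that] by metis
    qed
    then have "E' \<inter> F' = {}" using E'(4) H(3) unfolding F'_def by auto
    then show "\<exists>s'. P (Suc n) s' \<and> Q n s s'"
      using E E' unfolding P_def Q_def sE F'_def
      by (intro exI[of _ "(E', F', y)"]) (auto simp: F'_def)
  qed
  then obtain s where s: "\<And>n. P n (s n)" "\<And>n. Q n (s n) (s (Suc n))" by auto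
  define E where "E n = fst (s n)" for n
  define F where "F n = fst (snd (s n))" for n
  define x where "x n = snd (snd (s n))" for n
  have sn: "s n = (E n, F n, x n)" for n by (simp add: E_def F_def x_def)
  have 1: "subgroup (E n) G" "E n \<inter> F n = {}" "x n \<in> E n" for n
    using s(1)[of n] unfolding P_def sn by auto
  have 2: "E n \<subseteq> E (Suc n)" "F n \<subseteq> F (Suc n)" "\<And>e. e \<in> E n \<Longrightarrow> \<gamma> (x (Suc n)) \<otimes> inv (\<gamma> e) \<in> F (Suc n)" for n
    using s(2)[of n] unfolding Q_def sn by auto
  have mE: "E m \<subseteq> E n" if "m \<le> n" for m n using lift_Suc_mono_le[of E] 2(1) that by auto
  have mF: "F m \<subseteq> F n" if "m \<le> n" for m n using lift_Suc_mono_le[of F] 2(2) that by auto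
  define H where "H = (\<Union>n. E n)"
  have H: "subgroup H G"
  proof (rule subgroupI)
    show "H \<subseteq> carrier G" unfolding H_def using 1(1) subgroup.subset by auto
    show "H \<noteq> {}" unfolding H_def using 1(3) by auto
    show "inv a \<in> H" if "a \<in> H" for a
      using that 1(1) subgroup.m_inv_closed unfolding H_def by fastforce
    fix a b assume "a \<in> H" "b \<in> H"
    then obtain m n where "a \<in> E m" "b \<in> E n" unfolding H_def by auto
    then have "a \<in> E (max m n)" "b \<in> E (max m n)" using mE[of m "max m n"] mE[of n "max m n"] by auto
    then have "a \<otimes> b \<in> E (max m n)" using 1(1) subgroup.m_closed by metis
    then show "a \<otimes> b \<in> H" unfolding H_def by auto
  qed
  obtain \<Phi> where Phi: "finite \<Phi>" "\<Phi> \<subseteq> carrier G" "\<And>h. h \<in> H \<Longrightarrow> \<exists>h'\<in>H. \<exists>f\<in>\<Phi>. \<gamma> h = h' \<otimes> f"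
    using ap[OF H] unfolding almost_preserves_def by auto
  have xH: "x n \<in> H" for n using 1(3) unfolding H_def by auto
  have "\<forall>n. \<exists>f. f \<in> \<Phi> \<and> (\<exists>h'\<in>H. \<gamma> (x n) = h' \<otimes> f)" using Phi(3) xH by meson
  then obtain f where f: "\<And>n. f n \<in> \<Phi>" "\<And>n. \<exists>h'\<in>H. \<gamma> (x n) = h' \<otimes> f n" by metis
  \<comment> \<open>Two of the \<open>x\<^sub>n\<close> need the same element of \<open>\<Phi>\<close>.\<close>
  have "finite (range f)" using f(1) Phi(1) by (meson finite_subset image_subsetI)
  then have "\<not> inj f" using finite_imageD infinite_UNIV_nat by blast
  then obtain i j where "f i = f j" "i < j" unfolding inj_def by (metis linorder_neqE_nat)
  then obtain h h' where h: "h \<in> H" "h' \<in> H" "\<gamma> (x i) = h \<otimes> f j" "\<gamma> (x j) = h' \<otimes> f j" "i < j"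
    using f(2)[of i] f(2)[of j] by auto
  have hc: "h \<in> carrier G" "h' \<in> carrier G" "f j \<in> carrier G"
    using h H subgroup.subset f(1)[of j] Phi by auto
  have "\<gamma> (x j) \<otimes> inv (\<gamma> (x i)) = h' \<otimes> inv h"
    unfolding h(3,4) by (rule abelian_normal_form3[of h h' "f j"]) (use hc in simp_all)
  then have "\<gamma> (x j) \<otimes> inv (\<gamma> (x i)) \<in> H"
    using h(1,2) H subgroup.m_closed subgroup.m_inv_closed by metis
  then obtain m where m: "\<gamma> (x j) \<otimes> inv (\<gamma> (x i)) \<in> E m" unfolding H_def by auto
  obtain k where k: "j = Suc k" "i \<le> k" using h(5) by (cases j) auto
  have "x i \<in> E k" using mE[OF k(2)] 1(3) by auto
  then have "\<gamma> (x j) \<otimes> inv (\<gamma> (x i)) \<in> F j" using 2(3) k by auto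
  then have "\<gamma> (x j) \<otimes> inv (\<gamma> (x i)) \<in> F (max m j) \<inter> E (max m j)"
    using m mE[of m "max m j"] mF[of j "max m j"] by auto
  then show False using 1(2)[of "max m j"] by auto
qed

text \<open>
  The previous lemma for the subgroups \<open>E + \<langle>x\<rangle>\<close>: for every \<open>x\<close> whose cyclic subgroup avoids the finite
  set \<open>W\<close>, the image \<open>x\<gamma>\<close> is a multiple of \<open>x\<close> modulo a fixed finite subgroup.
\<close>

lemma local_powers_outside_finite:
  assumes hom: "\<gamma> \<in> hom G G" and tor: "carrier G = torsion_part G"
    and ap: "\<And>H. subgroup H G \<Longrightarrow> almost_preserves G \<gamma> H"
  obtains E W where "subgroup E G" "finite E" "finite W" "W \<subseteq> carrier G" "\<one> \<notin> W"
    "\<And>x. x \<in> carrier G \<Longrightarrow> (\<And>i::int. x [^] i \<notin> W) \<Longrightarrow> \<exists>i::int. \<gamma> x \<otimes> inv (x [^] i) \<in> E"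
proof -
  obtain E F where E: "subgroup E G" "finite E" "finite F" "E \<inter> F = {}"
    and EF: "\<And>H h. subgroup H G \<Longrightarrow> E \<subseteq> H \<Longrightarrow> H \<inter> F = {} \<Longrightarrow> h \<in> H \<Longrightarrow> \<exists>h'\<in>H. \<exists>e\<in>E. \<gamma> h = h' \<otimes> \<gamma> e"
    using greedy_finite_witness[OF hom tor ap] by metis
  have gc: "\<gamma> x \<in> carrier G" if "x \<in> carrier G" for x using hom_in_carrier[OF hom that] .
  have Ec: "E \<subseteq> carrier G" using subgroup.subset[OF E(1)] .
  interpret g: group_hom G G \<gamma> by unfold_locales (use hom in auto)
  have gE: "subgroup (\<gamma> ` E) G" using g.subgroup_img_is_subgroup[OF E(1)] .
  define W where "W = (\<lambda>(f, e). f \<otimes> inv e) ` ((F \<inter> carrier G) \<times> E)"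
  have "finite W" unfolding W_def using E by auto
  moreover have "W \<subseteq> carrier G" unfolding W_def using Ec by auto
  moreover have "\<one> \<notin> W"
  proof
    assume "\<one> \<in> W"
    then obtain f e where fe: "f \<in> F" "f \<in> carrier G" "e \<in> E" "\<one> = f \<otimes> inv e" unfolding W_def by auto
    then have "f = e" using Ec by (metis inv_equality inv_closed inv_inv subsetD)
    then show False using fe E by auto
  qed
  moreover have "\<exists>i::int. \<gamma> x \<otimes> inv (x [^] i) \<in> E <#> (\<gamma> ` E)"
    if x: "x \<in> carrier G" and xW: "\<And>i::int. x [^] i \<notin> W" for x
  proof -
    let ?C = "range (\<lambda>i::int. x [^] i)"
    have C: "subgroup ?C G" using subgroup_cyclic x .
    have "(E <#> ?C) \<inter> F = {}"
    proof (rule ccontr)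
      assume "(E <#> ?C) \<inter> F \<noteq> {}"
      then obtain e i where e: "e \<in> E" "e \<otimes> x [^] (i::int) \<in> F" unfolding set_mult_def by auto
      have "x [^] i = (e \<otimes> x [^] i) \<otimes> inv e"
        by (rule abelian_normal_form2[of e x]) (use e x Ec in auto)
      moreover have "(e \<otimes> x [^] i) \<otimes> inv e \<in> W" unfolding W_def using e x Ec by (auto intro!: image_eqI[of _ _ "(e \<otimes> x [^] i, e)"])
      ultimately show False using xW[of i] by metis
    qed
    moreover have "x \<in> E <#> ?C"
      using subset_set_mult_right[OF E(1) C] int_pow_1[OF x] by (metis rangeI subsetD)
    ultimately obtain h' e where he: "h' \<in> E <#> ?C" "e \<in> E" "\<gamma> x = h' \<otimes> \<gamma> e"
      using EF[OF mult_subgroups[OF E(1) C] subset_set_mult_left[OF E(1) C]] by blast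
    then obtain e' i where ei: "e' \<in> E" "h' = e' \<otimes> x [^] (i::int)" unfolding set_mult_def by auto
    have "\<gamma> x \<otimes> inv (x [^] i) = e' \<otimes> \<gamma> e"
      unfolding he(3) ei(2) by (rule abelian_normal_form3[of x e' "\<gamma> e"]) (use ei he(2) x Ec gc in auto)
    moreover have "e' \<otimes> \<gamma> e \<in> E <#> (\<gamma> ` E)" using ei he unfolding mem_set_mult by blast
    ultimately show ?thesis by metis
  qed
  ultimately show thesis
    using that[OF mult_subgroups[OF E(1) gE] finite_set_mult[OF E(2) finite_imageI[OF E(2)]]] by blast
qed

lemma pow_gcd_mem:
  assumes "subgroup E G" "x \<in> carrier G" "x [^] (a::int) \<in> E" "x [^] (b::int) \<in> E"
  shows "x [^] (gcd a b) \<in> E"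
proof -
  obtain u v where "u * a + v * b = gcd a b" using bezout_int by blast
  then have "x [^] gcd a b = (x [^] a) [^] u \<otimes> (x [^] b) [^] v"
    using assms(2) by (simp add: int_pow_pow int_pow_mult[symmetric] mult.commute)
  then show ?thesis using assms subgroup_int_pow_closed subgroup.m_closed by metis
qed

lemma pow_dvd_mem:
  assumes "subgroup E G" "x \<in> carrier G" "x [^] (a::int) \<in> E" "a dvd b"
  shows "x [^] b \<in> E"
proof -
  obtain c where "b = a * c" using assms(4) by auto
  then have "x [^] b = (x [^] a) [^] c" using assms(2) by (simp add: int_pow_pow)
  then show ?thesis using assms subgroup_int_pow_closed by metis
qed

text \<open>
  \<open>p\<^sup>i\<close> is the order of \<open>x\<close> modulo \<open>E\<close>.
\<close>

lemma prime_power_order_mod: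
  assumes "subgroup E G" "x \<in> carrier G" "Factorial_Ring.prime (p::int)" "x [^] (p ^ i) \<in> E"
    "\<And>k. k < i \<Longrightarrow> x [^] (p ^ k) \<notin> E"
  shows "x [^] (n::int) \<in> E \<longleftrightarrow> p ^ i dvd n"
proof
  assume "x [^] n \<in> E"
  then have g: "x [^] (gcd n (p ^ i)) \<in> E" using pow_gcd_mem assms by auto
  obtain l where l: "l \<le> i" "gcd n (p ^ i) = p ^ l"
    using divides_primepow[OF assms(3), of "gcd n (p ^ i)" i] by auto
  then have "l = i" using g assms(5)[of l] by (metis nat_less_le)
  then show "p ^ i dvd n" using l by (metis gcd_dvd1)
qed (use pow_dvd_mem[OF assms(1,2,4)] in auto)

text \<open>
  Modulo \<open>E\<close>, an endomorphism that maps each element to a multiple of itself multiplies any finite set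
  of \<open>p\<close>-elements by a common integer. Take the multiplier \<open>s\<close> of an element \<open>a\<close> of maximal order modulo \<open>E\<close>
  and subtract it, so that \<open>\<psi> = \<gamma> - s\<close> kills \<open>a\<close>. If \<open>b\<close> has minimal order with \<open>b\<psi> \<noteq> 0\<close>, then \<open>b\<close> cannot be
  shortened by adding multiples of \<open>a\<close>, hence \<open>\<langle>a\<rangle>\<close> and \<open>\<langle>b\<rangle>\<close> are independent, and
  \<open>b\<psi> = (b + a)\<psi> \<in> \<langle>b + a\<rangle>\<close> forces \<open>b\<psi> = 0\<close>.
\<close>

lemma uniform_power_mod:
  assumes hom: "\<gamma> \<in> hom G G" and E: "subgroup E G" and N: "subgroup N G" and p: "Factorial_Ring.prime (p::int)"
    and pw: "\<And>x. x \<in> N \<Longrightarrow> \<exists>i::int. \<gamma> x \<otimes> inv (x [^] i) \<in> E"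
    and S: "finite S" "S \<subseteq> N" "\<And>x. x \<in> S \<Longrightarrow> \<exists>k::nat. x [^] (p ^ k) \<in> E"
  shows "\<exists>s::int. \<forall>x\<in>S. \<gamma> x \<otimes> inv (x [^] s) \<in> E"
proof (cases "S = {}")
  case False
  define o' where "o' x = (LEAST k. x [^] (p ^ k) \<in> E)" for x
  have o': "x [^] (p ^ o' x) \<in> E" "\<And>k. k < o' x \<Longrightarrow> x [^] (p ^ k) \<notin> E" if "\<exists>k::nat. x [^] (p ^ k) \<in> E" for x
    using LeastI_ex[OF that] not_less_Least[of _ "\<lambda>k. x [^] (p ^ k) \<in> E"] unfolding o'_def by auto
  have Nc: "x \<in> carrier G" if "x \<in> N" for x using N subgroup.mem_carrier that by metis
  have gc: "\<gamma> x \<in> carrier G" if "x \<in> carrier G" for x using hom_in_carrier[OF hom that] .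
  have gm: "\<gamma> (x \<otimes> y) = \<gamma> x \<otimes> \<gamma> y" if "x \<in> carrier G" "y \<in> carrier G" for x y
    using hom_mult[OF hom] that by auto
  interpret g: group_hom G G \<gamma> by unfold_locales (use hom in auto)
  have "Max (o' ` S) \<in> o' ` S" using S False by (intro Max_in) auto
  then obtain a where a: "a \<in> S" "o' a = Max (o' ` S)" by (metis imageE)
  define i where "i = o' a"
  have oi: "o' x \<le> i" if "x \<in> S" for x using that a S unfolding i_def by simp
  have aN: "a \<in> N" and ac: "a \<in> carrier G" using a S Nc by auto
  have ai: "a [^] n \<in> E \<longleftrightarrow> p ^ i dvd n" for n :: int
    unfolding i_def by (rule prime_power_order_mod[OF E ac p]) (use o' S(3)[OF a(1)] in auto)
  obtain s :: int where s: "\<gamma> a \<otimes> inv (a [^] s) \<in> E" using pw[OF aN] by auto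
  define \<psi> where "\<psi> x = \<gamma> x \<otimes> inv (x [^] s)" for x
  have psc: "\<psi> x \<in> carrier G" if "x \<in> carrier G" for x using that gc unfolding \<psi>_def by auto
  have psm: "\<psi> (x \<otimes> y) = \<psi> x \<otimes> \<psi> y" if "x \<in> carrier G" "y \<in> carrier G" for x y
    unfolding \<psi>_def gm[OF that]
    by (rule abelian_normal_form4[of x y "\<gamma> x" "\<gamma> y"]) (use that gc in \<open>simp_all add: algebra_simps\<close>)
  have psp: "\<psi> (x [^] n) = \<psi> x [^] n" if "x \<in> carrier G" for x and n :: int
    unfolding \<psi>_def g.hom_int_pow[OF that]
    by (rule abelian_normal_form2[of x "\<gamma> x"]) (use that gc in \<open>simp_all add: algebra_simps\<close>)
  have pspw: "\<exists>t::int. \<psi> x \<otimes> inv (x [^] t) \<in> E" if "x \<in> N" for x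
  proof -
    obtain u :: int where u: "\<gamma> x \<otimes> inv (x [^] u) \<in> E" using pw[OF \<open>x \<in> N\<close>] by blast
    have "\<psi> x \<otimes> inv (x [^] (u - s)) = \<gamma> x \<otimes> inv (x [^] u)"
      unfolding \<psi>_def
      by (rule abelian_normal_form2[of x "\<gamma> x"]) (use Nc[OF that] gc in \<open>simp_all add: algebra_simps\<close>)
    then show ?thesis using u by metis
  qed
  have key: "\<psi> b \<in> E" if "b \<in> N" "b [^] (p ^ i) \<in> E" for b
  proof (rule ccontr)
    assume "\<psi> b \<notin> E"
    \<comment> \<open>\<open>B j b\<close>: a counterexample \<open>b\<close> with \<open>p\<^sup>j b \<in> E\<close>; the exponent \<open>j\<close> is taken minimal.\<close>
    define B where "B j b \<longleftrightarrow> b \<in> N \<and> b [^] (p ^ i) \<in> E \<and> \<psi> b \<notin> E \<and> b [^] (p ^ j) \<in> E" for j :: nat and b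
    define j where "j = (LEAST j. \<exists>b. B j b)"
    have ex: "\<exists>j. \<exists>b. B j b" using that \<open>\<psi> b \<notin> E\<close> unfolding B_def by blast
    obtain b where b: "B j b" using LeastI_ex[OF ex] unfolding j_def by auto
    have jmin: "\<not> B k c" if "k < j" for k c using not_less_Least[of k "\<lambda>j. \<exists>b. B j b"] that unfolding j_def by auto
    have bN: "b \<in> N" "b [^] (p ^ i) \<in> E" "\<psi> b \<notin> E" "b [^] (p ^ j) \<in> E" using b unfolding B_def by auto
    have bc: "b \<in> carrier G" using bN Nc by auto
    have "j \<le> i" using bN jmin[of i b] unfolding B_def by (meson not_le)
    obtain t :: int where t: "\<psi> b \<otimes> inv (b [^] t) \<in> E" using pspw bN by blast
    have "j \<noteq> 0"
    proof
      assume "j = 0"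
      then have "b \<in> E" using bN bc by simp
      then have "b [^] t \<in> E" using E subgroup_int_pow_closed by auto
      then show False using diff_mem[OF E psc[OF bc]] t bN by auto
    qed
    then obtain j' where j': "j = Suc j'" by (cases j) auto
    have bmin: "b [^] (p ^ j') \<otimes> a [^] (p ^ j' * c) \<notin> E" for c
    proof
      assume *: "b [^] (p ^ j') \<otimes> a [^] (p ^ j' * c) \<in> E"
      let ?b = "b \<otimes> a [^] c"
      have aN': "a [^] c \<in> N" using aN N subgroup_int_pow_closed by auto
      have "?b \<in> N" using aN' bN N subgroup.m_closed by metis
      moreover have "?b [^] (p ^ i) \<in> E"
      proof -
        have "?b [^] (p ^ i) = b [^] (p ^ i) \<otimes> a [^] (p ^ i * c)"
          by (rule abelian_normal_form2[of a b]) (use ac bc in \<open>simp_all add: algebra_simps\<close>)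
        moreover have "a [^] (p ^ i * c) \<in> E" using ai by auto
        ultimately show ?thesis using bN E subgroup.m_closed by metis
      qed
      moreover have "\<psi> ?b \<notin> E"
      proof
        assume "\<psi> ?b \<in> E"
        moreover have "\<psi> (a [^] c) \<in> E" using psp[OF ac] s subgroup_int_pow_closed[OF E] unfolding \<psi>_def by metis
        moreover have "\<psi> b = \<psi> ?b \<otimes> inv (\<psi> (a [^] c))"
        proof -
          have "\<psi> ?b = \<psi> b \<otimes> \<psi> (a [^] c)" using psm ac bc by auto
          then show ?thesis using inv_solve_right[of "\<psi> b" "\<psi> ?b" "\<psi> (a [^] c)"] psc ac bc by auto
        qed
        ultimately show False using bN E subgroup.m_closed subgroup.m_inv_closed by metis
      qed
      moreover have "?b [^] (p ^ j') \<in> E"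
      proof -
        have "?b [^] (p ^ j') = b [^] (p ^ j') \<otimes> a [^] (p ^ j' * c)"
          by (rule abelian_normal_form2[of a b]) (use ac bc in \<open>simp_all add: algebra_simps\<close>)
        then show ?thesis using * by metis
      qed
      ultimately have "B j' ?b" unfolding B_def by auto
      then show False using jmin[of j' ?b] j' by auto
    qed
    have indep: "p ^ j dvd v" if vu: "b [^] v \<otimes> a [^] u \<in> E" for v u :: int
    proof (rule ccontr)
      assume nd: "\<not> p ^ j dvd v"
      obtain l where l: "l \<le> j" "gcd v (p ^ j) = p ^ l"
        using divides_primepow[OF p, of "gcd v (p ^ j)" j] by auto
      have "l \<noteq> j" using l nd by (metis gcd_dvd1)
      then have "l \<le> j'" using l j' by auto
      obtain x y where xy: "x * v + y * p ^ j = p ^ l" using bezout_int l(2) by metis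
      define w where "w = p ^ (j' - l) * x * u"
      have "b [^] (p ^ j') \<otimes> a [^] w = (b [^] v \<otimes> a [^] u) [^] (p ^ (j' - l) * x) \<otimes> (b [^] (p ^ j)) [^] (p ^ (j' - l) * y)"
      proof -
        have "p ^ j' = p ^ (j' - l) * p ^ l" using \<open>l \<le> j'\<close> by (simp flip: power_add)
        also have "\<dots> = v * (p ^ (j' - l) * x) + p ^ j * (p ^ (j' - l) * y)"
          unfolding xy[symmetric] by (simp add: algebra_simps)
        finally have e: "p ^ j' = v * (p ^ (j' - l) * x) + p ^ j * (p ^ (j' - l) * y)" .
        show ?thesis unfolding e w_def
          by (rule abelian_normal_form2[of a b]) (use ac bc in \<open>simp_all add: algebra_simps\<close>)
      qed
      then have 1: "b [^] (p ^ j') \<otimes> a [^] w \<in> E"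
        using vu bN(4) subgroup_int_pow_closed[OF E] subgroup.m_closed[OF E] by metis
      have "a [^] (p * w) = (b [^] (p ^ j') \<otimes> a [^] w) [^] p \<otimes> inv (b [^] (p ^ j))"
        by (rule abelian_normal_form2[of a b]) (use ac bc j' in \<open>simp_all add: algebra_simps\<close>)
      then have "a [^] (p * w) \<in> E"
        using 1 bN(4) subgroup_int_pow_closed[OF E] subgroup.m_closed[OF E] subgroup.m_inv_closed[OF E] by metis
      then have "p ^ i dvd p * w" using ai by auto
      then have "p ^ j dvd p * w" using \<open>j \<le> i\<close> by (meson dvd_trans le_imp_power_dvd)
      then have "p ^ j' dvd w" using j' p by auto
      then show False using bmin 1 by (metis dvdE)
    qed
    have abN: "b \<otimes> a \<in> N" using aN bN N subgroup.m_closed by metis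
    obtain u :: int where u: "\<psi> (b \<otimes> a) \<otimes> inv ((b \<otimes> a) [^] u) \<in> E" using pspw[OF abN] by auto
    have psa: "\<psi> a \<in> E" using s unfolding \<psi>_def .
    have 1: "\<psi> b \<otimes> inv (b [^] u \<otimes> a [^] u) \<in> E"
    proof -
      have "\<psi> b \<otimes> inv (b [^] u \<otimes> a [^] u) = (\<psi> (b \<otimes> a) \<otimes> inv ((b \<otimes> a) [^] u)) \<otimes> inv (\<psi> a)"
        unfolding psm[OF bc ac]
        by (rule abelian_normal_form4[of a b "\<psi> a" "\<psi> b"]) (use ac bc psc in \<open>simp_all add: algebra_simps\<close>)
      then show ?thesis using u psa subgroup.m_closed[OF E] subgroup.m_inv_closed[OF E] by metis
    qed
    have "b [^] (t - u) \<otimes> a [^] (- u) = (\<psi> b \<otimes> inv (b [^] u \<otimes> a [^] u)) \<otimes> inv (\<psi> b \<otimes> inv (b [^] t))"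
      by (rule abelian_normal_form3[of a b "\<psi> b"]) (use ac bc psc in \<open>simp_all add: algebra_simps\<close>)
    then have tu: "b [^] (t - u) \<otimes> a [^] (- u) \<in> E"
      using 1 t subgroup.m_closed[OF E] subgroup.m_inv_closed[OF E] by metis
    have d1: "p ^ j dvd t - u" using indep[OF tu] .
    then have btu: "b [^] (t - u) \<in> E" using pow_dvd_mem[OF E bc bN(4)] by auto
    have "a [^] u = inv (b [^] (t - u) \<otimes> a [^] (- u)) \<otimes> b [^] (t - u)"
      by (rule abelian_normal_form2[of a b]) (use ac bc in \<open>simp_all add: algebra_simps\<close>)
    then have "a [^] u \<in> E" using tu btu subgroup.m_closed[OF E] subgroup.m_inv_closed[OF E] by metis
    then have "p ^ j dvd u" using ai \<open>j \<le> i\<close> by (meson dvd_trans le_imp_power_dvd)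
    then have "p ^ j dvd t" using d1 by (metis dvd_add diff_add_cancel)
    then have "b [^] t \<in> E" using pow_dvd_mem[OF E bc bN(4)] by auto
    then show False using diff_mem[OF E psc[OF bc]] t bN by auto
  qed
  show ?thesis
  proof (intro exI ballI)
    fix x assume x: "x \<in> S"
    have "x [^] (p ^ i) \<in> E"
      using pow_dvd_mem[OF E _ o'(1)[OF S(3)[OF x]]] oi[OF x] le_imp_power_dvd[of "o' x" i p] Nc S x by blast
    then show "\<gamma> x \<otimes> inv (x [^] s) \<in> E" using key x S unfolding \<psi>_def by auto
  qed
qed auto

end

section \<open>Torsion groups: bounded, generic and divisible elements\<close>

context comm_group
begin

lemma maximal_subgroup_avoiding:
  assumes "subgroup H G" "H \<inter> W = {}"
  shows "\<exists>M. subgroup M G \<and> H \<subseteq> M \<and> M \<inter> W = {} \<and>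
    (\<forall>M'. subgroup M' G \<longrightarrow> M \<subseteq> M' \<longrightarrow> M' \<inter> W = {} \<longrightarrow> M' = M)"
proof -
  define \<A> where "\<A> = {M. subgroup M G \<and> H \<subseteq> M \<and> M \<inter> W = {}}"
  have "\<exists>M\<in>\<A>. \<forall>K\<in>\<A>. M \<subseteq> K \<longrightarrow> K = M"
  proof (rule subset_Zorn_nonempty)
    show "\<A> \<noteq> {}" using assms unfolding \<A>_def by auto
    fix C assume C: "C \<noteq> {}" "subset.chain \<A> C"
    then have CA: "C \<subseteq> \<A>" and lin: "\<And>K L. K \<in> C \<Longrightarrow> L \<in> C \<Longrightarrow> K \<subseteq> L \<or> L \<subseteq> K"
      unfolding subset_chain_def by auto
    have sg: "subgroup K G" if "K \<in> C" for K using CA that unfolding \<A>_def by auto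
    have "subgroup (\<Union> C) G"
    proof (rule subgroupI)
      show "\<Union> C \<subseteq> carrier G" using subgroup.subset[OF sg] by auto
      obtain K where "K \<in> C" using C by auto
      then show "\<Union> C \<noteq> {}" using subgroup.one_closed[OF sg] by auto
      show "inv a \<in> \<Union> C" if "a \<in> \<Union> C" for a
        using that subgroup.m_inv_closed[OF sg] by auto
      fix a b assume "a \<in> \<Union> C" "b \<in> \<Union> C"
      then obtain K L where KL: "K \<in> C" "L \<in> C" "a \<in> K" "b \<in> L" by auto
      then obtain N where "N \<in> C" "a \<in> N" "b \<in> N" using lin[OF KL(1,2)] by auto
      then show "a \<otimes> b \<in> \<Union> C" using subgroup.m_closed[OF sg] by auto
    qed
    moreover have "H \<subseteq> \<Union> C" "\<Union> C \<inter> W = {}" using C CA unfolding \<A>_def by auto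
    ultimately show "\<Union> C \<in> \<A>" unfolding \<A>_def by auto
  qed
  then obtain M where M: "M \<in> \<A>" and max: "\<And>K. K \<in> \<A> \<Longrightarrow> M \<subseteq> K \<Longrightarrow> K = M" by blast
  have "M' = M" if "subgroup M' G" "M \<subseteq> M'" "M' \<inter> W = {}" for M'
    using max[of M'] M that unfolding \<A>_def by blast
  then show ?thesis using M unfolding \<A>_def by blast
qed

lemma insert_subgroup:
  assumes "subgroup M G" "x \<in> carrier G"
  shows "subgroup (M <#> range (\<lambda>i::int. x [^] i)) G" "M \<subseteq> M <#> range (\<lambda>i::int. x [^] i)"
    "x \<in> M <#> range (\<lambda>i::int. x [^] i)"
  using mult_subgroups[OF assms(1) subgroup_cyclic[OF assms(2)]]
    subset_set_mult_left[OF assms(1) subgroup_cyclic[OF assms(2)]]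
    subset_set_mult_right[OF assms(1) subgroup_cyclic[OF assms(2)]] int_pow_1[OF assms(2)]
  by (auto, metis rangeI subsetD)

text \<open>
  If \<open>M\<close> is a maximal subgroup avoiding the finite set \<open>W\<close>, then every nonzero cyclic subgroup of \<open>G/M\<close>
  meets the image of \<open>W\<close>. So \<open>G/M\<close> has finitely many elements of prime order \<open>p\<close>, and therefore, step by
  step, of every exponent \<open>n\<close>.
\<close>

lemma finite_index_roots:
  assumes tor: "carrier G = torsion_part G" and W: "finite W" "W \<subseteq> carrier G"
    and M: "subgroup M G" "M \<inter> W = {}"
    and max: "\<And>M'. subgroup M' G \<Longrightarrow> M \<subseteq> M' \<Longrightarrow> M' \<inter> W = {} \<Longrightarrow> M' = M"
    and n: "(n::int) \<noteq> 0"
  shows "finite_index {x \<in> carrier G. x [^] n \<in> M} M"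
  using n
proof (induction n rule: prime_divisors_induct)
  case (unit n)
  then have n: "n dvd 1" by simp
  have "{x \<in> carrier G. x [^] n \<in> M} \<subseteq> M"
  proof safe
    fix x assume x: "x \<in> carrier G" "x [^] n \<in> M"
    have "x [^] (1::int) \<in> M" using pow_dvd_mem[OF M(1) x n] .
    then show "x \<in> M" using x by simp
  qed
  then show ?case using finite_index_refl M subgroup_power_preimage by auto
next
  case (factor p m)
  have Mc: "M \<subseteq> carrier G" using subgroup.subset[OF M(1)] .
  define C where "C n = {x \<in> carrier G. x [^] (n::int) \<in> M}" for n
  have sC: "subgroup (C n) G" for n unfolding C_def using subgroup_power_preimage[OF M(1)] .
  \<comment> \<open>The elements of order \<open>p\<close> modulo \<open>M\<close> are represented in the finite subgroup generated by \<open>W\<close>.\<close>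
  obtain R where R: "subgroup R G" "finite R" "W \<subseteq> R"
    using finite_subgroup_cover[OF W(1), of "carrier G"] W tor subgroup_self by auto
  have Rc: "R \<subseteq> carrier G" using subgroup.subset[OF R(1)] .
  have "finite_index (C p) M"
  proof (rule finite_index_cover[OF M(1)])
    show "finite R" "R \<subseteq> carrier G" "C p \<subseteq> carrier G" using R Rc unfolding C_def by auto
    fix t assume t: "t \<in> C p"
    then have tc: "t \<in> carrier G" and tp: "t [^] p \<in> M" unfolding C_def by auto
    show "\<exists>r\<in>R. t \<otimes> inv r \<in> M"
    proof (cases "t \<in> M")
      case True
      then show ?thesis using subgroup.one_closed[OF R(1)] tc by (intro bexI[of _ \<one>]) auto
    next
      case False
      let ?M = "M <#> range (\<lambda>i::int. t [^] i)"
      have "?M \<inter> W \<noteq> {}"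
        using max[OF insert_subgroup(1,2)[OF M(1) tc]] insert_subgroup(3)[OF M(1) tc] False by metis
      then obtain a i where ai: "a \<in> M" "a \<otimes> t [^] (i::int) \<in> W" unfolding set_mult_def by auto
      define w where "w = a \<otimes> t [^] i"
      have ac: "a \<in> carrier G" using ai Mc by auto
      have "\<not> p dvd i"
      proof
        assume "p dvd i"
        then have "t [^] i \<in> M" using pow_dvd_mem[OF M(1) tc tp] by auto
        then have "a \<otimes> t [^] i \<in> M" using ai subgroup.m_closed[OF M(1)] by auto
        then show False using ai M(2) by auto
      qed
      then have "coprime i p"
        using prime_imp_coprime[OF factor.hyps(1)] coprime_commute by blast
      then have "gcd i p = 1" by simp
      then obtain u v where uv: "u * i + v * p = 1" using bezout_int by metis
      have "t \<otimes> inv (w [^] u) = (t [^] p) [^] v \<otimes> inv (a [^] u)"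
      proof -
        have "t = t [^] (u * i + v * p)" using uv tc by simp
        then have "t \<otimes> inv (w [^] u) = t [^] (u * i + v * p) \<otimes> inv (w [^] u)" by metis
        also have "\<dots> = (t [^] p) [^] v \<otimes> inv (a [^] u)"
          unfolding w_def
          by (rule abelian_normal_form2[of t a]) (use tc ac in \<open>simp_all add: algebra_simps\<close>)
        finally show ?thesis .
      qed
      also have "\<dots> \<in> M"
        using tp ai subgroup_int_pow_closed[OF M(1)] subgroup.m_closed[OF M(1)] subgroup.m_inv_closed[OF M(1)] by metis
      finally have "t \<otimes> inv (w [^] u) \<in> M" .
      moreover have "w [^] u \<in> R" using ai R subgroup_int_pow_closed[OF R(1)] unfolding w_def by auto
      ultimately show ?thesis by blast
    qed
  qed
  then obtain S where S: "finite S" "S \<subseteq> C p" "\<And>h. h \<in> C p \<Longrightarrow> \<exists>r\<in>S. h \<otimes> inv r \<in> M"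
    unfolding finite_index_def by auto
  have Cc: "C k \<subseteq> carrier G" for k unfolding C_def by auto
  have pow: "x [^] m \<in> C p" if "x \<in> C (p * m)" for x
    using that unfolding C_def by (auto simp: int_pow_pow mult.commute)
  \<comment> \<open>Modulo \<open>M\<close>, multiplication by \<open>m\<close> maps \<open>C (p * m)\<close> to the finite \<open>C p\<close> with kernel \<open>C m\<close>.\<close>
  define f where "f x = (SOME r. r \<in> S \<and> x [^] m \<otimes> inv r \<in> M)" for x
  have f: "f x \<in> S \<and> x [^] m \<otimes> inv (f x) \<in> M" if "x \<in> C (p * m)" for x
    using someI_ex[of "\<lambda>r. r \<in> S \<and> x [^] m \<otimes> inv r \<in> M"] S(3)[OF pow[OF that]] unfolding f_def by blast
  have "finite_index (C (p * m)) (C m)"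
  proof (rule finite_index_by_map[of f])
    show "finite (f ` C (p * m))" using f S(1) by (meson finite_subset image_subsetI)
    fix x y assume xy: "x \<in> C (p * m)" "y \<in> C (p * m)" "f x = f y"
    then have c: "x \<in> carrier G" "y \<in> carrier G" "f y \<in> carrier G" using Cc f[OF xy(2)] S(2) by blast+
    have "y [^] m \<otimes> inv (f y) \<in> M" "x [^] m \<otimes> inv (f y) \<in> M" using f[OF xy(1)] f[OF xy(2)] xy(3) by auto
    then have "x [^] m \<otimes> inv (y [^] m) \<in> M"
      using diff_trans[OF M(1), of "x [^] m" "f y" "y [^] m"] diff_sym[OF M(1), of "y [^] m" "f y"] c by auto
    moreover have "x [^] m \<otimes> inv (y [^] m) = (x \<otimes> inv y) [^] m"
      by (rule abelian_normal_form2[of x y]) (use c in \<open>simp_all\<close>)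
    ultimately show "x \<otimes> inv y \<in> C m" unfolding C_def using c by auto
  qed
  moreover have "finite_index (C m) M" using factor unfolding C_def by auto
  ultimately show ?case using finite_index_trans[OF _ _ M(1) sC sC] unfolding C_def by auto
qed auto

text \<open>
  If \<open>p\<^sup>k G\<close> has infinite \<open>p\<close>-socle for every \<open>k\<close>, then every \<open>p\<close>-element \<open>x\<close> is mapped to a multiple of
  itself modulo \<open>E\<close>, with no exception. Indeed there is a \<open>p\<close>-element \<open>b\<close> of larger order than \<open>x\<close> and
  independent of \<open>W\<close>, \<open>E\<close>, \<open>x\<close> and \<open>x\<gamma>\<close>. Then \<open>\<langle>b\<rangle>\<close> and \<open>\<langle>b + x\<rangle>\<close> avoid \<open>W\<close>, and independence makes the multipliers of \<open>b\<close> and \<open>b + x\<close> agree.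
\<close>

lemma generic_element_power:
  assumes hom: "\<gamma> \<in> hom G G" and tor: "carrier G = torsion_part G"
    and E: "subgroup E G" "finite E" and W: "finite W" "W \<subseteq> carrier G" "\<one> \<notin> W"
    and EW: "\<And>x. x \<in> carrier G \<Longrightarrow> (\<And>i::int. x [^] i \<notin> W) \<Longrightarrow> \<exists>i::int. \<gamma> x \<otimes> inv (x [^] i) \<in> E"
    and p: "Factorial_Ring.prime (p::int)"
    and inf: "\<And>k::nat. infinite {t \<in> carrier G. t [^] p = \<one> \<and> (\<exists>u\<in>carrier G. t = u [^] (p ^ k))}"
    and x: "x \<in> carrier G" "x [^] (p ^ k) = \<one>"
  shows "\<exists>i::int. \<gamma> x \<otimes> inv (x [^] i) \<in> E"
proof -
  have gc: "\<gamma> x \<in> carrier G" if "x \<in> carrier G" for x using hom_in_carrier[OF hom that] .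
  have Ec: "E \<subseteq> carrier G" using subgroup.subset[OF E(1)] .
  obtain V where V: "subgroup V G" "finite V" "W \<union> E \<union> {x, \<gamma> x} \<subseteq> V"
    using finite_subgroup_cover[of "W \<union> E \<union> {x, \<gamma> x}" "carrier G"] W E Ec x gc tor subgroup_self by auto
  \<comment> \<open>\<open>p\<^sup>k b\<close> lies in the socle but not in \<open>V\<close>, so that \<open>\<langle>b\<rangle> \<inter> V = 0\<close>.\<close>
  obtain t where t: "t \<in> {t \<in> carrier G. t [^] p = \<one> \<and> (\<exists>u\<in>carrier G. t = u [^] (p ^ k))}" "t \<notin> V"
    using inf[of k] V(2) by (meson finite_subset subsetI)
  then obtain b where b: "b \<in> carrier G" "t = b [^] (p ^ k)" "b [^] (p ^ k) \<notin> V" "t [^] p = \<one>" by auto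
  have bp: "b [^] (p ^ Suc k) = \<one>" using b by (simp add: int_pow_pow mult.commute)
  have bV: "b [^] j \<in> V \<longleftrightarrow> p ^ Suc k dvd j" for j :: int
  proof (rule prime_power_order_mod[OF V(1) b(1) p])
    show "b [^] (p ^ Suc k) \<in> V" using bp subgroup.one_closed[OF V(1)] by simp
    fix l assume "l < Suc k"
    then have "p ^ l dvd p ^ k" by (simp add: le_imp_power_dvd)
    then show "b [^] (p ^ l) \<notin> V" using b(3) pow_dvd_mem[OF V(1) b(1)] by blast
  qed
  have b1: "b [^] j = \<one>" if "p ^ Suc k dvd j" for j :: int
    using pow_dvd_mem[OF triv_subgroup b(1) _ that] bp by simp
  have x1: "x [^] j = \<one>" if "p ^ Suc k dvd j" for j :: int
  proof -
    have "p ^ k dvd j" using that by (metis dvd_trans dvd_triv_right power_Suc)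
    then show ?thesis using pow_dvd_mem[OF triv_subgroup x(1), of "p ^ k" j] x(2) by simp
  qed
  have "b [^] j \<notin> W" for j :: int
    using bV[of j] b1[of j] V(3) W(3) by auto
  then obtain s' where s': "\<gamma> b \<otimes> inv (b [^] (s'::int)) \<in> E" using EW[OF b(1)] by blast
  have bxc: "b \<otimes> x \<in> carrier G" using b x by auto
  have bx: "(b \<otimes> x) [^] j \<notin> W" for j :: int
  proof
    assume *: "(b \<otimes> x) [^] j \<in> W"
    have "b [^] j = (b \<otimes> x) [^] j \<otimes> inv (x [^] j)"
      by (rule abelian_normal_form2[of x b]) (use x b in simp_all)
    moreover have "x [^] j \<in> V" using V(1,3) subgroup_int_pow_closed by auto
    moreover have "(b \<otimes> x) [^] j \<in> V" using * V(3) by auto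
    ultimately have "b [^] j \<in> V" using subgroup.m_closed[OF V(1)] subgroup.m_inv_closed[OF V(1)] by metis
    then have "b [^] j = \<one>" "x [^] j = \<one>" using bV b1 x1 by auto
    then have "(b \<otimes> x) [^] j = \<one>" using int_pow_distrib[OF b(1) x(1), of j] by simp
    then show False using * W(3) by auto
  qed
  obtain s where s: "\<gamma> (b \<otimes> x) \<otimes> inv ((b \<otimes> x) [^] (s::int)) \<in> E" using EW[OF bxc bx] by blast
  have gm: "\<gamma> (b \<otimes> x) = \<gamma> b \<otimes> \<gamma> x" using hom_mult[OF hom] b x by auto
  define e where "e = (\<gamma> (b \<otimes> x) \<otimes> inv ((b \<otimes> x) [^] s)) \<otimes> inv (\<gamma> b \<otimes> inv (b [^] s'))"
  have e: "e \<in> E" using s s' subgroup.m_closed[OF E(1)] subgroup.m_inv_closed[OF E(1)] unfolding e_def by metis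
  have 1: "e = \<gamma> x \<otimes> inv (x [^] s) \<otimes> b [^] (s' - s)"
    unfolding e_def gm
    by (rule abelian_normal_form4[of b x "\<gamma> b" "\<gamma> x"]) (use x b gc in \<open>simp_all add: algebra_simps\<close>)
  have "b [^] (s' - s) = e \<otimes> inv (\<gamma> x) \<otimes> x [^] s"
    unfolding 1 by (rule abelian_normal_form3[of b x "\<gamma> x"]) (use x b gc in \<open>simp_all add: algebra_simps\<close>)
  moreover have "e \<in> V" "\<gamma> x \<in> V" "x [^] s \<in> V" using e V(1,3) subgroup_int_pow_closed by auto
  ultimately have "b [^] (s' - s) \<in> V" using subgroup.m_closed[OF V(1)] subgroup.m_inv_closed[OF V(1)] by metis
  then have "b [^] (s' - s) = \<one>" using bV b1 by auto
  then have "\<gamma> x \<otimes> inv (x [^] s) \<in> E" using 1 e x gc by simp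
  then show ?thesis by blast
qed

text \<open>
  The elements \<open>f 0, f 1, \<dots>\<close> generate a \<open>p\<close>-divisible \<open>p\<close>-group \<open>Q\<close>. As \<open>(Q + Q\<gamma>)/Q\<close> is finite as well as
  \<open>p\<close>-divisible, it is trivial, whence \<open>(f 0)\<gamma>\<close> lies in some \<open>\<langle>f l\<rangle>\<close>. Its order divides that of \<open>f 0\<close>, so
  it is a multiple of \<open>f 0\<close>.
\<close>

lemma divisible_chain_power:
  assumes hom: "\<gamma> \<in> hom G G" and ap: "\<And>H. subgroup H G \<Longrightarrow> almost_preserves G \<gamma> H"
    and p: "Factorial_Ring.prime (p::int)"
    and f: "\<And>n::nat. f n \<in> carrier G" "\<And>n. f n = f (Suc n) [^] p" and x: "f 0 [^] (p ^ k) = \<one>"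
  shows "\<exists>i::int. \<gamma> (f 0) = f 0 [^] i"
proof -
  have gc: "\<gamma> x \<in> carrier G" if "x \<in> carrier G" for x using hom_in_carrier[OF hom that] .
  interpret g: group_hom G G \<gamma> by unfold_locales (use hom in auto)
  have shift: "f m = f (m + n) [^] (p ^ n)" for m n
  proof (induction n)
    case (Suc n)
    then show ?case using f(2)[of "m + n"] f(1) by (simp add: int_pow_pow)
  qed (use f(1) in simp)
  define Q where "Q = {y. \<exists>n i. y = f n [^] (i::int)}"
  have fQ: "f n [^] (i::int) \<in> Q" for n i unfolding Q_def by auto
  have Q: "subgroup Q G"
  proof (rule subgroupI)
    show "Q \<subseteq> carrier G" "Q \<noteq> {}" using f(1) unfolding Q_def by auto
    show "inv a \<in> Q" if "a \<in> Q" for a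
      using that f(1) int_pow_neg[symmetric] unfolding Q_def by fastforce
    fix a b assume "a \<in> Q" "b \<in> Q"
    then obtain m i n j where ab: "a = f m [^] (i::int)" "b = f n [^] (j::int)" unfolding Q_def by auto
    have "a = f (m + n) [^] (p ^ n * i)" "b = f (m + n) [^] (p ^ m * j)"
      unfolding ab using shift[of m n] shift[of n m] f(1) by (metis int_pow_pow add.commute)+
    then have "a \<otimes> b = f (m + n) [^] (p ^ n * i + p ^ m * j)" using f(1) by (simp add: int_pow_mult)
    then show "a \<otimes> b \<in> Q" unfolding Q_def by blast
  qed
  obtain \<Phi> where Phi: "finite \<Phi>" "\<Phi> \<subseteq> carrier G" "\<And>h. h \<in> Q \<Longrightarrow> \<exists>h'\<in>Q. \<exists>f\<in>\<Phi>. \<gamma> h = h' \<otimes> f"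
    using ap[OF Q] unfolding almost_preserves_def by auto
  have "f n \<in> Q" for n using fQ[of n 1] f(1) by simp
  then have "\<forall>n. \<exists>g. g \<in> \<Phi> \<and> (\<exists>h'\<in>Q. \<gamma> (f n) = h' \<otimes> g)" using Phi(3) by meson
  then obtain g where g: "\<And>n. g n \<in> \<Phi>" "\<And>n. \<exists>h'\<in>Q. \<gamma> (f n) = h' \<otimes> g n" by metis
  \<comment> \<open>Two of the images \<open>(f m)\<gamma>\<close>, \<open>(f n)\<gamma>\<close> are congruent modulo \<open>Q\<close>.\<close>
  have "finite (range g)" using g(1) Phi(1) by (meson finite_subset image_subsetI)
  then have "\<not> inj g" using finite_imageD infinite_UNIV_nat by blast
  then obtain m n where "g m = g n" "m < n" unfolding inj_def by (metis linorder_neqE_nat)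
  then obtain h h' where h: "h \<in> Q" "h' \<in> Q" "\<gamma> (f m) = h \<otimes> g n" "\<gamma> (f n) = h' \<otimes> g n" "m < n"
    using g(2)[of m] g(2)[of n] by auto
  have hc: "h \<in> carrier G" "h' \<in> carrier G" "g n \<in> carrier G"
    using h subgroup.subset[OF Q] g(1)[of n] Phi by auto
  have "\<gamma> (f n) \<otimes> inv (\<gamma> (f m)) = h' \<otimes> inv h"
    unfolding h(3,4) by (rule abelian_normal_form3[of h h' "g n"]) (use hc in simp_all)
  then have 1: "(\<gamma> (f n) \<otimes> inv (\<gamma> (f m))) [^] (p ^ n) \<in> Q"
    using h(1,2) subgroup.m_closed[OF Q] subgroup.m_inv_closed[OF Q] subgroup_int_pow_closed[OF Q] by metis
  have e1: "\<gamma> (f n) [^] (p ^ n) = \<gamma> (f 0)" using shift[of 0 n] g.hom_int_pow[OF f(1)] by simp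
  have e2: "\<gamma> (f m) [^] (p ^ n) = \<gamma> (f 0) [^] (p ^ (n - m))"
  proof -
    have "p ^ n = p ^ m * p ^ (n - m)" using h(5) by (simp flip: power_add)
    then have "\<gamma> (f m) [^] (p ^ n) = (\<gamma> (f m) [^] (p ^ m)) [^] (p ^ (n - m))"
      using f(1) gc by (simp add: int_pow_pow)
    also have "\<gamma> (f m) [^] (p ^ m) = \<gamma> (f 0)" using shift[of 0 m] g.hom_int_pow[OF f(1)] by simp
    finally show ?thesis .
  qed
  define y where "y = \<gamma> (f 0)"
  have yc: "y \<in> carrier G" using f(1) gc unfolding y_def by auto
  have "(\<gamma> (f n) \<otimes> inv (\<gamma> (f m))) [^] (p ^ n) = \<gamma> (f n) [^] (p ^ n) \<otimes> inv (\<gamma> (f m) [^] (p ^ n))"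
    by (rule abelian_normal_form2[of "\<gamma> (f n)" "\<gamma> (f m)"]) (use f(1) gc in \<open>simp_all\<close>)
  also have "\<dots> = y [^] (1 - p ^ (n - m))"
    unfolding e1 e2 y_def[symmetric] using yc by (simp add: int_pow_diff)
  finally have 2: "y [^] (1 - p ^ (n - m)) \<in> Q" using 1 by simp
  have yk: "y [^] (p ^ k) = \<one>" if "f 0 [^] (p ^ k) = \<one>" for k :: nat
    unfolding y_def using g.hom_int_pow[OF f(1), of 0 "p ^ k"] that by simp
  have 3: "y [^] (p ^ k) \<in> Q" using yk[OF x] subgroup.one_closed[OF Q] by simp
  \<comment> \<open>So \<open>y\<close> is killed modulo \<open>Q\<close> by two coprime integers.\<close>
  have "coprime (1 - p ^ (n - m)) (p ^ k)"
  proof -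
    have "\<not> p dvd 1 - p ^ (n - m)"
    proof
      assume "p dvd 1 - p ^ (n - m)"
      moreover have "p dvd p ^ (n - m)" using h(5) by simp
      ultimately have "p dvd 1" by (metis dvd_add diff_add_cancel)
      then show False using p by auto
    qed
    then have "coprime p (1 - p ^ (n - m))" using p prime_imp_coprime by blast
    then show ?thesis by (simp add: coprime_commute)
  qed
  then have "y [^] (1::int) \<in> Q" using pow_gcd_mem[OF Q yc 2 3] by simp
  then have "y \<in> Q" using yc by simp
  then obtain l r where yr: "y = f l [^] (r::int)" unfolding Q_def by auto
  define k0 where "k0 = (LEAST k. f 0 [^] (p ^ k) = \<one>)"
  have k0: "f 0 [^] (p ^ k0) = \<one>" "\<And>k. k < k0 \<Longrightarrow> f 0 [^] (p ^ k) \<noteq> \<one>"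
    using LeastI[of "\<lambda>k. f 0 [^] (p ^ k) = \<one>", OF x] not_less_Least[of _ "\<lambda>k. f 0 [^] (p ^ k) = \<one>"] unfolding k0_def by auto
  show ?thesis
  proof (cases "k0 = 0")
    case True
    then have "f 0 = \<one>" using k0 f(1) by simp
    then show ?thesis by (intro exI[of _ 0]) simp
  next
    case False
    have ord: "f l [^] j \<in> {\<one>} \<longleftrightarrow> p ^ (l + k0) dvd j" for j :: int
    proof (rule prime_power_order_mod[OF triv_subgroup f(1) p])
      show "f l [^] (p ^ (l + k0)) \<in> {\<one>}"
        using k0(1) shift[of 0 l] f(1) by (simp add: int_pow_pow power_add)
      fix j assume j: "j < l + k0"
      show "f l [^] (p ^ j) \<notin> {\<one>}"
      proof
        assume "f l [^] (p ^ j) \<in> {\<one>}"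
        moreover have "p ^ j dvd p ^ l * p ^ (k0 - 1)"
          using j False by (simp flip: power_add add: le_imp_power_dvd)
        ultimately have "f l [^] (p ^ l * p ^ (k0 - 1)) \<in> {\<one>}" using pow_dvd_mem[OF triv_subgroup f(1)] by blast
        then have "f 0 [^] (p ^ (k0 - 1)) = \<one>" using shift[of 0 l] f(1) by (simp add: int_pow_pow)
        then show False using k0(2)[of "k0 - 1"] False by auto
      qed
    qed
    have "f l [^] (r * p ^ k0) \<in> {\<one>}" using yk[OF k0(1)] f(1) unfolding yr by (simp add: int_pow_pow)
    then have "p ^ l * p ^ k0 dvd r * p ^ k0" using ord by (simp add: power_add)
    then have "p ^ l dvd r" using p by auto
    then obtain c where "r = p ^ l * c" by auto
    then have "y = f 0 [^] c" using yr shift[of 0 l] f(1) by (simp add: int_pow_pow)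
    then show ?thesis unfolding y_def by blast
  qed
qed

end

section \<open>Locally almost stable subgroups\<close>

context comm_group
begin

text \<open>
  A strengthening of \<^const>\<open>almost_preserves\<close> that passes to inverse automorphisms: there is one finite set
  \<open>\<Phi>\<close> such that \<open>U\<close> is a directed union of finite subgroups \<open>Y\<close> with \<open>Y\<delta> \<subseteq> Y + \<Phi>\<close>.
\<close>

definition locally_almost_stable :: "('a \<Rightarrow> 'a) \<Rightarrow> 'a set \<Rightarrow> bool" where
  "locally_almost_stable \<delta> U \<longleftrightarrow> (\<exists>\<Phi>. finite \<Phi> \<and> \<Phi> \<subseteq> carrier G \<and>
     (\<forall>S. finite S \<longrightarrow> S \<subseteq> U \<longrightarrow> (\<exists>Y. subgroup Y G \<and> finite Y \<and> S \<subseteq> Y \<and> Y \<subseteq> U \<and>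
        (\<forall>y\<in>Y. \<exists>y'\<in>Y. \<exists>f\<in>\<Phi>. \<delta> y = y' \<otimes> f))))"

lemma locally_almost_stable_power:
  assumes "subgroup U G" "U \<subseteq> torsion_part G" "finite \<Phi>" "\<Phi> \<subseteq> carrier G"
    and "\<And>x. x \<in> U \<Longrightarrow> \<exists>i::int. \<exists>f\<in>\<Phi>. \<delta> x = x [^] i \<otimes> f"
  shows "locally_almost_stable \<delta> U"
  unfolding locally_almost_stable_def
proof (rule exI[of _ \<Phi>], intro conjI allI impI)
  fix S assume S: "finite S" "S \<subseteq> U"
  then obtain Y where Y: "subgroup Y G" "finite Y" "S \<subseteq> Y" "Y \<subseteq> U"
    using finite_subgroup_cover[of S U] assms by blast
  have "\<exists>y'\<in>Y. \<exists>f\<in>\<Phi>. \<delta> y = y' \<otimes> f" if "y \<in> Y" for y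
    using assms(5)[of y] that Y subgroup_int_pow_closed[OF Y(1) that] by blast
  then show "\<exists>Y. subgroup Y G \<and> finite Y \<and> S \<subseteq> Y \<and> Y \<subseteq> U \<and> (\<forall>y\<in>Y. \<exists>y'\<in>Y. \<exists>f\<in>\<Phi>. \<delta> y = y' \<otimes> f)"
    using Y by blast
qed (use assms in auto)

lemma locally_almost_stable_finite:
  assumes "subgroup U G" "finite U" "\<delta> \<in> hom G G"
  shows "locally_almost_stable \<delta> U"
  unfolding locally_almost_stable_def
proof (rule exI[of _ "\<delta> ` U"], intro conjI allI impI)
  have c: "\<delta> x \<in> carrier G" if "x \<in> U" for x
    using hom_in_carrier[OF assms(3)] subgroup.mem_carrier[OF assms(1) that] by auto
  then show "\<delta> ` U \<subseteq> carrier G" "finite (\<delta> ` U)" using assms by auto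
  fix S assume S: "finite S" "S \<subseteq> U"
  have "\<exists>y'\<in>U. \<exists>f\<in>\<delta> ` U. \<delta> y = y' \<otimes> f" if "y \<in> U" for y
    using that c[OF that] subgroup.one_closed[OF assms(1)] by (intro bexI[of _ \<one>] bexI[of _ "\<delta> y"]) auto
  then show "\<exists>Y. subgroup Y G \<and> finite Y \<and> S \<subseteq> Y \<and> Y \<subseteq> U \<and> (\<forall>y\<in>Y. \<exists>y'\<in>Y. \<exists>f\<in>\<delta> ` U. \<delta> y = y' \<otimes> f)"
    using S assms by blast
qed

lemma locally_almost_stable_set_mult:
  assumes hom: "\<delta> \<in> hom G G" and U: "subgroup U G" and V: "subgroup V G"
    and lU: "locally_almost_stable \<delta> U" and lV: "locally_almost_stable \<delta> V"
  shows "locally_almost_stable \<delta> (U <#> V)"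
proof -
  obtain F where F: "finite F" "F \<subseteq> carrier G" "\<And>S. finite S \<Longrightarrow> S \<subseteq> U \<Longrightarrow>
      \<exists>Y. subgroup Y G \<and> finite Y \<and> S \<subseteq> Y \<and> Y \<subseteq> U \<and> (\<forall>y\<in>Y. \<exists>y'\<in>Y. \<exists>f\<in>F. \<delta> y = y' \<otimes> f)"
    using lU unfolding locally_almost_stable_def by blast
  obtain F' where F': "finite F'" "F' \<subseteq> carrier G" "\<And>S. finite S \<Longrightarrow> S \<subseteq> V \<Longrightarrow>
      \<exists>Y. subgroup Y G \<and> finite Y \<and> S \<subseteq> Y \<and> Y \<subseteq> V \<and> (\<forall>y\<in>Y. \<exists>y'\<in>Y. \<exists>f\<in>F'. \<delta> y = y' \<otimes> f)"
    using lV unfolding locally_almost_stable_def by blast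
  show ?thesis unfolding locally_almost_stable_def
  proof (rule exI[of _ "F <#> F'"], intro conjI allI impI)
    show "finite (F <#> F')" "F <#> F' \<subseteq> carrier G"
      using F F' finite_set_mult setmult_subset_G by auto
    fix S assume S: "finite S" "S \<subseteq> U <#> V"
    then have "\<forall>s\<in>S. \<exists>u v. u \<in> U \<and> v \<in> V \<and> s = u \<otimes> v" unfolding set_mult_def by blast
    then obtain a b where ab: "\<And>s. s \<in> S \<Longrightarrow> a s \<in> U \<and> b s \<in> V \<and> s = a s \<otimes> b s" by metis
    obtain Y where Y: "subgroup Y G" "finite Y" "a ` S \<subseteq> Y" "Y \<subseteq> U"
        "\<And>y. y \<in> Y \<Longrightarrow> \<exists>y'\<in>Y. \<exists>f\<in>F. \<delta> y = y' \<otimes> f"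
      using F(3)[of "a ` S"] ab S(1) by (metis finite_imageI image_subsetI)
    obtain Z where Z: "subgroup Z G" "finite Z" "b ` S \<subseteq> Z" "Z \<subseteq> V"
        "\<And>y. y \<in> Z \<Longrightarrow> \<exists>y'\<in>Z. \<exists>f\<in>F'. \<delta> y = y' \<otimes> f"
      using F'(3)[of "b ` S"] ab S(1) by (metis finite_imageI image_subsetI)
    have Yc: "Y \<subseteq> carrier G" and Zc: "Z \<subseteq> carrier G" using subgroup.subset Y(1) Z(1) by blast+
    have "S \<subseteq> Y <#> Z"
    proof
      fix s assume s: "s \<in> S"
      then have "a s \<in> Y" "b s \<in> Z" "s = a s \<otimes> b s" using Y(3) Z(3) ab by auto
      then show "s \<in> Y <#> Z" unfolding mem_set_mult by blast
    qed
    moreover have "\<exists>y'\<in>Y <#> Z. \<exists>f\<in>F <#> F'. \<delta> y = y' \<otimes> f" if "y \<in> Y <#> Z" for y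
    proof -
      obtain u v where uv: "u \<in> Y" "v \<in> Z" "y = u \<otimes> v" using \<open>y \<in> Y <#> Z\<close> unfolding set_mult_def by blast
      obtain u' f where u': "u' \<in> Y" "f \<in> F" "\<delta> u = u' \<otimes> f" using Y(5)[OF uv(1)] by blast
      obtain v' f' where v': "v' \<in> Z" "f' \<in> F'" "\<delta> v = v' \<otimes> f'" using Z(5)[OF uv(2)] by blast
      have "\<delta> y = \<delta> u \<otimes> \<delta> v" unfolding uv(3) using hom_mult[OF hom] uv Yc Zc by blast
      also have "\<dots> = (u' \<otimes> v') \<otimes> (f \<otimes> f')" unfolding u'(3) v'(3)
        by (rule abelian_normal_form4[of u' v' f f']) (use u'(1,2) v'(1,2) Yc Zc F(2) F'(2) in auto)
      finally have "\<delta> y = (u' \<otimes> v') \<otimes> (f \<otimes> f')" .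
      moreover have "u' \<otimes> v' \<in> Y <#> Z" "f \<otimes> f' \<in> F <#> F'" using u'(1,2) v'(1,2) unfolding mem_set_mult by blast+
      ultimately show ?thesis by blast
    qed
    moreover have "Y <#> Z \<subseteq> U <#> V" using mono_set_mult Y Z by blast
    ultimately show "\<exists>Y. subgroup Y G \<and> finite Y \<and> S \<subseteq> Y \<and> Y \<subseteq> U <#> V \<and> (\<forall>y\<in>Y. \<exists>y'\<in>Y. \<exists>f\<in>F <#> F'. \<delta> y = y' \<otimes> f)"
      using mult_subgroups[OF Y(1) Z(1)] finite_set_mult[OF Y(2) Z(2)] by blast
  qed
qed

lemma locally_almost_stable_imp_almost_preserves:
  assumes "locally_almost_stable \<delta> U"
  shows "almost_preserves G \<delta> U"
proof -
  obtain F where F: "finite F" "F \<subseteq> carrier G" "\<And>S. finite S \<Longrightarrow> S \<subseteq> U \<Longrightarrow>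
      \<exists>Y. subgroup Y G \<and> finite Y \<and> S \<subseteq> Y \<and> Y \<subseteq> U \<and> (\<forall>y\<in>Y. \<exists>y'\<in>Y. \<exists>f\<in>F. \<delta> y = y' \<otimes> f)"
    using assms unfolding locally_almost_stable_def by blast
  have "\<exists>h'\<in>U. \<exists>f\<in>F. \<delta> h = h' \<otimes> f" if "h \<in> U" for h
    using F(3)[of "{h}"] that by (meson empty_subsetI finite.intros insert_subset subsetD)
  then show ?thesis using F(1,2) unfolding almost_preserves_def by blast
qed

text \<open>
  If \<open>Y\<close> is finite, \<open>\<delta>\<close> injective and \<open>Y\<delta> \<subseteq> Y + \<Phi>\<close>, then elements of \<open>Y\<close> that are pairwise incongruent
  modulo \<open>U\<delta>\<close> number at most \<open>|\<Phi>|\<close>, because \<open>Y\<delta>\<close> has as many elements as \<open>Y\<close>. Hence \<open>U \<subseteq> U\<delta> + \<Phi>'\<close> with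
  \<open>\<Phi>'\<close> finite.
\<close>

lemma locally_almost_stable_covers:
  assumes hom: "\<delta> \<in> hom G G" and inj: "inj_on \<delta> (carrier G)" and U: "subgroup U G"
    and las: "locally_almost_stable \<delta> U"
  shows "\<exists>\<Phi>. finite \<Phi> \<and> \<Phi> \<subseteq> carrier G \<and> (\<forall>x\<in>U. \<exists>y\<in>U. \<exists>f\<in>\<Phi>. x = \<delta> y \<otimes> f)"
proof -
  interpret g: group_hom G G \<delta> by unfold_locales (use hom in auto)
  have Uc: "U \<subseteq> carrier G" using subgroup.subset[OF U] .
  have dU: "subgroup (\<delta> ` U) G" using g.subgroup_img_is_subgroup[OF U] .
  obtain F where F: "finite F" "F \<subseteq> carrier G" "\<And>S. finite S \<Longrightarrow> S \<subseteq> U \<Longrightarrow>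
      \<exists>Y. subgroup Y G \<and> finite Y \<and> S \<subseteq> Y \<and> Y \<subseteq> U \<and> (\<forall>y\<in>Y. \<exists>y'\<in>Y. \<exists>f\<in>F. \<delta> y = y' \<otimes> f)"
    using las unfolding locally_almost_stable_def by blast
  define P where "P S \<longleftrightarrow> finite S \<and> S \<subseteq> U \<and> (\<forall>s\<in>S. \<forall>s'\<in>S. s \<otimes> inv s' \<in> \<delta> ` U \<longrightarrow> s = s')" for S
  have bound: "card S \<le> card F" if S: "P S" for S
  proof -
    have fS: "finite S" "S \<subseteq> U" using S unfolding P_def by auto
    obtain Y where Y: "subgroup Y G" "finite Y" "S \<subseteq> Y" "Y \<subseteq> U"
        "\<And>y. y \<in> Y \<Longrightarrow> \<exists>y'\<in>Y. \<exists>f\<in>F. \<delta> y = y' \<otimes> f"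
      using F(3)[OF fS] by metis
    have Yc: "Y \<subseteq> carrier G" using subgroup.subset[OF Y(1)] .
    \<comment> \<open>Counting: \<open>(s, y) \<mapsto> s + y\<delta>\<close> embeds \<open>S \<times> Y\<close> into \<open>Y + \<Phi>\<close>.\<close>
    define m where "m = (\<lambda>(s, y). s \<otimes> \<delta> y)"
    have dc: "\<delta> y \<in> carrier G" if "y \<in> Y" for y using that Yc by auto
    have "inj_on m (S \<times> Y)"
    proof (rule inj_onI, clarify)
      fix s y s' y' assume *: "s \<in> S" "y \<in> Y" "s' \<in> S" "y' \<in> Y" "m (s, y) = m (s', y')"
      have c: "s \<in> carrier G" "s' \<in> carrier G" "y \<in> carrier G" "y' \<in> carrier G" using * Y(3) Yc by auto
      have eq: "s \<otimes> \<delta> y = s' \<otimes> \<delta> y'" using *(5) unfolding m_def by simp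
      have "s \<otimes> inv s' = (s \<otimes> \<delta> y) \<otimes> inv (s' \<otimes> \<delta> y)"
        by (rule abelian_normal_form3[of s s' "\<delta> y"]) (use c in simp_all)
      also have "\<dots> = \<delta> y' \<otimes> inv (\<delta> y)"
        unfolding eq by (rule abelian_normal_form3[of s' "\<delta> y'" "\<delta> y"]) (use c in simp_all)
      also have "\<dots> = \<delta> (y' \<otimes> inv y)" using c by simp
      finally have "s \<otimes> inv s' \<in> \<delta> ` U"
        using subgroup.m_closed[OF U] subgroup.m_inv_closed[OF U] * Y(4) by blast
      then have "s = s'" using S * unfolding P_def by blast
      then have "\<delta> y = \<delta> y'" using eq c by simp
      then show "s = s' \<and> y = y'" using \<open>s = s'\<close> inj c by (auto dest: inj_onD)
    qed
    moreover have "m ` (S \<times> Y) \<subseteq> (\<lambda>(y, f). y \<otimes> f) ` (Y \<times> F)"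
    proof clarify
      fix s y assume sy: "s \<in> S" "y \<in> Y"
      then obtain y' f where y': "y' \<in> Y" "f \<in> F" "\<delta> y = y' \<otimes> f" using Y(5) by blast
      have "m (s, y) = (s \<otimes> y') \<otimes> f"
        unfolding m_def using y' sy Y(3) Yc F(2) by (simp add: m_assoc subsetD)
      moreover have "s \<otimes> y' \<in> Y" using subgroup.m_closed[OF Y(1)] sy y' Y(3) by auto
      ultimately show "m (s, y) \<in> (\<lambda>(y, f). y \<otimes> f) ` (Y \<times> F)" using y'(2) by (intro image_eqI[of _ _ "(s \<otimes> y', f)"]) auto
    qed
    ultimately have "card (S \<times> Y) \<le> card (Y \<times> F)"
      using F(1) Y(2) by (meson card_image_le card_inj_on_le finite_SigmaI finite_imageI order_trans)
    then have "card S * card Y \<le> card F * card Y" by (simp add: card_cartesian_product mult.commute)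
    moreover have "card Y > 0" using Y(1,2) subgroup.one_closed[OF Y(1)] card_gt_0_iff by blast
    ultimately show ?thesis by simp
  qed
  have "P {}" unfolding P_def by auto
  then obtain S where S: "P S" "\<And>S'. P S' \<Longrightarrow> card S' \<le> card S"
    using ex_has_greatest_nat[of P "{}" card "card F"] bound by (metis order_le_less le_imp_less_Suc)
  have fS: "finite S" "S \<subseteq> U" using S unfolding P_def by auto
  have "\<exists>y\<in>U. \<exists>f\<in>S. x = \<delta> y \<otimes> f" if x: "x \<in> U" for x
  proof -
    have "\<exists>s\<in>S. x \<otimes> inv s \<in> \<delta> ` U"
    proof (rule ccontr)
      assume neg: "\<not> ?thesis"
      have "x \<notin> S"
      proof
        assume "x \<in> S"
        moreover have "x \<otimes> inv x \<in> \<delta> ` U" using x Uc subgroup.one_closed[OF dU] by auto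
        ultimately show False using neg by blast
      qed
      have neg2: "s \<otimes> inv x \<notin> \<delta> ` U" if "s \<in> S" for s
        using diff_sym[OF dU, of s x] that neg fS Uc x by blast
      have "P (insert x S)" using S(1) neg neg2 x unfolding P_def by auto
      then have "card (insert x S) \<le> card S" by (rule S(2))
      then show False using \<open>x \<notin> S\<close> fS by simp
    qed
    then obtain s y where sy: "s \<in> S" "y \<in> U" "x \<otimes> inv s = \<delta> y" by blast
    have "x = (x \<otimes> inv s) \<otimes> s"
      by (rule abelian_normal_form2[of x s]) (use sy(1) x fS Uc in auto)
    then show ?thesis using sy by metis
  qed
  then show ?thesis using fS Uc by (meson order_trans)
qed

end

section \<open>Families of homomorphisms into a torsion group\<close>

text \<open>
  An abelian group \<open>G\<close> with an endomorphism \<open>\<delta>\<close> is embedded in a finite power of a torsion group \<open>T\<close>, the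
  coordinates being the homomorphisms \<open>\<pi> i\<close>, and \<open>\<delta>\<close> is induced by an endomorphism \<open>\<gamma>\<close> of \<open>T\<close> that almost
  preserves every subgroup. The aim is that \<open>\<delta>\<close> almost preserves the subgroups of \<open>G\<close>.
\<close>

locale equivariant_embedding = G: comm_group G + T: comm_group T
  for G :: "('g, 'm) monoid_scheme" (structure) and T :: "('t, 'n) monoid_scheme" +
  fixes \<delta> :: "'g \<Rightarrow> 'g" and \<gamma> :: "'t \<Rightarrow> 't" and I :: "'i set" and \<pi> :: "'i \<Rightarrow> 'g \<Rightarrow> 't"
  assumes torsion: "carrier T = torsion_part T"
    and hom_\<gamma>: "\<gamma> \<in> hom T T"
    and almost: "\<And>H. subgroup H T \<Longrightarrow> almost_preserves T \<gamma> H"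
    and hom_\<delta>: "\<delta> \<in> hom G G"
    and finite_I: "finite I"
    and hom_\<pi>: "\<And>i. i \<in> I \<Longrightarrow> \<pi> i \<in> hom G T"
    and joint_kernel: "\<And>g. g \<in> carrier G \<Longrightarrow> (\<And>i. i \<in> I \<Longrightarrow> \<pi> i g = \<one>\<^bsub>T\<^esub>) \<Longrightarrow> g = \<one>"
    and equivariant: "\<And>i g. i \<in> I \<Longrightarrow> g \<in> carrier G \<Longrightarrow> \<pi> i (\<delta> g) = \<gamma> (\<pi> i g)"
begin

lemma \<pi>_hom: "i \<in> I \<Longrightarrow> group_hom G T (\<pi> i)"
  by unfold_locales (rule hom_\<pi>)

lemmas \<pi>_closed [simp] = group_hom.hom_closed[OF \<pi>_hom]
lemmas \<pi>_mult = group_hom.hom_mult[OF \<pi>_hom]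
lemmas \<pi>_inv = group_hom.hom_inv[OF \<pi>_hom]
lemmas \<pi>_one = group_hom.hom_one[OF \<pi>_hom]
lemmas \<pi>_pow = group_hom.hom_int_pow[OF \<pi>_hom]

lemma \<delta>_closed [simp]: "g \<in> carrier G \<Longrightarrow> \<delta> g \<in> carrier G"
  using hom_in_carrier[OF hom_\<delta>] .

lemma joint_inj:
  assumes "g \<in> carrier G" "h \<in> carrier G" "\<And>i. i \<in> I \<Longrightarrow> \<pi> i g = \<pi> i h"
  shows "g = h"
proof -
  have "g \<otimes> inv h = \<one>"
    by (rule joint_kernel) (use assms \<pi>_mult \<pi>_inv in auto)
  then show ?thesis using assms by (metis G.inv_equality G.inv_closed G.inv_inv)
qed

lemma finite_joint_preimage:
  assumes "finite E"
  shows "finite {g \<in> carrier G. \<forall>i\<in>I. \<pi> i g \<in> E}"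
proof (rule inj_on_finite)
  show "inj_on (\<lambda>g. \<lambda>i\<in>I. \<pi> i g) {g \<in> carrier G. \<forall>i\<in>I. \<pi> i g \<in> E}"
  proof (rule inj_onI)
    fix g h assume g: "g \<in> {g \<in> carrier G. \<forall>i\<in>I. \<pi> i g \<in> E}" "h \<in> {g \<in> carrier G. \<forall>i\<in>I. \<pi> i g \<in> E}"
      and eq: "(\<lambda>i\<in>I. \<pi> i g) = (\<lambda>i\<in>I. \<pi> i h)"
    have "\<pi> i g = \<pi> i h" if "i \<in> I" for i using fun_cong[OF eq, of i] that by simp
    then show "g = h" using joint_inj g by auto
  qed
  show "(\<lambda>g. \<lambda>i\<in>I. \<pi> i g) ` {g \<in> carrier G. \<forall>i\<in>I. \<pi> i g \<in> E} \<subseteq> PiE I (\<lambda>_. E)" by auto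
  show "finite (PiE I (\<lambda>_. E))" using assms finite_I by (intro finite_PiE) auto
qed

lemma subgroup_joint_preimage:
  assumes "subgroup N T"
  shows "subgroup {g \<in> carrier G. \<forall>i\<in>I. \<pi> i g \<in> N} G"
  by (rule G.subgroupI)
    (use subgroup.one_closed[OF assms] subgroup.m_closed[OF assms] subgroup.m_inv_closed[OF assms] \<pi>_one in
      \<open>auto simp: \<pi>_mult \<pi>_inv\<close>)

lemma torsion_G: "carrier G = torsion_part G"
proof -
  have "g \<in> torsion_part G" if g: "g \<in> carrier G" for g
  proof -
    have "\<forall>i. \<exists>n::int. i \<in> I \<longrightarrow> n \<noteq> 0 \<and> \<pi> i g [^]\<^bsub>T\<^esub> n = \<one>\<^bsub>T\<^esub>"
      using torsion T.torsion_part_int g \<pi>_closed by blast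
    then obtain n where n: "\<And>i. i \<in> I \<Longrightarrow> n i \<noteq> (0::int) \<and> \<pi> i g [^]\<^bsub>T\<^esub> n i = \<one>\<^bsub>T\<^esub>" by metis
    have "g [^] (\<Prod>i\<in>I. n i) = \<one>"
    proof (rule joint_kernel)
      fix i assume i: "i \<in> I"
      have "n i dvd (\<Prod>i\<in>I. n i)" using i finite_I by (intro dvd_prodI) auto
      then have "\<pi> i g [^]\<^bsub>T\<^esub> (\<Prod>i\<in>I. n i) \<in> {\<one>\<^bsub>T\<^esub>}"
        using T.pow_dvd_mem[OF T.triv_subgroup \<pi>_closed[OF i g], of "n i"] n[OF i] by simp
      then show "\<pi> i (g [^] (\<Prod>i\<in>I. n i)) = \<one>\<^bsub>T\<^esub>" using \<pi>_pow i g by simp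
    qed (use g in auto)
    moreover have "(\<Prod>i\<in>I. n i) \<noteq> 0" using n finite_I by auto
    ultimately show ?thesis using g unfolding G.torsion_part_int by blast
  qed
  then show ?thesis unfolding torsion_part_def by auto
qed

text \<open>
  The coordinates of a \<open>p\<close>-element of \<open>G\<close> are multiplied by a common integer, by
  \<open>uniform_power_mod\<close>; this is where single elements of \<open>T\<close> are passed to tuples.
\<close>

lemma power_mod_prime:
  assumes E: "subgroup E T" and N: "subgroup N T" and p: "Factorial_Ring.prime (p::int)"
    and pw: "\<And>t k. t \<in> N \<Longrightarrow> t [^]\<^bsub>T\<^esub> (p ^ k) = \<one>\<^bsub>T\<^esub> \<Longrightarrow> \<exists>s::int. \<gamma> t \<otimes>\<^bsub>T\<^esub> inv\<^bsub>T\<^esub> (t [^]\<^bsub>T\<^esub> s) \<in> E"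
    and g: "g \<in> carrier G" "g [^] (p ^ k) = \<one>" "\<And>i. i \<in> I \<Longrightarrow> \<pi> i g \<in> N"
  shows "\<exists>s::int. \<forall>i\<in>I. \<pi> i (\<delta> g \<otimes> inv (g [^] s)) \<in> E"
proof -
  define N' where "N' = N \<inter> {t \<in> carrier T. \<exists>k. t [^]\<^bsub>T\<^esub> (p ^ k) = \<one>\<^bsub>T\<^esub>}"
  have Nc: "N \<subseteq> carrier T" using subgroup.subset[OF N] .
  have N': "subgroup N' T"
  proof (rule T.subgroupI)
    show "N' \<subseteq> carrier T" using Nc unfolding N'_def by auto
    have "\<one>\<^bsub>T\<^esub> \<in> N'" using subgroup.one_closed[OF N] unfolding N'_def by auto
    then show "N' \<noteq> {}" by auto
    show "inv\<^bsub>T\<^esub> a \<in> N'" if "a \<in> N'" for a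
      using that subgroup.m_inv_closed[OF N] unfolding N'_def by (auto simp: T.int_pow_inv)
    fix a b assume ab: "a \<in> N'" "b \<in> N'"
    then obtain k l where kl: "a [^]\<^bsub>T\<^esub> (p ^ k) = \<one>\<^bsub>T\<^esub>" "b [^]\<^bsub>T\<^esub> (p ^ l) = \<one>\<^bsub>T\<^esub>" unfolding N'_def by auto
    have c: "a \<in> carrier T" "b \<in> carrier T" using ab unfolding N'_def by auto
    have "a [^]\<^bsub>T\<^esub> (p ^ (k + l)) = \<one>\<^bsub>T\<^esub>" "b [^]\<^bsub>T\<^esub> (p ^ (k + l)) = \<one>\<^bsub>T\<^esub>"
      using T.pow_dvd_mem[OF T.triv_subgroup c(1), of "p ^ k" "p ^ (k + l)"]
        T.pow_dvd_mem[OF T.triv_subgroup c(2), of "p ^ l" "p ^ (k + l)"] kl by (auto simp: power_add)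
    then have "(a \<otimes>\<^bsub>T\<^esub> b) [^]\<^bsub>T\<^esub> (p ^ (k + l)) = \<one>\<^bsub>T\<^esub>" using c by (simp add: T.int_pow_distrib)
    then show "a \<otimes>\<^bsub>T\<^esub> b \<in> N'" using ab subgroup.m_closed[OF N] unfolding N'_def by auto
  qed
  have "\<exists>s::int. \<forall>x\<in>(\<lambda>i. \<pi> i g) ` I. \<gamma> x \<otimes>\<^bsub>T\<^esub> inv\<^bsub>T\<^esub> (x [^]\<^bsub>T\<^esub> s) \<in> E"
  proof (rule T.uniform_power_mod[OF hom_\<gamma> E N' p])
    show "\<exists>i::int. \<gamma> x \<otimes>\<^bsub>T\<^esub> inv\<^bsub>T\<^esub> (x [^]\<^bsub>T\<^esub> i) \<in> E" if "x \<in> N'" for x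
      using pw that unfolding N'_def by blast
    have pi: "\<pi> i g [^]\<^bsub>T\<^esub> (p ^ k) = \<one>\<^bsub>T\<^esub>" if "i \<in> I" for i
      using \<pi>_pow[OF that g(1), of "p ^ k"] g(2) \<pi>_one[OF that] by simp
    show "finite ((\<lambda>i. \<pi> i g) ` I)" using finite_I by simp
    show "(\<lambda>i. \<pi> i g) ` I \<subseteq> N'" using g pi unfolding N'_def by auto
    show "\<exists>k. x [^]\<^bsub>T\<^esub> (p ^ k) \<in> E" if "x \<in> (\<lambda>i. \<pi> i g) ` I" for x
      using that pi subgroup.one_closed[OF E] by (intro exI[of _ k]) auto
  qed
  then obtain s :: int where s: "\<And>i. i \<in> I \<Longrightarrow> \<gamma> (\<pi> i g) \<otimes>\<^bsub>T\<^esub> inv\<^bsub>T\<^esub> (\<pi> i g [^]\<^bsub>T\<^esub> s) \<in> E" by blast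
  have "\<pi> i (\<delta> g \<otimes> inv (g [^] s)) \<in> E" if i: "i \<in> I" for i
    using s[OF i] i g(1) by (simp add: \<pi>_mult \<pi>_inv \<pi>_pow equivariant)
  then show ?thesis by blast
qed

text \<open>
  Elements of composite order are decomposed into elements of prime power order. The multipliers of
  the parts need not be combined: both parts of \<open>g\<close> are multiples of \<open>g\<close>.
\<close>

lemma power_mod:
  assumes E: "subgroup E T" and N: "subgroup N T"
    and pw: "\<And>(p::int) t k. p \<in> P \<Longrightarrow> Factorial_Ring.prime p \<Longrightarrow> t \<in> N \<Longrightarrow> t [^]\<^bsub>T\<^esub> (p ^ k) = \<one>\<^bsub>T\<^esub> \<Longrightarrow>
      \<exists>s::int. \<gamma> t \<otimes>\<^bsub>T\<^esub> inv\<^bsub>T\<^esub> (t [^]\<^bsub>T\<^esub> s) \<in> E"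
    and "(n::int) \<noteq> 0" "\<And>p. Factorial_Ring.prime p \<Longrightarrow> p dvd n \<Longrightarrow> p \<in> P"
    and "g \<in> carrier G" "g [^] n = \<one>" "\<And>i. i \<in> I \<Longrightarrow> \<pi> i g \<in> N"
  shows "\<exists>s::int. \<forall>i\<in>I. \<pi> i (\<delta> g \<otimes> inv (g [^] s)) \<in> E"
  using assms(4-)
proof (induction "nat \<bar>n\<bar>" arbitrary: n g rule: less_induct)
  case less
  note g = less.prems(3)
  interpret d: group_hom G G \<delta> by unfold_locales (rule hom_\<delta>)
  show ?case
  proof (cases "is_unit n")
    case True
    have "g = \<one>" using G.pow_dvd_mem[OF G.triv_subgroup g, of n 1] less.prems(4) True g by simp
    then show ?thesis using subgroup.one_closed[OF E] \<pi>_one by (intro exI[of _ 0]) simp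
  next
    case False
    obtain p where p: "Factorial_Ring.prime p" "p dvd n"
      using prime_divisor_exists[OF less.prems(1) False] by auto
    define e where "e = multiplicity p n"
    obtain m where m: "n = p ^ e * m" "\<not> p dvd m" 
      using multiplicity_decompose'[of n p] less.prems(1) p(1) not_prime_unit unfolding e_def by metis
    have "coprime p m" using prime_imp_coprime[OF p(1) m(2)] .
    then have "coprime m (p ^ e)" by (simp add: coprime_commute)
    then have "gcd m (p ^ e) = 1" by simp
    then obtain u v where uv: "u * m + v * p ^ e = 1" using bezout_int by metis
    have "e \<noteq> 0" using m p by (cases "e = 0") auto
    have m0: "m \<noteq> 0" "p ^ e \<noteq> 0" using m less.prems(1) by auto
    have "p > 1" using p(1) prime_gt_1_int by blast
    then have "p ^ e > 1" using \<open>e \<noteq> 0\<close> by simp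
    then have "\<bar>m\<bar> < \<bar>n\<bar>" using m0 unfolding m(1) by (simp add: abs_mult)
    let ?a = "g [^] (u * m)" and ?b = "g [^] (v * p ^ e)"
    have gab: "g = ?a \<otimes> ?b" using uv g by (simp flip: G.int_pow_mult)
    have one: "g [^] (n * j) = \<one>" for j :: int
      using G.pow_dvd_mem[OF G.triv_subgroup g, of n "n * j"] less.prems(4) by simp
    have piN: "\<pi> i (g [^] j) \<in> N" if "i \<in> I" for i and j :: int
      using less.prems(5)[OF that] T.subgroup_int_pow_closed[OF N] \<pi>_pow[OF that g] by simp
    have "\<exists>s::int. \<forall>i\<in>I. \<pi> i (\<delta> ?a \<otimes> inv (?a [^] s)) \<in> E"
    proof (rule power_mod_prime[OF E N p(1)])
      show "?a [^] (p ^ e) = \<one>" using g one[of u] m by (simp add: G.int_pow_pow algebra_simps)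
    qed (use pw[of p] p less.prems(2) g piN in auto)
    then obtain s :: int where s: "\<And>i. i \<in> I \<Longrightarrow> \<pi> i (\<delta> ?a \<otimes> inv (?a [^] s)) \<in> E" by blast
    have "\<exists>s::int. \<forall>i\<in>I. \<pi> i (\<delta> ?b \<otimes> inv (?b [^] s)) \<in> E"
    proof (rule less.hyps[of m])
      show "nat \<bar>m\<bar> < nat \<bar>n\<bar>" using \<open>\<bar>m\<bar> < \<bar>n\<bar>\<close> by simp
      show "q \<in> P" if "Factorial_Ring.prime q" "q dvd m" for q using less.prems(2) that m by auto
      show "?b [^] m = \<one>" using g one[of v] m by (simp add: G.int_pow_pow algebra_simps)
    qed (use m0 g piN in auto)
    then obtain r :: int where r: "\<And>i. i \<in> I \<Longrightarrow> \<pi> i (\<delta> ?b \<otimes> inv (?b [^] r)) \<in> E" by blast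
    define j where "j = u * m * s + v * p ^ e * r"
    have "\<delta> g = \<delta> ?a \<otimes> \<delta> ?b" using gab g d.hom_mult[of ?a ?b] by simp
    then have "\<delta> g \<otimes> inv (g [^] j) = (\<delta> ?a \<otimes> \<delta> ?b) \<otimes> inv (g [^] j)" by simp
    also have "\<dots> = (\<delta> ?a \<otimes> inv (?a [^] s)) \<otimes> (\<delta> ?b \<otimes> inv (?b [^] r))"
      unfolding j_def
      by (rule G.abelian_normal_form3[of g "\<delta> ?a" "\<delta> ?b"]) (use g in \<open>simp_all add: algebra_simps\<close>)
    finally have eq: "\<delta> g \<otimes> inv (g [^] j) = \<dots>" .
    have "\<pi> i (\<delta> g \<otimes> inv (g [^] j)) \<in> E" if i: "i \<in> I" for i
      unfolding eq using s[OF i] r[OF i] subgroup.m_closed[OF E] i g \<pi>_mult[OF i] by simp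
    then show ?thesis by blast
  qed
qed

lemma stable_of_power_mod:
  assumes U: "subgroup U G" and E: "subgroup E T" "finite E" 
    and pw: "\<And>g. g \<in> U \<Longrightarrow> \<exists>s::int. \<forall>i\<in>I. \<pi> i (\<delta> g \<otimes> inv (g [^] s)) \<in> E"
  shows "G.locally_almost_stable \<delta> U"
proof (rule G.locally_almost_stable_power[OF U])
  show "U \<subseteq> torsion_part G" using subgroup.subset[OF U] torsion_G by simp
  let ?F = "{g \<in> carrier G. \<forall>i\<in>I. \<pi> i g \<in> E}"
  show "finite ?F" "?F \<subseteq> carrier G" using finite_joint_preimage[OF E(2)] by auto
  fix x assume x: "x \<in> U"
  then have xc: "x \<in> carrier G" using subgroup.mem_carrier[OF U] by auto
  obtain s :: int where s: "\<forall>i\<in>I. \<pi> i (\<delta> x \<otimes> inv (x [^] s)) \<in> E" using pw[OF x] by blast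
  have "\<delta> x = x [^] s \<otimes> (\<delta> x \<otimes> inv (x [^] s))"
    by (rule G.abelian_normal_form2[of x "\<delta> x"]) (use xc in simp_all)
  moreover have "\<delta> x \<otimes> inv (x [^] s) \<in> ?F" using s xc by auto
  ultimately show "\<exists>i::int. \<exists>f\<in>?F. \<delta> x = x [^] i \<otimes> f" by blast
qed

end

lemma (in comm_group) finite_exponent:
  assumes "finite W" "W \<subseteq> torsion_part G"
  shows "\<exists>N::int. N \<noteq> 0 \<and> (\<forall>w\<in>W. w [^] N = \<one>)"
proof -
  have Wc: "W \<subseteq> carrier G" using assms(2) unfolding torsion_part_def by auto
  have "\<forall>w. \<exists>n::int. w \<in> W \<longrightarrow> n \<noteq> 0 \<and> w [^] n = \<one>"
    using assms(2) torsion_part_int by blast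
  then obtain n where n: "\<And>w. w \<in> W \<Longrightarrow> n w \<noteq> (0::int) \<and> w [^] n w = \<one>" by metis
  have "w [^] (\<Prod>w\<in>W. n w) = \<one>" if w: "w \<in> W" for w
  proof -
    have "n w dvd (\<Prod>w\<in>W. n w)" using w assms by (intro dvd_prodI) auto
    then show ?thesis using pow_dvd_mem[OF triv_subgroup, of w "n w"] n[OF w] w Wc by auto
  qed
  moreover have "(\<Prod>w\<in>W. n w) \<noteq> 0" using n assms by auto
  ultimately show ?thesis by blast
qed

context equivariant_embedding
begin

text \<open>
  A bounded subgroup is, up to finite index, mapped coordinatewise into a maximal subgroup \<open>M\<close> avoiding
  \<open>W\<close>, on which \<open>\<gamma>\<close> maps every element to a multiple modulo \<open>E\<close>.
\<close>

lemma stable_bounded: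
  assumes U: "subgroup U G" and n: "(n::int) \<noteq> 0" "\<And>g. g \<in> U \<Longrightarrow> g [^] n = \<one>"
  shows "G.locally_almost_stable \<delta> U"
proof -
  have Uc: "U \<subseteq> carrier G" using subgroup.subset[OF U] .
  obtain E W where EW: "subgroup E T" "finite E" "W \<subseteq> carrier T" "finite W" "\<one>\<^bsub>T\<^esub> \<notin> W"
    "\<And>x. x \<in> carrier T \<Longrightarrow> (\<And>i::int. x [^]\<^bsub>T\<^esub> i \<notin> W) \<Longrightarrow> \<exists>i::int. \<gamma> x \<otimes>\<^bsub>T\<^esub> inv\<^bsub>T\<^esub> (x [^]\<^bsub>T\<^esub> i) \<in> E"
    by (rule T.local_powers_outside_finite[OF hom_\<gamma> torsion almost]) (assumption, rule that, assumption+, blast)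
  have "{\<one>\<^bsub>T\<^esub>} \<inter> W = {}" using EW(5) by auto
  from T.maximal_subgroup_avoiding[OF T.triv_subgroup this]
  obtain M where M: "subgroup M T" "M \<inter> W = {}"
    "\<And>M'. subgroup M' T \<Longrightarrow> M \<subseteq> M' \<Longrightarrow> M' \<inter> W = {} \<Longrightarrow> M' = M" by metis
  have Mc: "M \<subseteq> carrier T" using subgroup.subset[OF M(1)] .
  have "T.finite_index {x \<in> carrier T. x [^]\<^bsub>T\<^esub> n \<in> M} M"
    by (rule T.finite_index_roots[OF torsion EW(4,3) M(1,2) _ n(1)]) (rule M(3))
  then obtain R where R: "finite R" "R \<subseteq> {x \<in> carrier T. x [^]\<^bsub>T\<^esub> n \<in> M}"
      "\<And>h. h \<in> {x \<in> carrier T. x [^]\<^bsub>T\<^esub> n \<in> M} \<Longrightarrow> \<exists>r\<in>R. h \<otimes>\<^bsub>T\<^esub> inv\<^bsub>T\<^esub> r \<in> M"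
    unfolding T.finite_index_def by blast
  define U0 where "U0 = U \<inter> {g \<in> carrier G. \<forall>i\<in>I. \<pi> i g \<in> M}"
  have U0: "subgroup U0 G" unfolding U0_def
    using G.subgroups_Inter_pair[OF U subgroup_joint_preimage[OF M(1)]] .
  have pw: "\<exists>s::int. \<gamma> t \<otimes>\<^bsub>T\<^esub> inv\<^bsub>T\<^esub> (t [^]\<^bsub>T\<^esub> s) \<in> E" if "t \<in> M" for t
  proof (rule EW(6))
    show "t \<in> carrier T" using that Mc by auto
    show "t [^]\<^bsub>T\<^esub> i \<notin> W" for i :: int using T.subgroup_int_pow_closed[OF M(1) that] M(2) by auto
  qed
  have las0: "G.locally_almost_stable \<delta> U0"
  proof (rule stable_of_power_mod[OF U0 EW(1,2)])
    fix g assume g: "g \<in> U0"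
    show "\<exists>s::int. \<forall>i\<in>I. \<pi> i (\<delta> g \<otimes> inv (g [^] s)) \<in> E"
      by (rule power_mod[OF EW(1) M(1), of UNIV n]) (use pw n g in \<open>auto simp: U0_def\<close>)
  qed
  have pin: "\<pi> i g [^]\<^bsub>T\<^esub> n \<in> M" if "i \<in> I" "g \<in> U" for i g
    using \<pi>_pow[of i g n] n(2)[OF that(2)] \<pi>_one that Uc subgroup.one_closed[OF M(1)] by auto
  define f where "f g = (\<lambda>i\<in>I. SOME r. r \<in> R \<and> \<pi> i g \<otimes>\<^bsub>T\<^esub> inv\<^bsub>T\<^esub> r \<in> M)" for g
  have f: "f g i \<in> R \<and> \<pi> i g \<otimes>\<^bsub>T\<^esub> inv\<^bsub>T\<^esub> (f g i) \<in> M" if "i \<in> I" "g \<in> U" for i g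
  proof -
    have "\<pi> i g \<in> {x \<in> carrier T. x [^]\<^bsub>T\<^esub> n \<in> M}" using pin[OF that] that Uc by auto
    then show ?thesis
      using someI_ex[of "\<lambda>r. r \<in> R \<and> \<pi> i g \<otimes>\<^bsub>T\<^esub> inv\<^bsub>T\<^esub> r \<in> M"] R(3) that unfolding f_def by auto
  qed
  have "G.finite_index U U0"
  proof (rule G.finite_index_by_map[of f])
    have "f ` U \<subseteq> PiE I (\<lambda>_. R)" using f unfolding f_def by auto
    then show "finite (f ` U)" using finite_PiE[OF finite_I] R(1) by (meson finite_subset)
    fix g h assume gh: "g \<in> U" "h \<in> U" "f g = f h"
    have "\<pi> i (g \<otimes> inv h) \<in> M" if i: "i \<in> I" for i
    proof -
      have c: "\<pi> i g \<in> carrier T" "\<pi> i h \<in> carrier T" "f h i \<in> carrier T"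
        using i gh Uc f[OF i gh(2)] R(2) by auto
      have "\<pi> i g \<otimes>\<^bsub>T\<^esub> inv\<^bsub>T\<^esub> (\<pi> i h) \<in> M"
        using T.diff_trans[OF M(1) c(1,3,2)] T.diff_sym[OF M(1) c(2,3)] f[OF i gh(1)] f[OF i gh(2)] gh(3) by auto
      moreover have "g \<in> carrier G" "h \<in> carrier G" using gh Uc by auto
      ultimately show ?thesis using i by (simp add: \<pi>_mult \<pi>_inv)
    qed
    then show "g \<otimes> inv h \<in> U0"
      unfolding U0_def using gh Uc subgroup.m_closed[OF U] subgroup.m_inv_closed[OF U] by auto
  qed
  then obtain V where V: "finite V" "V \<subseteq> U" "\<And>h. h \<in> U \<Longrightarrow> \<exists>r\<in>V. h \<otimes> inv r \<in> U0"
    unfolding G.finite_index_def by blast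
  obtain V' where V': "subgroup V' G" "finite V'" "V \<subseteq> V'" "V' \<subseteq> U"
    using G.finite_subgroup_cover[OF V(1) _ U V(2)] V(2) Uc torsion_G by auto
  \<comment> \<open>A finite subgroup \<open>V'\<close> containing the coset representatives makes up for the rest.\<close>
  have "U \<subseteq> U0 <#> V'"
  proof
    fix h assume h: "h \<in> U"
    then obtain r where r: "r \<in> V" "h \<otimes> inv r \<in> U0" using V(3) by blast
    have "h = (h \<otimes> inv r) \<otimes> r"
      by (rule G.abelian_normal_form2[of h r]) (use h r(1) V(2) Uc in auto)
    then show "h \<in> U0 <#> V'" using r V'(3) unfolding G.mem_set_mult by blast
  qed
  moreover have "U0 <#> V' \<subseteq> U" using G.set_mult_least[OF U] V'(4) unfolding U0_def by auto
  ultimately have "U = U0 <#> V'" by auto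
  then show ?thesis
    using G.locally_almost_stable_set_mult[OF hom_\<delta> U0 V'(1) las0
        G.locally_almost_stable_finite[OF V'(1,2) hom_\<delta>]] by simp
qed

text \<open>
  On a \<open>p\<close>-divisible \<open>p\<close>-group, \<open>\<delta>\<close> maps every element to a multiple of itself.
\<close>

lemma stable_divisible:
  assumes p: "Factorial_Ring.prime (p::int)" and Y: "subgroup Y G"
    and tor: "\<And>y. y \<in> Y \<Longrightarrow> \<exists>k::nat. y [^] (p ^ k) = \<one>"
    and dvd: "\<And>y. y \<in> Y \<Longrightarrow> \<exists>y'\<in>Y. y = y' [^] p"
  shows "G.locally_almost_stable \<delta> Y"
proof (rule stable_of_power_mod[OF Y T.triv_subgroup])
  show "finite {\<one>\<^bsub>T\<^esub>}" by simp
  have Yc: "Y \<subseteq> carrier G" using subgroup.subset[OF Y] .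
  \<comment> \<open>The elements with infinite chains of \<open>p\<close>-th parts; they form a subgroup.\<close>
  define N where "N = {t. \<exists>f. f 0 = t \<and> (\<forall>n::nat. f n \<in> carrier T \<and> f n = f (Suc n) [^]\<^bsub>T\<^esub> p)}"
  have N: "subgroup N T"
  proof (rule T.subgroupI)
    show "N \<subseteq> carrier T" unfolding N_def by auto
    have "\<one>\<^bsub>T\<^esub> \<in> N" unfolding N_def by (auto intro!: exI[of _ "\<lambda>_. \<one>\<^bsub>T\<^esub>"])
    then show "N \<noteq> {}" by auto
    show "inv\<^bsub>T\<^esub> a \<in> N" if "a \<in> N" for a
    proof -
      obtain f where f: "f 0 = a" "\<And>n. f n \<in> carrier T" "\<And>n::nat. f n = f (Suc n) [^]\<^bsub>T\<^esub> p"
        using \<open>a \<in> N\<close> unfolding N_def by blast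
      have "inv\<^bsub>T\<^esub> f n = (inv\<^bsub>T\<^esub> f (Suc n)) [^]\<^bsub>T\<^esub> p" for n
        using T.int_pow_inv[OF f(2)[of "Suc n"], of p] f(3)[of n] by simp
      then show ?thesis unfolding N_def using f(1) T.inv_closed[OF f(2)] by (intro CollectI exI[of _ "\<lambda>n. inv\<^bsub>T\<^esub> f n"]) metis
    qed
    show "a \<otimes>\<^bsub>T\<^esub> b \<in> N" if "a \<in> N" "b \<in> N" for a b
    proof -
      obtain f where f: "f 0 = a" "\<And>n. f n \<in> carrier T" "\<And>n::nat. f n = f (Suc n) [^]\<^bsub>T\<^esub> p"
        using \<open>a \<in> N\<close> unfolding N_def by blast
      obtain g where g: "g 0 = b" "\<And>n. g n \<in> carrier T" "\<And>n::nat. g n = g (Suc n) [^]\<^bsub>T\<^esub> p"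
        using \<open>b \<in> N\<close> unfolding N_def by blast
      have "f n \<otimes>\<^bsub>T\<^esub> g n = (f (Suc n) \<otimes>\<^bsub>T\<^esub> g (Suc n)) [^]\<^bsub>T\<^esub> p" for n
        using T.int_pow_distrib[OF f(2)[of "Suc n"] g(2)[of "Suc n"], of p] f(3)[of n] g(3)[of n] by simp
      then show ?thesis unfolding N_def using f(1) g(1) T.m_closed[OF f(2) g(2)] by (intro CollectI exI[of _ "\<lambda>n. f n \<otimes>\<^bsub>T\<^esub> g n"]) metis
    qed
  qed
  fix g assume g: "g \<in> Y"
  obtain k where k: "g [^] (p ^ k) = \<one>" using tor[OF g] by blast
  show "\<exists>s::int. \<forall>i\<in>I. \<pi> i (\<delta> g \<otimes> inv (g [^] s)) \<in> {\<one>\<^bsub>T\<^esub>}"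
  proof (rule power_mod_prime[OF T.triv_subgroup N p _ _ k])
    show "g \<in> carrier G" using g Yc by auto
    fix t k assume "t \<in> N" and tk: "t [^]\<^bsub>T\<^esub> (p ^ k) = \<one>\<^bsub>T\<^esub>"
    then obtain f where f: "f 0 = t" "\<And>n. f n \<in> carrier T" "\<And>n::nat. f n = f (Suc n) [^]\<^bsub>T\<^esub> p"
      unfolding N_def by blast
    have "\<exists>i::int. \<gamma> (f 0) = f 0 [^]\<^bsub>T\<^esub> i"
    proof (rule T.divisible_chain_power[where f = f, OF hom_\<gamma> _ p])
      show "f 0 [^]\<^bsub>T\<^esub> (p ^ k) = \<one>\<^bsub>T\<^esub>" using tk f(1) by simp
    qed (rule almost f(2,3) | assumption)+
    then obtain i :: int where "\<gamma> t = t [^]\<^bsub>T\<^esub> i" using f(1) by auto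
    moreover have "t \<in> carrier T" using f(1,2) by auto
    ultimately show "\<exists>s::int. \<gamma> t \<otimes>\<^bsub>T\<^esub> inv\<^bsub>T\<^esub> (t [^]\<^bsub>T\<^esub> s) \<in> {\<one>\<^bsub>T\<^esub>}" by (intro exI[of _ i]) simp
  next
    fix i assume i: "i \<in> I"
    obtain r where r: "\<And>y. y \<in> Y \<Longrightarrow> r y \<in> Y \<and> y = r y [^] p" using dvd by metis
    define f where "f n = (r ^^ n) g" for n
    have fY: "f n \<in> Y" for n by (induction n) (use g r in \<open>auto simp: f_def\<close>)
    have "f n = f (Suc n) [^] p" for n using r[OF fY[of n]] unfolding f_def by simp
    then have "\<pi> i (f n) = \<pi> i (f (Suc n)) [^]\<^bsub>T\<^esub> p" for n
      using \<pi>_pow[OF i] fY Yc by (metis subsetD)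
    moreover have "\<pi> i (f n) \<in> carrier T" for n using \<pi>_closed[OF i subsetD[OF Yc fY]] .
    moreover have "f 0 = g" unfolding f_def by simp
    ultimately show "\<pi> i g \<in> N" unfolding N_def by (intro CollectI exI[of _ "\<lambda>n. \<pi> i (f n)"]) metis
  qed
qed

text \<open>
  A \<open>p\<close>-subgroup \<open>U\<close>, where \<open>p\<^sup>k T\<close> has finite \<open>p\<close>-socle for some \<open>k\<close>. The socles of the groups \<open>p\<^sup>j U\<close>
  become stationary at some \<open>j0\<close>, which makes \<open>Y = p\<^sup>j\<^sup>0 U\<close> divisible. So \<open>U\<close> is the sum of \<open>Y\<close> and of the
  bounded group of elements killed by \<open>p\<^sup>j\<^sup>0\<close>.
\<close>

lemma stable_finite_socle_height:
  assumes p: "Factorial_Ring.prime (p::int)" and U: "subgroup U G"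
    and tor: "\<And>g. g \<in> U \<Longrightarrow> \<exists>k::nat. g [^] (p ^ k) = \<one>"
    and fin: "finite {t \<in> carrier T. t [^]\<^bsub>T\<^esub> p = \<one>\<^bsub>T\<^esub> \<and> (\<exists>u\<in>carrier T. t = u [^]\<^bsub>T\<^esub> (p ^ k0))}"
  shows "G.locally_almost_stable \<delta> U"
proof -
  have Uc: "U \<subseteq> carrier G" using subgroup.subset[OF U] .
  have p0: "p ^ k \<noteq> 0" for k using p by auto
  define S where "S j = {x \<in> U. x [^] p = \<one> \<and> (\<exists>u\<in>U. x = u [^] (p ^ j))}" for j
  have Santi: "S j \<subseteq> S i" if "i \<le> j" for i j
  proof
    fix x assume "x \<in> S j"
    then obtain u where u: "x \<in> U" "x [^] p = \<one>" "u \<in> U" "x = u [^] (p ^ j)" unfolding S_def by auto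
    have "x = (u [^] (p ^ (j - i))) [^] (p ^ i)"
      using u Uc that by (auto simp: G.int_pow_pow simp flip: power_add)
    then show "x \<in> S i" unfolding S_def using u G.subgroup_int_pow_closed[OF U] by blast
  qed
  have Sfin: "finite (S j)" if "k0 \<le> j" for j
  proof -
    let ?F = "{t \<in> carrier T. t [^]\<^bsub>T\<^esub> p = \<one>\<^bsub>T\<^esub> \<and> (\<exists>u\<in>carrier T. t = u [^]\<^bsub>T\<^esub> (p ^ k0))}"
    have sub: "S k0 \<subseteq> {g \<in> carrier G. \<forall>i\<in>I. \<pi> i g \<in> ?F}"
    proof
      fix x assume "x \<in> S k0"
      then obtain u where u: "x \<in> U" "x [^] p = \<one>" "u \<in> U" "x = u [^] (p ^ k0)" unfolding S_def by auto
      have c: "x \<in> carrier G" "u \<in> carrier G" using u Uc by auto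
      have "\<pi> i x \<in> ?F" if i: "i \<in> I" for i
      proof -
        have "\<pi> i x [^]\<^bsub>T\<^esub> p = \<one>\<^bsub>T\<^esub>" using \<pi>_pow[OF i c(1), of p] u(2) \<pi>_one[OF i] by simp
        moreover have "\<pi> i x = \<pi> i u [^]\<^bsub>T\<^esub> (p ^ k0)" unfolding u(4) using \<pi>_pow[OF i c(2)] .
        ultimately show ?thesis using \<pi>_closed[OF i c(1)] \<pi>_closed[OF i c(2)] by blast
      qed
      then show "x \<in> {g \<in> carrier G. \<forall>i\<in>I. \<pi> i g \<in> ?F}" using c by auto
    qed
    show ?thesis by (rule finite_subset[OF Santi[OF that] finite_subset[OF sub finite_joint_preimage[OF fin]]])
  qed
  obtain j0 where j0: "k0 \<le> j0" "\<And>j. k0 \<le> j \<Longrightarrow> card (S j0) \<le> card (S j)"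
    using ex_has_least_nat[of "\<lambda>j. k0 \<le> j" k0 "\<lambda>j. card (S j)"] by auto
  have Sconst: "S j = S j0" if "j0 \<le> j" for j
    using card_subset_eq[OF Sfin[OF j0(1)] Santi[OF that]] j0(2)[of j] that j0(1)
      card_mono[OF Sfin[OF j0(1)] Santi[OF that]] by auto
  define Y where "Y = (\<lambda>x. x [^] (p ^ j0)) ` U"
  have Y: "subgroup Y G" unfolding Y_def using G.subgroup_powers[OF U] .
  have YU: "Y \<subseteq> U" unfolding Y_def using G.subgroup_int_pow_closed[OF U] by auto
  have dvd: "\<exists>y'\<in>Y. y = y' [^] p" if "y \<in> Y" "y [^] (p ^ k) = \<one>" for k y
    using that
  proof (induction k arbitrary: y)
    case 0
    then have "y = \<one>" using YU Uc by auto
    then show ?case using subgroup.one_closed[OF Y] by (intro bexI[of _ "\<one>"]) auto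
  next
    case (Suc k)
    obtain u where u: "u \<in> U" "y = u [^] (p ^ j0)" using Suc.prems unfolding Y_def by auto
    define z where "z = y [^] (p ^ k)"
    have yc: "y \<in> carrier G" using Suc.prems YU Uc by auto
    have uc: "u \<in> carrier G" using subsetD[OF Uc u(1)] .
    have "z \<in> U" unfolding z_def using Suc.prems(1) YU G.subgroup_int_pow_closed[OF U] by blast
    moreover have "z [^] p = \<one>"
      using Suc.prems(2) yc unfolding z_def by (simp add: G.int_pow_pow mult.commute)
    moreover have "z = u [^] (p ^ (j0 + k))"
      unfolding z_def u(2) using uc by (simp add: G.int_pow_pow power_add)
    ultimately have "z \<in> S (j0 + k)" unfolding S_def using u(1) by blast
    then have "z \<in> S (j0 + Suc k)" using Sconst[of "j0 + k"] Sconst[of "j0 + Suc k"] by simp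
    then obtain v where v: "v \<in> U" "z = v [^] (p ^ (j0 + Suc k))" unfolding S_def by auto
    define y' where "y' = v [^] (p ^ j0)"
    have y': "y' \<in> Y" unfolding Y_def y'_def using v by auto
    have y'c: "y' \<in> carrier G" using y' YU Uc by auto
    have zy': "z = y' [^] (p ^ Suc k)" unfolding v(2) y'_def using subsetD[OF Uc v(1)] by (simp add: G.int_pow_pow power_add ac_simps)
    define w where "w = y \<otimes> inv (y' [^] p)"
    have wY: "w \<in> Y" unfolding w_def
      using subgroup.m_closed[OF Y Suc.prems(1) subgroup.m_inv_closed[OF Y G.subgroup_int_pow_closed[OF Y y']]] .
    have "w [^] (p ^ k) = z \<otimes> inv (y' [^] (p ^ Suc k))"
      unfolding w_def z_def
      by (rule G.abelian_normal_form2[of y y']) (use yc y'c in \<open>simp_all add: algebra_simps\<close>)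
    also have "\<dots> = \<one>" using zy' y'c by (simp flip: zy')
    finally obtain w' where w': "w' \<in> Y" "w = w' [^] p" using Suc.IH[OF wY] by blast
    have w'c: "w' \<in> carrier G" using w' YU Uc by auto
    have "y = w \<otimes> y' [^] p" unfolding w_def
      by (rule G.abelian_normal_form2[of y y']) (use yc y'c in \<open>simp_all\<close>)
    also have "\<dots> = (w' \<otimes> y') [^] p" unfolding w'(2) using w'c y'c by (simp add: G.int_pow_distrib)
    finally show ?case using subgroup.m_closed[OF Y w'(1) y'] by blast
  qed
  have dvdY: "\<exists>y'\<in>Y. y = y' [^] p" if "y \<in> Y" for y
    using dvd[OF that] tor that YU by blast
  have dvdYn: "\<exists>y'\<in>Y. y = y' [^] (p ^ m)" if "y \<in> Y" for y m
    using that
  proof (induction m arbitrary: y)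
    case 0
    then show ?case using YU Uc by (intro bexI[of _ y]) auto
  next
    case (Suc m)
    obtain y' where y': "y' \<in> Y" "y = y' [^] (p ^ m)" using Suc by blast
    obtain y'' where y'': "y'' \<in> Y" "y' = y'' [^] p" using dvdY[OF y'(1)] by blast
    have "y = y'' [^] (p ^ Suc m)" using y' y'' YU Uc by (auto simp: G.int_pow_pow)
    then show ?case using y'' by blast
  qed
  have lasY: "G.locally_almost_stable \<delta> Y"
    by (rule stable_divisible[OF p Y]) (use tor YU dvdY in blast)+
  define B where "B = U \<inter> {x \<in> carrier G. x [^] (p ^ j0) \<in> {\<one>}}"
  have B: "subgroup B G" unfolding B_def
    using G.subgroups_Inter_pair[OF U G.subgroup_power_preimage[OF G.triv_subgroup]] .
  have lasB: "G.locally_almost_stable \<delta> B"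
    by (rule stable_bounded[OF B p0[of j0]]) (auto simp: B_def)
  have "U \<subseteq> B <#> Y"
  proof
    fix x assume x: "x \<in> U"
    then have "x [^] (p ^ j0) \<in> Y" unfolding Y_def by auto
    then obtain y where y: "y \<in> Y" "x [^] (p ^ j0) = y [^] (p ^ j0)" using dvdYn by blast
    have c: "x \<in> carrier G" "y \<in> carrier G" using x y(1) YU Uc by auto
    have "(x \<otimes> inv y) [^] (p ^ j0) = x [^] (p ^ j0) \<otimes> inv (y [^] (p ^ j0))"
      by (rule G.abelian_normal_form2[of x y]) (use c in simp_all)
    also have "\<dots> = \<one>" unfolding y(2) using c by simp
    finally have "x \<otimes> inv y \<in> B"
      unfolding B_def using x y(1) YU c subgroup.m_closed[OF U] subgroup.m_inv_closed[OF U] by auto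
    moreover have "x = (x \<otimes> inv y) \<otimes> y"
      by (rule G.abelian_normal_form2[of x y]) (use c in simp_all)
    ultimately show "x \<in> B <#> Y" using y(1) unfolding G.mem_set_mult by blast
  qed
  moreover have "B <#> Y \<subseteq> U" using G.set_mult_least[OF U] YU unfolding B_def by auto
  ultimately have "U = B <#> Y" by auto
  then show ?thesis using G.locally_almost_stable_set_mult[OF hom_\<delta> B Y lasB lasY] by simp
qed

text \<open>
  Call a prime \<open>p\<close> good if every \<open>p\<close>-element of \<open>T\<close> is mapped to a multiple of itself modulo \<open>E\<close>. This is
  so if \<open>p\<close> does not divide the exponent of \<open>W\<close>, and also if the \<open>p\<close>-socles of all \<open>p\<^sup>k T\<close> are infinite. Hence
  only finitely many primes are bad, and their primary components, which are treated by the previous lemma,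
  can be split off one by one.
\<close>

lemma all_stable:
  assumes U: "subgroup U G"
  shows "G.locally_almost_stable \<delta> U"
proof -
  obtain E W where EW: "subgroup E T" "finite E" "W \<subseteq> carrier T" "finite W" "\<one>\<^bsub>T\<^esub> \<notin> W"
    "\<And>x. x \<in> carrier T \<Longrightarrow> (\<And>i::int. x [^]\<^bsub>T\<^esub> i \<notin> W) \<Longrightarrow> \<exists>i::int. \<gamma> x \<otimes>\<^bsub>T\<^esub> inv\<^bsub>T\<^esub> (x [^]\<^bsub>T\<^esub> i) \<in> E"
    by (rule T.local_powers_outside_finite[OF hom_\<gamma> torsion almost]) (assumption, rule that, assumption+, blast)
  define good where "good p \<longleftrightarrow> (\<forall>t k. t \<in> carrier T \<longrightarrow> t [^]\<^bsub>T\<^esub> (p ^ k) = \<one>\<^bsub>T\<^esub> \<longrightarrow>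
    (\<exists>s::int. \<gamma> t \<otimes>\<^bsub>T\<^esub> inv\<^bsub>T\<^esub> (t [^]\<^bsub>T\<^esub> s) \<in> E))" for p :: int
  define B where "B = {p::int. Factorial_Ring.prime p \<and> \<not> good p}"
  obtain N :: int where N: "N \<noteq> 0" "\<And>w. w \<in> W \<Longrightarrow> w [^]\<^bsub>T\<^esub> N = \<one>\<^bsub>T\<^esub>"
    using T.finite_exponent[OF EW(4)] EW(3)[unfolded torsion] by blast
  have "B \<subseteq> {p. p dvd N}"
  proof (rule ccontr)
    assume "\<not> B \<subseteq> {p. p dvd N}"
    then obtain p where p: "Factorial_Ring.prime p" "\<not> good p" "\<not> p dvd N" unfolding B_def by auto
    have "\<exists>s::int. \<gamma> t \<otimes>\<^bsub>T\<^esub> inv\<^bsub>T\<^esub> (t [^]\<^bsub>T\<^esub> s) \<in> E"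
      if t: "t \<in> carrier T" "t [^]\<^bsub>T\<^esub> (p ^ k) = \<one>\<^bsub>T\<^esub>" for t k
    proof (rule EW(6)[OF t(1)])
      fix i :: int
      show "t [^]\<^bsub>T\<^esub> i \<notin> W"
      proof
        assume w: "t [^]\<^bsub>T\<^esub> i \<in> W"
        have "coprime p N" using prime_imp_coprime[OF p(1,3)] .
        then have "coprime N (p ^ k)" by (simp add: coprime_commute)
        moreover have "(t [^]\<^bsub>T\<^esub> i) [^]\<^bsub>T\<^esub> (p ^ k) = \<one>\<^bsub>T\<^esub>"
          using T.pow_dvd_mem[OF T.triv_subgroup t(1), of "p ^ k" "i * p ^ k"] t by (simp add: T.int_pow_pow)
        ultimately have "(t [^]\<^bsub>T\<^esub> i) [^]\<^bsub>T\<^esub> (1::int) = \<one>\<^bsub>T\<^esub>"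
          using T.pow_gcd_mem[OF T.triv_subgroup T.int_pow_closed[OF t(1), of i], of N "p ^ k"] N(2)[OF w]
          by (metis coprime_imp_gcd_eq_1 singletonI singletonD)
        then show False using w EW(5) t(1) by simp
      qed
    qed
    then show False using p(2) unfolding good_def by blast
  qed
  moreover have "finite {p. p dvd N}"
  proof (rule finite_subset)
    show "{p. p dvd N} \<subseteq> {- \<bar>N\<bar>..\<bar>N\<bar>}"
    proof clarify
      fix d assume "d dvd N"
      then have "\<bar>d\<bar> \<le> \<bar>N\<bar>" using dvd_imp_le_int[OF N(1)] by blast
      then show "d \<in> {- \<bar>N\<bar>..\<bar>N\<bar>}" by auto
    qed
  qed simp
  ultimately have finB: "finite B" using finite_subset by blast
  have socle: "\<exists>k::nat. finite {t \<in> carrier T. t [^]\<^bsub>T\<^esub> p = \<one>\<^bsub>T\<^esub> \<and> (\<exists>u\<in>carrier T. t = u [^]\<^bsub>T\<^esub> (p ^ k))}"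
    if p: "p \<in> B" for p
  proof (rule ccontr)
    assume inf: "\<not> ?thesis"
    have "\<exists>s::int. \<gamma> t \<otimes>\<^bsub>T\<^esub> inv\<^bsub>T\<^esub> (t [^]\<^bsub>T\<^esub> s) \<in> E"
      if t: "t \<in> carrier T" "t [^]\<^bsub>T\<^esub> (p ^ k) = \<one>\<^bsub>T\<^esub>" for t k
      by (rule T.generic_element_power[OF hom_\<gamma> torsion EW(1,2,4,3,5,6) _ _ t]) (use p inf in \<open>auto simp: B_def\<close>)
    then show False using p unfolding B_def good_def by blast
  qed
  \<comment> \<open>\<open>rel P g n\<close>: \<open>n\<close> kills \<open>g\<close>, and the prime divisors of \<open>n\<close> are good or in \<open>P\<close>.\<close>
  define rel where "rel P g n \<longleftrightarrow> n \<noteq> 0 \<and> g [^] n = \<one> \<and>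
      (\<forall>q. Factorial_Ring.prime q \<longrightarrow> q dvd n \<longrightarrow> good q \<or> q \<in> P)" for P g and n :: int
  have main: "G.locally_almost_stable \<delta> U"
    if "finite P" "P \<subseteq> B" "subgroup U G" "\<And>g. g \<in> U \<Longrightarrow> \<exists>n. rel P g n" for P U
    using that
  proof (induction P arbitrary: U)
    case empty
    show ?case
    proof (rule stable_of_power_mod[OF empty(2) EW(1,2)])
      fix g assume g: "g \<in> U"
      have gc: "g \<in> carrier G" using g subgroup.mem_carrier[OF empty(2)] by auto
      obtain n where n: "n \<noteq> 0" "g [^] n = \<one>" "\<And>q. Factorial_Ring.prime q \<Longrightarrow> q dvd n \<Longrightarrow> good q"
        using empty(3)[OF g] unfolding rel_def by auto
      show "\<exists>s::int. \<forall>i\<in>I. \<pi> i (\<delta> g \<otimes> inv (g [^] s)) \<in> E"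
        by (rule power_mod[OF EW(1) T.subgroup_self, of "{q. good q}" n]) (use n gc in \<open>auto simp: good_def\<close>)
    qed
  next
    case (insert p P)
    note U = insert.prems(2)
    have Uc: "U \<subseteq> carrier G" using subgroup.subset[OF U] .
    have p: "Factorial_Ring.prime p" "p \<in> B" using insert.prems(1) unfolding B_def by auto
    obtain k0 where k0: "finite {t \<in> carrier T. t [^]\<^bsub>T\<^esub> p = \<one>\<^bsub>T\<^esub> \<and> (\<exists>u\<in>carrier T. t = u [^]\<^bsub>T\<^esub> (p ^ k0))}"
      using socle[OF p(2)] by blast
    have kill: "g [^] (b::int) = \<one>" if "g \<in> carrier G" "g [^] a = \<one>" "a dvd b" for g and a b :: int
      using G.pow_dvd_mem[OF G.triv_subgroup that(1) _ that(3)] that(2) by simp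
    define V where "V = {g \<in> U. \<exists>k::nat. g [^] (p ^ k) = \<one>}"
    define V' where "V' = {g \<in> U. \<exists>n. rel P g n}"
    have V: "subgroup V G"
    proof (rule G.subgroupI)
      show "V \<subseteq> carrier G" using Uc unfolding V_def by auto
      have "\<one> \<in> V" using subgroup.one_closed[OF U] unfolding V_def by auto
      then show "V \<noteq> {}" by auto
      show "inv a \<in> V" if "a \<in> V" for a
        using that subgroup.m_inv_closed[OF U] subsetD[OF Uc] unfolding V_def by (auto simp: G.int_pow_inv)
      fix a b assume ab: "a \<in> V" "b \<in> V"
      then obtain k l where kl: "a [^] (p ^ k) = \<one>" "b [^] (p ^ l) = \<one>" unfolding V_def by auto
      have c: "a \<in> carrier G" "b \<in> carrier G" using ab Uc unfolding V_def by auto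
      have "a [^] (p ^ (k + l)) = \<one>" "b [^] (p ^ (k + l)) = \<one>"
        using kill[OF c(1) kl(1)] kill[OF c(2) kl(2)] by (auto simp: power_add)
      then have "(a \<otimes> b) [^] (p ^ (k + l)) = \<one>" using c by (simp add: G.int_pow_distrib)
      then show "a \<otimes> b \<in> V" using ab subgroup.m_closed[OF U] unfolding V_def by auto
    qed
    have V': "subgroup V' G"
    proof (rule G.subgroupI)
      show "V' \<subseteq> carrier G" using Uc unfolding V'_def by auto
      have "rel P \<one> 1" unfolding rel_def by (auto simp: not_prime_unit)
      then have "\<one> \<in> V'" using subgroup.one_closed[OF U] unfolding V'_def by blast
      then show "V' \<noteq> {}" by auto
      show "inv a \<in> V'" if "a \<in> V'" for a
        using that subgroup.m_inv_closed[OF U] subsetD[OF Uc] unfolding V'_def rel_def by (auto simp: G.int_pow_inv)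
      fix a b assume ab: "a \<in> V'" "b \<in> V'"
      then obtain m n where mn: "rel P a m" "rel P b n" unfolding V'_def by auto
      have c: "a \<in> carrier G" "b \<in> carrier G" using ab Uc unfolding V'_def by auto
      have "a [^] (m * n) = \<one>" "b [^] (m * n) = \<one>"
        using kill[OF c(1), of m "m * n"] kill[OF c(2), of n "m * n"] mn unfolding rel_def by auto
      then have "rel P (a \<otimes> b) (m * n)"
        using mn c unfolding rel_def by (auto simp: G.int_pow_distrib prime_dvd_mult_iff)
      then show "a \<otimes> b \<in> V'" using ab subgroup.m_closed[OF U] unfolding V'_def by auto
    qed
    have lasV: "G.locally_almost_stable \<delta> V"
      by (rule stable_finite_socle_height[OF p(1) V _ k0]) (auto simp: V_def)
    have lasV': "G.locally_almost_stable \<delta> V'"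
      by (rule insert.IH[OF _ V']) (use insert.prems(1) in \<open>auto simp: V'_def\<close>)
    have "U \<subseteq> V <#> V'"
    proof
      fix g assume g: "g \<in> U"
      then have gc: "g \<in> carrier G" using Uc by auto
      obtain n where n: "rel (insert p P) g n" using insert.prems(3)[OF g] by blast
      define e where "e = multiplicity p n"
      obtain m where m: "n = p ^ e * m" "\<not> p dvd m"
        using multiplicity_decompose'[of n p] n p(1) not_prime_unit unfolding e_def rel_def by metis
      have "coprime p m" using prime_imp_coprime[OF p(1) m(2)] .
      then have "coprime m (p ^ e)" by (simp add: coprime_commute)
      then have "gcd m (p ^ e) = 1" by simp
      then obtain u v where uv: "u * m + v * p ^ e = 1" using bezout_int by metis
      let ?a = "g [^] (u * m)" and ?b = "g [^] (v * p ^ e)"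
      have gab: "g = ?a \<otimes> ?b" using uv gc by (simp flip: G.int_pow_mult)
      have gn: "g [^] n = \<one>" using n unfolding rel_def by auto
      have abU: "?a \<in> U" "?b \<in> U" using G.subgroup_int_pow_closed[OF U g] by auto
      have "?a [^] (p ^ e) = \<one>" using kill[OF gc gn, of "u * m * p ^ e"] gc m by (simp add: G.int_pow_pow)
      then have aV: "?a \<in> V" using abU unfolding V_def by auto
      have "?b [^] m = \<one>" using kill[OF gc gn, of "v * p ^ e * m"] gc m by (simp add: G.int_pow_pow mult.assoc)
      then have "rel P ?b m" using n m unfolding rel_def by auto
      then have "?b \<in> V'" using abU unfolding V'_def by blast
      then show "g \<in> V <#> V'" using aV gab unfolding G.mem_set_mult by blast
    qed
    moreover have "V <#> V' \<subseteq> U" using G.set_mult_least[OF U] unfolding V_def V'_def by auto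
    ultimately have "U = V <#> V'" by auto
    then show ?case using G.locally_almost_stable_set_mult[OF hom_\<delta> V V' lasV lasV'] by simp
  qed
  have "\<exists>n. rel B g n" if g: "g \<in> U" for g
  proof -
    have "g \<in> torsion_part G" using g subgroup.mem_carrier[OF U g] torsion_G by auto
    then obtain n :: int where "n \<noteq> 0" "g [^] n = \<one>" unfolding G.torsion_part_int by auto
    then show ?thesis unfolding rel_def B_def by blast
  qed
  then show ?thesis using main[OF finB order_refl U] by blast
qed

end

section \<open>Groups of finite torsion-free rank\<close>

context comm_group
begin

lemma torsion_subgroup: "subgroup (torsion_part G) G"
proof (rule subgroupI)
  show "torsion_part G \<subseteq> carrier G" unfolding torsion_part_def by auto
  have "\<one> \<in> torsion_part G" unfolding torsion_part_def by (auto intro: exI[of _ 1])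
  then show "torsion_part G \<noteq> {}" by auto
  show "inv a \<in> torsion_part G" if "a \<in> torsion_part G" for a
    using that unfolding torsion_part_int by (auto simp: int_pow_inv)
  fix a b assume "a \<in> torsion_part G" "b \<in> torsion_part G"
  then obtain m n :: int where mn: "a \<in> carrier G" "b \<in> carrier G" "m \<noteq> 0" "n \<noteq> 0" "a [^] m = \<one>" "b [^] n = \<one>"
    unfolding torsion_part_int by auto
  have "a [^] (m * n) = \<one>" "b [^] (m * n) = \<one>"
    using pow_dvd_mem[OF triv_subgroup mn(1), of m "m * n"] pow_dvd_mem[OF triv_subgroup mn(2), of n "m * n"] mn by auto
  then have "(a \<otimes> b) [^] (m * n) = \<one>" using mn by (simp add: int_pow_distrib)
  then show "a \<otimes> b \<in> torsion_part G" using mn unfolding torsion_part_int by (auto intro!: exI[of _ "m * n"])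
qed

lemma torsion_isolated:
  assumes "x \<in> carrier G" "(n::int) \<noteq> 0" "x [^] n \<in> torsion_part G"
  shows "x \<in> torsion_part G"
proof -
  obtain m :: int where "m \<noteq> 0" "(x [^] n) [^] m = \<one>" using assms(3) unfolding torsion_part_int by auto
  then have "n * m \<noteq> 0" "x [^] (n * m) = \<one>" using assms by (auto simp: int_pow_pow)
  then show ?thesis using assms(1) unfolding torsion_part_int by blast
qed

lemma finprod_mem_subgroup:
  assumes "finite F" "subgroup H G" "\<And>x. x \<in> F \<Longrightarrow> f x \<in> H"
  shows "finprod G f F \<in> H"
  using assms(1,3)
proof (induction F)
  case empty
  then show ?case using subgroup.one_closed[OF assms(2)] by simp
next
  case (insert x F)
  have "f \<in> F \<rightarrow> carrier G" "f x \<in> carrier G" using insert.prems subgroup.mem_carrier[OF assms(2)] by auto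
  then show ?case using insert subgroup.m_closed[OF assms(2)] by (simp add: finprod_insert)
qed

text \<open>
  A maximal independent subset generates a subgroup modulo which the group is periodic.
\<close>

lemma finite_rank_essential_subgroup:
  assumes "finite_torsion_free_rank G"
  shows "\<exists>S. finite S \<and> S \<subseteq> carrier G \<and> (\<forall>a\<in>carrier G. \<exists>n::int. n \<noteq> 0 \<and> a [^] n \<in> generate G S)"
proof -
  obtain S where S: "finite S" "Z_independent G S" "\<And>S'. Z_independent G S' \<Longrightarrow> S \<subseteq> S' \<Longrightarrow> S' = S"
    using assms unfolding finite_torsion_free_rank_def maximal_Z_independent_def by blast
  have Sc: "S \<subseteq> carrier G" using S(2) unfolding Z_independent_def by auto
  have gS: "subgroup (generate G S) G" using generate_is_subgroup[OF Sc] .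
  have "\<exists>n::int. n \<noteq> 0 \<and> a [^] n \<in> generate G S" if a: "a \<in> carrier G" for a
  proof (cases "a \<in> S")
    case True
    then show ?thesis using generate.incl[of a S G] a by (intro exI[of _ 1]) simp
  next
    case False
    then have "\<not> Z_independent G (insert a S)" using S(3)[of "insert a S"] by auto
    then obtain F n x where F: "finite F" "F \<subseteq> insert a S" "finprod G (\<lambda>x. x [^] (n x :: int)) F = \<one>" "x \<in> F" "n x \<noteq> 0"
      using a Sc unfolding Z_independent_def by blast
    define F' where "F' = F - {a}"
    have F': "finite F'" "F' \<subseteq> S" "a \<notin> F'" using F unfolding F'_def by auto
    have cl: "(\<lambda>x. x [^] (n x :: int)) \<in> F' \<rightarrow> carrier G" using F' Sc by auto
    have ind: "finprod G (\<lambda>x. x [^] (n x :: int)) F' = \<one> \<Longrightarrow> (\<forall>x\<in>F'. n x = 0)"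
      using S(2) F' unfolding Z_independent_def by blast
    have aF: "a \<in> F"
    proof (rule ccontr)
      assume "a \<notin> F"
      then have "F' = F" unfolding F'_def by auto
      then show False using ind F by auto
    qed
    then have FF: "F = insert a F'" unfolding F'_def by auto
    have prod: "a [^] n a \<otimes> finprod G (\<lambda>x. x [^] (n x :: int)) F' = \<one>"
      using F(3) unfolding FF using finprod_insert[OF F'(1,3) cl] a by simp
    have "n a \<noteq> 0"
    proof
      assume "n a = 0"
      then have "\<forall>x\<in>F'. n x = 0" using prod ind finprod_closed[OF cl] by simp
      then show False using F(4,5) \<open>n a = 0\<close> unfolding FF by auto
    qed
    moreover have "a [^] n a \<in> generate G S"
    proof -
      have "finprod G (\<lambda>x. x [^] (n x :: int)) F' \<in> generate G S"
        by (rule finprod_mem_subgroup[OF F'(1) gS])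
          (use F' generate.incl[of _ S G] subgroup_int_pow_closed[OF gS] in blast)
      moreover have "a [^] n a = inv (finprod G (\<lambda>x. x [^] (n x :: int)) F')"
        using inv_equality[OF prod] finprod_closed[OF cl] a by simp
      ultimately show ?thesis using subgroup.m_inv_closed[OF gS] by metis
    qed
    ultimately show ?thesis by blast
  qed
  then show ?thesis using S(1) Sc by blast
qed

lemma generate_insert:
  assumes "S \<subseteq> carrier G" "x \<in> carrier G" "g \<in> generate G (insert x S)"
  obtains s i where "s \<in> generate G S" "g = s \<otimes> x [^] (i::int)"
proof -
  have gS: "subgroup (generate G S) G" using generate_is_subgroup[OF assms(1)] .
  have "insert x S \<subseteq> generate G S <#> range (\<lambda>i::int. x [^] i)"
    using insert_subgroup[OF gS assms(2)] generate.incl[of _ S G] by blast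
  from generate_subgroup_incl[OF this insert_subgroup(1)[OF gS assms(2)]] assms(3)
  show thesis using that unfolding set_mult_def by blast
qed

text \<open>
  If \<open>H/L\<close> is torsion-free of rank at most one, then \<open>H/(L + mH)\<close> is finite. For a prime \<open>p\<close> in place of \<open>m\<close>
  this quotient is cyclic, generated by any \<open>a\<close> outside \<open>L + pH\<close>: a relation \<open>i a + j b \<in> L\<close> can be divided by
  the greatest common divisor of \<open>i\<close> and \<open>j\<close>, and then \<open>p\<close> does not divide \<open>j\<close>.
\<close>

lemma finite_index_rank_one:
  assumes H: "subgroup H G" and L: "subgroup L G" "L \<subseteq> H"
    and isol: "\<And>c n. c \<in> H \<Longrightarrow> (n::int) \<noteq> 0 \<Longrightarrow> c [^] n \<in> L \<Longrightarrow> c \<in> L"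
    and dep: "\<And>a b. a \<in> H \<Longrightarrow> b \<in> H \<Longrightarrow> \<exists>(i::int) (j::int). (i \<noteq> 0 \<or> j \<noteq> 0) \<and> a [^] i \<otimes> b [^] j \<in> L"
    and m: "(m::int) \<noteq> 0"
  shows "finite_index H (L <#> (\<lambda>h. h [^] m) ` H)"
  using m
proof (induction m rule: prime_divisors_induct)
  have Hc: "H \<subseteq> carrier G" using subgroup.subset[OF H] .
  have sub: "subgroup (L <#> (\<lambda>h. h [^] (n::int)) ` H) G" for n using mult_subgroups[OF L(1) subgroup_powers[OF H]] .
  {
    case (unit m)
    have "H \<subseteq> L <#> (\<lambda>h. h [^] m) ` H"
    proof
      fix h assume h: "h \<in> H"
      obtain k where k: "1 = m * k" using unit(1) by (elim dvdE)
      have "h = (h [^] k) [^] m" using h Hc k by (simp add: int_pow_pow subsetD mult.commute)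
      moreover have "h [^] k \<in> H" using subgroup_int_pow_closed[OF H h] .
      ultimately have "h \<in> (\<lambda>h. h [^] m) ` H" by blast
      then show "h \<in> L <#> (\<lambda>h. h [^] m) ` H" using subset_set_mult_right[OF L(1) subgroup_powers[OF H]] by blast
    qed
    then show ?case using finite_index_refl[OF sub _ H] by blast
  next
    case (factor p m)
    then have m: "m \<noteq> 0" by auto
    let ?L = "L <#> (\<lambda>h. h [^] p) ` H"
    have LL: "L \<subseteq> ?L" using subset_set_mult_left[OF L(1) subgroup_powers[OF H]] .
    have pL: "h [^] p \<in> ?L" if "h \<in> H" for h using that subset_set_mult_right[OF L(1) subgroup_powers[OF H]] by blast
    have 1: "finite_index H ?L"
    proof (cases "H \<subseteq> ?L")
      case True
      then show ?thesis using finite_index_refl[OF sub _ H] by blast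
    next
      case False
      then obtain a where a: "a \<in> H" "a \<notin> ?L" by auto
      have ac: "a \<in> carrier G" using a Hc by auto
      show ?thesis
      proof (rule finite_index_cover[OF sub Hc])
        show "finite ((\<lambda>i::int. a [^] i) ` {0..<p})" "(\<lambda>i::int. a [^] i) ` {0..<p} \<subseteq> carrier G" using ac by auto
        fix b assume b: "b \<in> H"
        then have bc: "b \<in> carrier G" using Hc by auto
        obtain i j :: int where ij: "i \<noteq> 0 \<or> j \<noteq> 0" "a [^] i \<otimes> b [^] j \<in> L" using dep[OF a(1) b] by blast
        define g where "g = gcd i j"
        have g0: "g \<noteq> 0" using ij unfolding g_def by auto
        obtain i' j' where ij': "i = i' * g" "j = j' * g" "coprime i' j'"
          unfolding g_def using gcd_coprime_exists[of i j] g0 unfolding g_def by auto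
        have "(a [^] i' \<otimes> b [^] j') [^] g = a [^] i \<otimes> b [^] j"
          unfolding ij' by (rule abelian_normal_form2[of a b]) (use ac bc in simp_all)
        then have "(a [^] i' \<otimes> b [^] j') [^] g \<in> L" using ij by simp
        moreover have "a [^] i' \<otimes> b [^] j' \<in> H" using subgroup.m_closed[OF H] subgroup_int_pow_closed[OF H] a b by blast
        ultimately have l: "a [^] i' \<otimes> b [^] j' \<in> L" using isol g0 by blast
        have nd: "\<not> p dvd j'"
        proof
          assume d: "p dvd j'"
          then have "\<not> p dvd i'" using ij'(3) factor.hyps(1) by (meson coprime_common_divisor not_prime_unit)
          then have "coprime i' p" using prime_imp_coprime[OF factor.hyps(1)] coprime_commute by blast
          then have "gcd i' p = 1" by simp
          obtain k where k: "j' = p * k" using d by auto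
          have "(a [^] i' \<otimes> b [^] j') \<otimes> inv ((b [^] p) [^] k) = a [^] i'"
            unfolding k by (rule abelian_normal_form2[of a b]) (use ac bc in simp_all)
          moreover have "(a [^] i' \<otimes> b [^] j') \<otimes> inv ((b [^] p) [^] k) \<in> ?L"
            by (rule subgroup.m_closed[OF sub subsetD[OF LL l]
                  subgroup.m_inv_closed[OF sub subgroup_int_pow_closed[OF sub pL[OF b]]]])
          ultimately have "a [^] i' \<in> ?L" by simp
          then have "a [^] (gcd i' p) \<in> ?L" using pow_gcd_mem[OF sub ac] pL[OF a(1)] by blast
          then show False using a ac \<open>gcd i' p = 1\<close> by simp
        qed
        have "coprime j' p" using prime_imp_coprime[OF factor.hyps(1) nd] coprime_commute by blast
        then have "gcd j' p = 1" by simp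
        then obtain u v where uv: "u * j' + v * p = 1" using bezout_int by metis
        define e where "e = (- i' * u) mod p"
        define q where "q = (- i' * u) div p"
        have eq: "- i' * u = q * p + e" unfolding e_def q_def by simp
        have "b \<otimes> inv (a [^] e) = b [^] (u * j' + v * p) \<otimes> inv (a [^] e)" using uv bc by simp
        also have "\<dots> = (a [^] i' \<otimes> b [^] j') [^] u \<otimes> (b [^] p) [^] v \<otimes> (a [^] p) [^] q"
        proof -
          have e: "e = - i' * u - q * p" using eq by simp
          show ?thesis unfolding e
            by (rule abelian_normal_form2[of a b]) (use ac bc in \<open>simp_all add: algebra_simps\<close>)
        qed
        also have "\<dots> \<in> ?L"
        proof -
          have "a [^] i' \<otimes> b [^] j' \<in> ?L" using l LL by blast
          then show ?thesis
            by (rule subgroup.m_closed[OF sub subgroup.m_closed[OF sub subgroup_int_pow_closed[OF sub]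
                  subgroup_int_pow_closed[OF sub pL[OF b]]] subgroup_int_pow_closed[OF sub pL[OF a(1)]]])
        qed
        finally have "b \<otimes> inv (a [^] e) \<in> ?L" .
        moreover have "e \<in> {0..<p}" unfolding e_def using prime_gt_0_int[OF factor.hyps(1)] by simp
        ultimately show "\<exists>r\<in>(\<lambda>i::int. a [^] i) ` {0..<p}. b \<otimes> inv r \<in> ?L" by blast
      qed
    qed
    obtain R where R: "finite R" "R \<subseteq> H" "\<And>h. h \<in> H \<Longrightarrow> \<exists>r\<in>R. h \<otimes> inv r \<in> L <#> (\<lambda>h. h [^] m) ` H"
      using factor.IH[OF m] unfolding finite_index_def by blast
    obtain S where S: "finite S" "S \<subseteq> H" "\<And>h. h \<in> H \<Longrightarrow> \<exists>r\<in>S. h \<otimes> inv r \<in> ?L"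
      using 1 unfolding finite_index_def by blast
    show ?case
    proof (rule finite_index_cover[OF sub Hc])
      let ?R = "(\<lambda>(s, r). s [^] m \<otimes> r) ` (S \<times> R)"
      show "finite ?R" using R S by auto
      show "?R \<subseteq> carrier G" using subset_trans[OF R(2) Hc] subset_trans[OF S(2) Hc] by auto
      fix h assume h: "h \<in> H"
      obtain r where r: "r \<in> R" "h \<otimes> inv r \<in> L <#> (\<lambda>h. h [^] m) ` H" using R(3)[OF h] by blast
      then obtain l g where lg: "l \<in> L" "g \<in> H" "h \<otimes> inv r = l \<otimes> g [^] m" unfolding set_mult_def by blast
      obtain s where s: "s \<in> S" "g \<otimes> inv s \<in> ?L" using S(3)[OF lg(2)] by blast
      then obtain l' k where lk: "l' \<in> L" "k \<in> H" "g \<otimes> inv s = l' \<otimes> k [^] p" unfolding set_mult_def by blast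
      have c: "h \<in> carrier G" "r \<in> carrier G" "l \<in> carrier G" "g \<in> carrier G" "s \<in> carrier G" "l' \<in> carrier G" "k \<in> carrier G"
        using h r(1) lg(1,2) s(1) lk(1,2) R(2) S(2) L(2) Hc by blast+
      have "h \<otimes> inv (s [^] m \<otimes> r) = (h \<otimes> inv r) \<otimes> inv (s [^] m)"
        by (rule abelian_normal_form3[of h r s]) (use c in simp_all)
      also have "\<dots> = l \<otimes> (g \<otimes> inv s) [^] m"
        unfolding lg(3) by (rule abelian_normal_form3[of l g s]) (use c in simp_all)
      also have "\<dots> = (l \<otimes> l' [^] m) \<otimes> k [^] (p * m)"
        unfolding lk(3) by (rule abelian_normal_form3[of l l' k]) (use c in simp_all)
      finally have "h \<otimes> inv (s [^] m \<otimes> r) = (l \<otimes> l' [^] m) \<otimes> k [^] (p * m)" .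
      moreover have "l \<otimes> l' [^] m \<in> L" using subgroup.m_closed[OF L(1)] subgroup_int_pow_closed[OF L(1)] lg lk by blast
      ultimately have "h \<otimes> inv (s [^] m \<otimes> r) \<in> L <#> (\<lambda>h. h [^] (p * m)) ` H" using lk(2) unfolding mem_set_mult by blast
      then show "\<exists>r\<in>?R. h \<otimes> inv r \<in> L <#> (\<lambda>h. h [^] (p * m)) ` H" using r(1) s(1) by force
    qed
  }
qed auto

text \<open>
  If \<open>H\<close> is periodic modulo a finitely generated group, then \<open>H/(T(H) + mH)\<close> is finite. The
  induction drops one generator at a time and splits off a quotient of rank at most one.
\<close>

lemma finite_index_torsion_powers:
  assumes "finite S" "S \<subseteq> carrier G" "subgroup H G"
    and "\<And>h. h \<in> H \<Longrightarrow> \<exists>n::int. n \<noteq> 0 \<and> h [^] n \<in> generate G S"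
    and m: "(m::int) \<noteq> 0"
  shows "finite_index H ((H \<inter> torsion_part G) <#> (\<lambda>h. h [^] m) ` H)"
  using assms(1-4)
proof (induction S arbitrary: H)
  case empty
  have sub: "subgroup ((H \<inter> torsion_part G) <#> (\<lambda>h. h [^] m) ` H) G"
    using mult_subgroups[OF subgroups_Inter_pair[OF empty(2) torsion_subgroup] subgroup_powers[OF empty(2)]] .
  have "H \<subseteq> H \<inter> torsion_part G"
    using empty(3) subgroup.mem_carrier[OF empty(2)] generate_empty unfolding torsion_part_int by auto
  then have "H \<subseteq> (H \<inter> torsion_part G) <#> (\<lambda>h. h [^] m) ` H"
    using subset_set_mult_left[OF subgroups_Inter_pair[OF empty(2) torsion_subgroup] subgroup_powers[OF empty(2)]] by blast
  then show ?case using finite_index_refl[OF sub _ empty(2)] by blast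
next
  case (insert x S)
  note H = insert.prems(2)
  have Hc: "H \<subseteq> carrier G" using subgroup.subset[OF H] .
  have xc: "x \<in> carrier G" and Sc: "S \<subseteq> carrier G" using insert.prems by auto
  have gS: "subgroup (generate G S) G" using generate_is_subgroup[OF Sc] .
  \<comment> \<open>The elements of \<open>H\<close> that depend on the remaining generators.\<close>
  define L where "L = {h \<in> H. \<exists>n::int. n \<noteq> 0 \<and> h [^] n \<in> generate G S}"
  have L: "subgroup L G"
  proof (rule subgroupI)
    show "L \<subseteq> carrier G" using Hc unfolding L_def by auto
    have "\<one> \<in> L" using subgroup.one_closed[OF H] subgroup.one_closed[OF gS] unfolding L_def by (auto intro: exI[of _ 1])
    then show "L \<noteq> {}" by auto
    show "inv a \<in> L" if "a \<in> L" for a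
      using that subgroup.m_inv_closed[OF H] subgroup.m_inv_closed[OF gS] subsetD[OF Hc] int_pow_inv unfolding L_def by force
    fix a b assume ab: "a \<in> L" "b \<in> L"
    then obtain k l :: int where kl: "k \<noteq> 0" "a [^] k \<in> generate G S" "l \<noteq> 0" "b [^] l \<in> generate G S" unfolding L_def by auto
    have c: "a \<in> carrier G" "b \<in> carrier G" using ab Hc unfolding L_def by auto
    have "(a \<otimes> b) [^] (k * l) = (a [^] k) [^] l \<otimes> (b [^] l) [^] k"
      by (rule abelian_normal_form2[of a b]) (use c in \<open>simp_all add: mult.commute\<close>)
    then have "(a \<otimes> b) [^] (k * l) \<in> generate G S"
      using kl subgroup.m_closed[OF gS] subgroup_int_pow_closed[OF gS] by metis
    moreover have "a \<otimes> b \<in> H" using ab subgroup.m_closed[OF H] unfolding L_def by auto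
    moreover have "k * l \<noteq> 0" using kl by auto
    ultimately show "a \<otimes> b \<in> L" unfolding L_def by blast
  qed
  have LH: "L \<subseteq> H" unfolding L_def by auto
  have sub: "subgroup ((H \<inter> torsion_part G) <#> (\<lambda>h. h [^] m) ` H) G"
    using mult_subgroups[OF subgroups_Inter_pair[OF H torsion_subgroup] subgroup_powers[OF H]] .
  have sub2: "subgroup (L <#> (\<lambda>h. h [^] m) ` H) G"
    using mult_subgroups[OF L subgroup_powers[OF H]] .
  have 1: "finite_index H (L <#> (\<lambda>h. h [^] m) ` H)"
  proof (rule finite_index_rank_one[OF H L LH _ _ m])
    fix c and n :: int assume c: "c \<in> H" "n \<noteq> 0" "c [^] n \<in> L"
    then obtain k :: int where "k \<noteq> 0" "(c [^] n) [^] k \<in> generate G S" unfolding L_def by auto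
    then have "n * k \<noteq> 0" "c [^] (n * k) \<in> generate G S" using c subsetD[OF Hc c(1)] by (auto simp: int_pow_pow)
    then show "c \<in> L" using c(1) unfolding L_def by blast
  next
    fix a b assume ab: "a \<in> H" "b \<in> H"
    have c: "a \<in> carrier G" "b \<in> carrier G" using ab Hc by auto
    obtain n k :: int where nk: "n \<noteq> 0" "a [^] n \<in> generate G (insert x S)" "k \<noteq> 0" "b [^] k \<in> generate G (insert x S)"
      using insert.prems(3)[OF ab(1)] insert.prems(3)[OF ab(2)] by blast
    obtain s i where s: "s \<in> generate G S" "a [^] n = s \<otimes> x [^] (i::int)" using generate_insert[OF Sc xc nk(2)] by metis
    obtain t j where t: "t \<in> generate G S" "b [^] k = t \<otimes> x [^] (j::int)" using generate_insert[OF Sc xc nk(4)] by metis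
    have stc: "s \<in> carrier G" "t \<in> carrier G" using s(1) t(1) subgroup.subset[OF gS] by auto
    show "\<exists>(i::int) (j::int). (i \<noteq> 0 \<or> j \<noteq> 0) \<and> a [^] i \<otimes> b [^] j \<in> L"
    proof (cases "i = 0")
      case True
      then have "a [^] n \<in> generate G S" using s stc by simp
      then have "a \<in> L" using ab nk unfolding L_def by blast
      then have "((1::int) \<noteq> 0 \<or> (0::int) \<noteq> 0) \<and> a [^] (1::int) \<otimes> b [^] (0::int) \<in> L" using c by simp
      then show ?thesis by blast
    next
      case False
      have "a [^] (n * j) \<otimes> b [^] (- k * i) = (a [^] n) [^] j \<otimes> (b [^] k) [^] (- i)"
        using c by (simp add: int_pow_pow)
      also have "\<dots> = s [^] j \<otimes> t [^] (- i)"
        unfolding s(2) t(2) by (rule abelian_normal_form3[of s t x]) (use stc xc in \<open>simp_all add: algebra_simps\<close>)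
      also have "\<dots> \<in> generate G S" using s t subgroup.m_closed[OF gS] subgroup_int_pow_closed[OF gS] by blast
      finally have "a [^] (n * j) \<otimes> b [^] (- k * i) \<in> generate G S" .
      moreover have abH: "a [^] (n * j) \<otimes> b [^] (- k * i) \<in> H"
        using ab subgroup.m_closed[OF H] subgroup_int_pow_closed[OF H] by blast
      ultimately have "a [^] (n * j) \<otimes> b [^] (- k * i) \<in> L"
        unfolding L_def using subsetD[OF Hc abH] by (auto intro!: exI[of _ 1])
      moreover have "- k * i \<noteq> 0" using False nk by simp
      ultimately show ?thesis by blast
    qed
  qed
  have "finite_index L ((L \<inter> torsion_part G) <#> (\<lambda>h. h [^] m) ` L)"
    by (rule insert.IH[OF Sc L]) (simp add: L_def)
  then obtain R where R: "finite R" "R \<subseteq> L" "\<And>h. h \<in> L \<Longrightarrow> \<exists>r\<in>R. h \<otimes> inv r \<in> (L \<inter> torsion_part G) <#> (\<lambda>h. h [^] m) ` L"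
    unfolding finite_index_def by blast
  have 2: "finite_index (L <#> (\<lambda>h. h [^] m) ` H) ((H \<inter> torsion_part G) <#> (\<lambda>h. h [^] m) ` H)"
  proof (rule finite_index_cover[OF sub])
    show "L <#> (\<lambda>h. h [^] m) ` H \<subseteq> carrier G" using subgroup.subset[OF sub2] .
    show "finite R" "R \<subseteq> carrier G" using R LH Hc by auto
    fix y assume "y \<in> L <#> (\<lambda>h. h [^] m) ` H"
    then obtain l g where lg: "l \<in> L" "g \<in> H" "y = l \<otimes> g [^] m" unfolding set_mult_def by blast
    obtain r where r: "r \<in> R" "l \<otimes> inv r \<in> (L \<inter> torsion_part G) <#> (\<lambda>h. h [^] m) ` L" using R(3)[OF lg(1)] by blast
    then obtain t k where tk: "t \<in> L \<inter> torsion_part G" "k \<in> L" "l \<otimes> inv r = t \<otimes> k [^] m" unfolding set_mult_def by blast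
    have c: "l \<in> carrier G" "g \<in> carrier G" "r \<in> carrier G" "t \<in> carrier G" "k \<in> carrier G"
      using lg(1,2) r(1) tk(1,2) R(2) LH Hc by blast+
    have "y \<otimes> inv r = (l \<otimes> inv r) \<otimes> g [^] m"
      unfolding lg(3) by (rule abelian_normal_form3[of l g r]) (use c in simp_all)
    also have "\<dots> = t \<otimes> (k \<otimes> g) [^] m"
      unfolding tk(3) by (rule abelian_normal_form3[of t k g]) (use c in simp_all)
    finally have "y \<otimes> inv r = t \<otimes> (k \<otimes> g) [^] m" .
    moreover have "k \<otimes> g \<in> H" using tk lg LH subgroup.m_closed[OF H] by blast
    moreover have "t \<in> H \<inter> torsion_part G" using tk LH by blast
    ultimately have "y \<otimes> inv r \<in> (H \<inter> torsion_part G) <#> (\<lambda>h. h [^] m) ` H" unfolding mem_set_mult by blast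
    then show "\<exists>r\<in>R. y \<otimes> inv r \<in> (H \<inter> torsion_part G) <#> (\<lambda>h. h [^] m) ` H" using r(1) by blast
  qed
  show ?case using finite_index_trans[OF 1 2 sub sub2 H] .
qed

end

section \<open>Finitely generated groups\<close>

context comm_group
begin

text \<open>
  Subgroups of finitely generated abelian groups are finitely generated, in a form relative to a
  subgroup \<open>L\<close>: if \<open>H\<close> lies in a finitely generated group plus \<open>L\<close>, then \<open>H\<close> is finitely generated modulo
  \<open>H \<inter> L\<close>.
\<close>

lemma finitely_generated_mod_subgroup:
  assumes "finite S" "S \<subseteq> carrier G" "subgroup L G" "subgroup H G" "H \<subseteq> generate G S <#> L"
  shows "\<exists>R. finite R \<and> R \<subseteq> H \<and> (\<forall>h\<in>H. \<exists>g\<in>generate G R. \<exists>l\<in>H \<inter> L. h = g \<otimes> l)"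
  using assms(1,2,4,5)
proof (induction S arbitrary: H)
  case empty
  have "h \<in> L" if "h \<in> H" for h
    using that empty(3) generate_empty subgroup.mem_carrier[OF assms(3)] by (auto simp: set_mult_def)
  then have "\<exists>l\<in>H \<inter> L. h = \<one> \<otimes> l" if "h \<in> H" for h
    using that subgroup.mem_carrier[OF empty(2) that] by (intro bexI[of _ h]) auto
  then show ?case using generate.one[of G "{}"] by (intro exI[of _ "{}"]) blast
next
  case (insert x S)
  note H = insert.prems(2)
  have Hc: "H \<subseteq> carrier G" using subgroup.subset[OF H] .
  have xc: "x \<in> carrier G" and Sc: "S \<subseteq> carrier G" using insert.prems by auto
  have gS: "subgroup (generate G S) G" using generate_is_subgroup[OF Sc] .
  let ?N = "generate G S <#> L"
  have N: "subgroup ?N G" using mult_subgroups[OF gS assms(3)] .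
  have H1: "subgroup (H \<inter> ?N) G" using subgroups_Inter_pair[OF H N] .
  obtain R where R0: "finite R \<and> R \<subseteq> H \<inter> ?N \<and> (\<forall>h\<in>H \<inter> ?N. \<exists>g\<in>generate G R. \<exists>l\<in>(H \<inter> ?N) \<inter> L. h = g \<otimes> l)"
    using insert.IH[OF Sc H1 Int_lower2] by (rule exE)
  note R = conjunct1[OF R0] conjunct1[OF conjunct2[OF R0]] bspec[OF conjunct2[OF conjunct2[OF R0]]]
  \<comment> \<open>The set of exponents of \<open>x\<close> that occur in \<open>H\<close>; it is generated by its least positive element.\<close>
  define D where "D i \<longleftrightarrow> (\<exists>h\<in>H. h \<otimes> inv (x [^] (i::int)) \<in> ?N)" for i
  have hD: "\<exists>i::int. h \<otimes> inv (x [^] i) \<in> ?N" if h: "h \<in> H" for h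
  proof -
    obtain g l where gl: "g \<in> generate G (insert x S)" "l \<in> L" "h = g \<otimes> l" using h insert.prems(3) unfolding set_mult_def by blast
    obtain s i where si: "s \<in> generate G S" "g = s \<otimes> x [^] (i::int)" using generate_insert[OF Sc xc gl(1)] by metis
    have c: "s \<in> carrier G" "l \<in> carrier G" using si(1) gl(2) subgroup.subset[OF gS] subgroup.subset[OF assms(3)] by auto
    have "h \<otimes> inv (x [^] i) = s \<otimes> l"
      unfolding gl(3) si(2) by (rule abelian_normal_form3[of s l x]) (use c xc in simp_all)
    then show ?thesis using si(1) gl(2) unfolding mem_set_mult by blast
  qed
  show ?case
  proof (cases "\<exists>d::nat. d > 0 \<and> D (int d)")
    case False
    have D0: "i = 0" if "D i" for i
    proof (rule ccontr)
      assume "i \<noteq> 0"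
      have "D (- i)"
      proof -
        obtain h where h: "h \<in> H" "h \<otimes> inv (x [^] i) \<in> ?N" using \<open>D i\<close> unfolding D_def by blast
        have "inv h \<otimes> inv (x [^] (- i)) = inv (h \<otimes> inv (x [^] i))"
          by (rule abelian_normal_form2[of h x]) (use xc subsetD[OF Hc h(1)] in simp_all)
        then have "inv h \<otimes> inv (x [^] (- i)) \<in> ?N" using subgroup.m_inv_closed[OF N h(2)] by simp
        then show ?thesis using subgroup.m_inv_closed[OF H h(1)] unfolding D_def by blast
      qed
      then show False using False that \<open>i \<noteq> 0\<close> zero_less_nat_eq[of i] zero_less_nat_eq[of "-i"]
        by (cases "i > 0") (auto dest: spec[of _ "nat i"] spec[of _ "nat (- i)"])
    qed
    have "h \<in> ?N" if h: "h \<in> H" for h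
    proof -
      obtain i :: int where i: "h \<otimes> inv (x [^] i) \<in> ?N" using hD[OF h] by blast
      then have "i = 0" using D0 h unfolding D_def by blast
      then show ?thesis using i subsetD[OF Hc h] by simp
    qed
    then have HN: "H \<inter> ?N = H" by auto
    show ?thesis using R0 unfolding HN by (rule exI)
  next
    case True
    define d where "d = (LEAST d::nat. d > 0 \<and> D (int d))"
    have d: "d > 0" "D (int d)" using LeastI_ex[OF True] unfolding d_def by auto
    have dmin: "\<not> D (int k)" if "0 < k" "k < d" for k using not_less_Least[of k] that unfolding d_def by blast
    obtain h0 where h0: "h0 \<in> H" "h0 \<otimes> inv (x [^] int d) \<in> ?N" using d unfolding D_def by blast
    have h0c: "h0 \<in> carrier G" using h0 Hc by auto
    have Rc: "insert h0 R \<subseteq> carrier G" using R(2) Hc h0c by blast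
    have gR: "subgroup (generate G (insert h0 R)) G" using generate_is_subgroup[OF Rc] .
    show ?thesis
    proof (intro exI[of _ "insert h0 R"] conjI ballI)
      show "finite (insert h0 R)" "insert h0 R \<subseteq> H" using R h0 by auto
      fix h assume h: "h \<in> H"
      have hc: "h \<in> carrier G" using h Hc by auto
      obtain i :: int where i: "h \<otimes> inv (x [^] i) \<in> ?N" using hD[OF h] by blast
      define q where "q = i div int d"
      define r where "r = i mod int d"
      have iqr: "i = int d * q + r" unfolding q_def r_def by simp
      define h1 where "h1 = h \<otimes> inv (h0 [^] q)"
      have h1H: "h1 \<in> H" unfolding h1_def
        using h h0 subgroup.m_closed[OF H] subgroup.m_inv_closed[OF H] subgroup_int_pow_closed[OF H] by blast
      have "h1 \<otimes> inv (x [^] r) = (h \<otimes> inv (x [^] i)) \<otimes> inv ((h0 \<otimes> inv (x [^] int d)) [^] q)"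
        unfolding h1_def iqr by (rule abelian_normal_form3[of h h0 x]) (use hc h0c xc in \<open>simp_all add: algebra_simps\<close>)
      then have h1N: "h1 \<otimes> inv (x [^] r) \<in> ?N"
        using i h0 subgroup.m_closed[OF N] subgroup.m_inv_closed[OF N] subgroup_int_pow_closed[OF N] by metis
      have "r = 0"
      proof (rule ccontr)
        assume "r \<noteq> 0"
        moreover have "0 \<le> r" "r < int d" unfolding r_def using d by auto
        ultimately have "0 < nat r" "nat r < d" "int (nat r) = r" by auto
        then show False using dmin[of "nat r"] h1H h1N unfolding D_def by auto
      qed
      have h1c: "h1 \<in> carrier G" using h1H Hc by auto
      then have "h1 \<in> H \<inter> ?N" using h1H h1N \<open>r = 0\<close> by simp
      then obtain g l where gl: "g \<in> generate G R" "l \<in> H \<inter> L" "h1 = g \<otimes> l" using R(3) by blast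
      have g: "g \<in> generate G (insert h0 R)" using gl(1) mono_generate[of R "insert h0 R"] by blast
      have c: "g \<in> carrier G" "l \<in> carrier G" using g gl(2) subgroup.subset[OF gR] Hc by auto
      have "h = h1 \<otimes> h0 [^] q" unfolding h1_def
        by (rule abelian_normal_form2[of h h0]) (use hc h0c in simp_all)
      also have "\<dots> = (g \<otimes> h0 [^] q) \<otimes> l"
        unfolding gl(3) by (rule abelian_normal_form3[of g h0 l]) (use c h0c in simp_all)
      finally have "h = (g \<otimes> h0 [^] q) \<otimes> l" .
      moreover have "g \<otimes> h0 [^] q \<in> generate G (insert h0 R)"
        using g generate.incl[of h0 "insert h0 R" G] subgroup.m_closed[OF gR] subgroup_int_pow_closed[OF gR] by blast
      ultimately show "\<exists>g\<in>generate G (insert h0 R). \<exists>l\<in>H \<inter> L. h = g \<otimes> l" using gl(2) by blast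
    qed
  qed
qed

text \<open>
  A finitely generated group that is periodic modulo \<open>M\<close> meets only finitely many cosets of \<open>M\<close>.
\<close>

lemma finite_cover_generate_mod:
  assumes "finite R" "R \<subseteq> carrier G" "subgroup M G" "\<And>r. r \<in> R \<Longrightarrow> \<exists>n::int. n \<noteq> 0 \<and> r [^] n \<in> M"
  shows "\<exists>C. finite C \<and> C \<subseteq> carrier G \<and> (\<forall>g\<in>generate G R. \<exists>c\<in>C. g \<otimes> inv c \<in> M)"
  using assms(1,2,4)
proof (induction R)
  case empty
  then show ?case using generate_empty subgroup.one_closed[OF assms(3)] by (intro exI[of _ "{\<one>}"]) auto
next
  case (insert r R)
  have rc: "r \<in> carrier G" and Rc: "R \<subseteq> carrier G" using insert.prems by auto
  obtain C where C: "finite C" "C \<subseteq> carrier G" "\<And>g. g \<in> generate G R \<Longrightarrow> \<exists>c\<in>C. g \<otimes> inv c \<in> M"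
    using insert.IH[OF Rc] insert.prems(2) by blast
  obtain n :: int where n: "n \<noteq> 0" "r [^] n \<in> M" using insert.prems(2) by blast
  let ?C = "(\<lambda>(c, i). c \<otimes> r [^] i) ` (C \<times> {- \<bar>n\<bar>..\<bar>n\<bar>})"
  have "\<exists>c\<in>?C. g \<otimes> inv c \<in> M" if g: "g \<in> generate G (insert r R)" for g
  proof -
    obtain s i where si: "s \<in> generate G R" "g = s \<otimes> r [^] (i::int)" using generate_insert[OF Rc rc g] by metis
    obtain c where c: "c \<in> C" "s \<otimes> inv c \<in> M" using C(3)[OF si(1)] by blast
    have sc: "s \<in> carrier G" "c \<in> carrier G" using generate_in_carrier[OF Rc si(1)] c C by auto
    define q where "q = i div n"
    define e where "e = i mod n"
    have iqr: "i = n * q + e" unfolding q_def e_def by simp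
    have "g \<otimes> inv (c \<otimes> r [^] e) = (s \<otimes> inv c) \<otimes> (r [^] n) [^] q"
      unfolding si(2) iqr by (rule abelian_normal_form3[of s c r]) (use sc rc in \<open>simp_all add: algebra_simps\<close>)
    then have "g \<otimes> inv (c \<otimes> r [^] e) \<in> M"
      using c n subgroup.m_closed[OF assms(3)] subgroup_int_pow_closed[OF assms(3)] by metis
    moreover have "e \<in> {- \<bar>n\<bar>..\<bar>n\<bar>}" using abs_mod_less[OF n(1), of i] unfolding e_def by auto
    ultimately show ?thesis using c(1) by force
  qed
  moreover have "finite ?C" "?C \<subseteq> carrier G" using C(1) subsetD[OF C(2)] rc by auto
  ultimately show ?case by blast
qed

end

section \<open>Splitting off the torsion subgroup\<close>

context comm_group
begin

text \<open>
  Every subgroup \<open>B\<close> is the sum of its torsion subgroup and of a subgroup \<open>K\<close> whose torsion elements are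
  \<open>n\<close>-fold multiples of torsion elements of \<open>B\<close>. The claim for \<open>n\<close> follows from that for its prime factors,
  applied one after the other to the subgroups obtained; for a prime \<open>p\<close> it says that the image of \<open>T(B)\<close> in
  the vector space \<open>B/pB\<close> has a complement. If \<open>T(B)\<close> has exponent \<open>n\<close>, it follows that \<open>T(B)\<close> is a direct summand.
\<close>

lemma split_mod_powers:
  assumes "(n::int) \<noteq> 0" "subgroup B G"
  shows "\<exists>K. subgroup K G \<and> K \<subseteq> B \<and> B \<subseteq> K <#> (B \<inter> torsion_part G) \<and>
    K \<inter> torsion_part G \<subseteq> (\<lambda>x. x [^] n) ` (B \<inter> torsion_part G)"
  using assms
proof (induction n arbitrary: B rule: prime_divisors_induct)
  case (unit m)
  note B = \<open>subgroup B G\<close>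
  have Bc: "B \<subseteq> carrier G" using subgroup.subset[OF B] .
  have BT: "subgroup (B \<inter> torsion_part G) G" using subgroups_Inter_pair[OF B torsion_subgroup] .
  obtain k where k: "1 = m * k" using unit(1) by (elim dvdE)
  have "B \<inter> torsion_part G \<subseteq> (\<lambda>x. x [^] m) ` (B \<inter> torsion_part G)"
  proof
    fix x assume x: "x \<in> B \<inter> torsion_part G"
    have "x = (x [^] k) [^] m" using x Bc k by (simp add: int_pow_pow subsetD mult.commute)
    moreover have "x [^] k \<in> B \<inter> torsion_part G" using subgroup_int_pow_closed[OF BT x] .
    ultimately show "x \<in> (\<lambda>x. x [^] m) ` (B \<inter> torsion_part G)" by blast
  qed
  then show ?case using subset_set_mult_left[OF B BT] B by blast
next
  case (factor p m)
  note B = \<open>subgroup B G\<close>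
  have m: "m \<noteq> 0" using factor.prems by auto
  obtain C where C: "subgroup C G" "C \<subseteq> B" "B \<subseteq> C <#> (B \<inter> torsion_part G)"
      "C \<inter> torsion_part G \<subseteq> (\<lambda>x. x [^] m) ` (B \<inter> torsion_part G)"
    using factor.IH[OF m B] by blast
  let ?T = "torsion_part G"
  have Bc: "B \<subseteq> carrier G" using subgroup.subset[OF B] .
  have Cc: "C \<subseteq> carrier G" using subgroup.subset[OF C(1)] .
  have CT: "subgroup (C \<inter> ?T) G" using subgroups_Inter_pair[OF C(1) torsion_subgroup] .
  have BT: "subgroup (B \<inter> ?T) G" using subgroups_Inter_pair[OF B torsion_subgroup] .
  have p: "p \<noteq> 0" using factor.hyps by auto
  \<comment> \<open>A subgroup avoiding \<open>W\<close> is contained in \<open>C\<close> and meets \<open>T\<close> in multiples of \<open>p\<close> only.\<close>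
  define W where "W = (?T - (\<lambda>x. x [^] p) ` (C \<inter> ?T)) \<union> (carrier G - C)"
  have "(\<lambda>x. x [^] p) ` C \<inter> W = {}"
  proof -
    have "c [^] p \<notin> W" if c: "c \<in> C" for c
    proof
      assume w: "c [^] p \<in> W"
      have "c [^] p \<in> C" using subgroup_int_pow_closed[OF C(1) c] .
      then have "c [^] p \<in> ?T" "c [^] p \<notin> (\<lambda>x. x [^] p) ` (C \<inter> ?T)" using w unfolding W_def by auto
      moreover have "c \<in> ?T" using torsion_isolated[OF subsetD[OF Cc c] p] calculation by blast
      ultimately show False using c by blast
    qed
    then show ?thesis by blast
  qed
  from maximal_subgroup_avoiding[OF subgroup_powers[OF C(1)] this]
  obtain K where K: "subgroup K G" "(\<lambda>x. x [^] p) ` C \<subseteq> K" "K \<inter> W = {}"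
    and max: "\<forall>M'. subgroup M' G \<longrightarrow> K \<subseteq> M' \<longrightarrow> M' \<inter> W = {} \<longrightarrow> M' = K" by blast
  have Kc: "K \<subseteq> carrier G" using subgroup.subset[OF K(1)] .
  have KC: "K \<subseteq> C" using K(3) Kc unfolding W_def by blast
  have KT: "K \<inter> ?T \<subseteq> (\<lambda>x. x [^] p) ` (C \<inter> ?T)" using K(3) unfolding W_def by blast
  have sKT: "subgroup (K <#> (C \<inter> ?T)) G" using mult_subgroups[OF K(1) CT] .
  have Csub: "C \<subseteq> K <#> (C \<inter> ?T)"
  proof (rule ccontr)
    assume "\<not> ?thesis"
    then obtain b where b: "b \<in> C" "b \<notin> K <#> (C \<inter> ?T)" by auto
    have bc: "b \<in> carrier G" using b Cc by auto
    let ?K = "K <#> range (\<lambda>i::int. b [^] i)"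
    note K' = insert_subgroup[OF K(1) bc]
    have K'C: "?K \<subseteq> C"
      using set_mult_least[OF C(1) KC] subgroup_int_pow_closed[OF C(1) b(1)] by blast
    have "?K \<inter> ?T \<subseteq> K"
    proof
      fix x assume x: "x \<in> ?K \<inter> ?T"
      then obtain k i where ki: "k \<in> K" "x = k \<otimes> b [^] (i::int)" unfolding set_mult_def by blast
      have kc: "k \<in> carrier G" using ki Kc by auto
      have "p dvd i"
      proof (rule ccontr)
        assume "\<not> p dvd i"
        then have "coprime i p" using prime_imp_coprime[OF factor.hyps(1)] coprime_commute by blast
        then have g: "gcd i p = 1" by simp
        have "b [^] i = inv k \<otimes> x"
          unfolding ki(2) by (rule abelian_normal_form2[of b k]) (use bc kc in simp_all)
        moreover have "x \<in> C \<inter> ?T" using x K'C by blast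
        ultimately have 1: "b [^] i \<in> K <#> (C \<inter> ?T)"
          using subgroup.m_inv_closed[OF K(1) ki(1)] unfolding mem_set_mult by blast
        have "b [^] p \<in> K" using K(2) b(1) by blast
        then have 2: "b [^] p \<in> K <#> (C \<inter> ?T)" using subset_set_mult_left[OF K(1) CT] by blast
        have "b [^] (gcd i p) \<in> K <#> (C \<inter> ?T)" using pow_gcd_mem[OF sKT bc 1 2] .
        then show False using b(2) bc g by simp
      qed
      moreover have "b [^] p \<in> K" using K(2) b(1) by blast
      ultimately have "b [^] i \<in> K" using pow_dvd_mem[OF K(1) bc] by blast
      then show "x \<in> K" unfolding ki(2) using subgroup.m_closed[OF K(1) ki(1)] by blast
    qed
    then have "?K \<inter> W = {}" using K'C KT unfolding W_def by blast
    then have "?K = K" using max K'(1,2) by blast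
    then have "b \<in> K" using K'(3) by blast
    then show False using b(2) subset_set_mult_left[OF K(1) CT] by blast
  qed
  have "B \<subseteq> K <#> (B \<inter> ?T)"
  proof
    fix b assume "b \<in> B"
    then obtain c t where ct: "c \<in> C" "t \<in> B \<inter> ?T" "b = c \<otimes> t" using C(3) unfolding set_mult_def by blast
    obtain k s where ks: "k \<in> K" "s \<in> C \<inter> ?T" "c = k \<otimes> s" using Csub ct(1) unfolding set_mult_def by blast
    have cc: "k \<in> carrier G" "s \<in> carrier G" "t \<in> carrier G" using ks(1,2) ct(2) Kc Cc Bc by auto
    have "b = k \<otimes> (s \<otimes> t)" unfolding ct(3) ks(3) using cc by (simp add: m_assoc)
    moreover have "s \<otimes> t \<in> B \<inter> ?T" using subgroup.m_closed[OF BT _ ct(2)] ks(2) C(2) by blast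
    ultimately show "b \<in> K <#> (B \<inter> ?T)" using ks(1) unfolding mem_set_mult by blast
  qed
  moreover have "K \<inter> ?T \<subseteq> (\<lambda>x. x [^] (p * m)) ` (B \<inter> ?T)"
  proof
    fix x assume "x \<in> K \<inter> ?T"
    then obtain c where c: "c \<in> C \<inter> ?T" "x = c [^] p" using KT by blast
    then obtain b where b: "b \<in> B \<inter> ?T" "c = b [^] m" using C(4) by blast
    have "x = b [^] (p * m)" unfolding c(2) b(2) using b(1) Bc by (simp add: int_pow_pow subsetD mult.commute)
    then show "x \<in> (\<lambda>x. x [^] (p * m)) ` (B \<inter> ?T)" using b(1) by blast
  qed
  ultimately show ?case using K(1) KC C(2) by blast
qed auto

lemma fg_mod_torsion:
  assumes "finitely_generated (G Mod torsion_part G)"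
  shows "\<exists>S. finite S \<and> S \<subseteq> carrier G \<and> carrier G \<subseteq> generate G S <#> torsion_part G"
proof -
  let ?T = "torsion_part G"
  interpret N: normal ?T G using subgroup_imp_normal[OF torsion_subgroup] .
  obtain S' where S': "finite S'" "S' \<subseteq> carrier (G Mod ?T)" "generate (G Mod ?T) S' = carrier (G Mod ?T)"
    using assms unfolding finitely_generated_def by blast
  have rep: "\<exists>a. a \<in> carrier G \<and> C = ?T #> a" if "C \<in> S'" for C
    using that S'(2) unfolding FactGroup_def RCOSETS_def by auto
  define f where "f C = (SOME a. a \<in> carrier G \<and> C = ?T #> a)" for C
  have f: "f C \<in> carrier G" "C = ?T #> f C" if "C \<in> S'" for C
    using someI_ex[OF rep[OF that]] unfolding f_def by auto
  define S where "S = f ` S'"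
  have S: "finite S" "S \<subseteq> carrier G" using S' f unfolding S_def by auto
  have gS: "subgroup (generate G S) G" using generate_is_subgroup[OF S(2)] .
  have gc: "g \<in> carrier G" if "g \<in> generate G S" for g using generate_in_carrier[OF S(2) that] .
  have key: "\<exists>g\<in>generate G S. C = ?T #> g" if "C \<in> generate (G Mod ?T) S'" for C
    using that
  proof (induction C rule: generate.induct)
    case one
    have "\<one>\<^bsub>G Mod ?T\<^esub> = ?T #> \<one>" using coset_mult_one N.subset unfolding FactGroup_def by simp
    then show ?case using generate.one by blast
  next
    case (incl C)
    then show ?case using f[OF incl] generate.incl[of "f C" S G] unfolding S_def by blast
  next
    case (inv C)
    have "C \<in> carrier (G Mod ?T)" using inv S'(2) by blast
    then have "inv\<^bsub>G Mod ?T\<^esub> C = set_inv C" by (rule N.inv_FactGroup)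
    also have "\<dots> = ?T #> inv (f C)" using N.rcos_inv[OF f(1)[OF inv]] f(2)[OF inv] by simp
    finally show ?case using subgroup.m_inv_closed[OF gS] generate.incl[of "f C" S G] inv unfolding S_def by blast
  next
    case (eng C D)
    then obtain c d where cd: "c \<in> generate G S" "C = ?T #> c" "d \<in> generate G S" "D = ?T #> d" by blast
    have "C \<otimes>\<^bsub>G Mod ?T\<^esub> D = ?T #> (c \<otimes> d)"
      using N.rcos_sum[OF gc[OF cd(1)] gc[OF cd(3)]] cd by simp
    then show ?case using subgroup.m_closed[OF gS cd(1,3)] by blast
  qed
  have "a \<in> generate G S <#> ?T" if a: "a \<in> carrier G" for a
  proof -
    have "?T #> a \<in> carrier (G Mod ?T)" using a unfolding FactGroup_def RCOSETS_def by auto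
    then obtain g where g: "g \<in> generate G S" "?T #> a = ?T #> g" using key S'(3) by blast
    have "a \<in> ?T #> g" using rcos_self[OF a torsion_subgroup] g by simp
    then obtain t where "t \<in> ?T" "a = t \<otimes> g" unfolding r_coset_def by blast
    then have "a = g \<otimes> t" using gc[OF g(1)] N.subset m_comm by blast
    then show ?thesis using g(1) \<open>t \<in> ?T\<close> unfolding mem_set_mult by blast
  qed
  then show ?thesis using S by blast
qed

end

text \<open>
  The hypotheses on the group: finite torsion-free rank, and either a bounded torsion subgroup or a
  finitely generated quotient by the torsion subgroup.
\<close>

locale bounded_or_fg = comm_group A for A (structure) +
  assumes rank: "finite_torsion_free_rank A"
    and cases: "(\<exists>n::int. n \<noteq> 0 \<and> (\<forall>t\<in>torsion_part A. t [^] n = \<one>)) \<or>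
      (\<exists>S. finite S \<and> S \<subseteq> carrier A \<and> carrier A \<subseteq> generate A S <#> torsion_part A)"
begin

abbreviation T where "T \<equiv> torsion_part A"

lemma T_closed: "t \<in> T \<Longrightarrow> t \<in> carrier A"
  unfolding torsion_part_def by auto

text \<open>
  A periodic quotient \<open>H/M\<close> of \<open>H/T(H)\<close> is finite provided that it is annihilated by every exponent of \<open>T\<close>.
  If \<open>T\<close> is unbounded, this concerns \<open>n = 0\<close> only and is void.
\<close>

lemma finite_index_of_torsion_quotient:
  assumes H: "subgroup H A" and M: "subgroup M A" "M \<subseteq> H" "H \<inter> T \<subseteq> M"
    and tor: "\<And>h. h \<in> H \<Longrightarrow> \<exists>n::int. n \<noteq> 0 \<and> h [^] n \<in> M"
    and bnd: "\<And>n h. \<forall>t\<in>T. t [^] (n::int) = \<one> \<Longrightarrow> h \<in> H \<Longrightarrow> h [^] n \<in> M"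
  shows "finite_index H M"
  using cases
proof
  assume "\<exists>n::int. n \<noteq> 0 \<and> (\<forall>t\<in>T. t [^] n = \<one>)"
  then obtain n :: int where n: "n \<noteq> 0" "\<forall>t\<in>T. t [^] n = \<one>" by blast
  obtain S where S: "finite S" "S \<subseteq> carrier A" "\<forall>a\<in>carrier A. \<exists>n::int. n \<noteq> 0 \<and> a [^] n \<in> generate A S"
    using finite_rank_essential_subgroup[OF rank] by blast
  have "finite_index H ((H \<inter> T) <#> (\<lambda>h. h [^] n) ` H)"
    by (rule finite_index_torsion_powers[OF S(1,2) H _ n(1)]) (use S(3) subgroup.subset[OF H] in blast)
  moreover have "(H \<inter> T) <#> (\<lambda>h. h [^] n) ` H \<subseteq> M"
    by (rule set_mult_least[OF M(1) M(3)]) (use bnd[OF n(2)] in auto)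
  ultimately show ?thesis by (rule finite_index_mono)
next
  assume "\<exists>S. finite S \<and> S \<subseteq> carrier A \<and> carrier A \<subseteq> generate A S <#> T"
  then obtain S where S: "finite S" "S \<subseteq> carrier A" "carrier A \<subseteq> generate A S <#> T" by blast
  have Hc: "H \<subseteq> carrier A" using subgroup.subset[OF H] .
  obtain R where R: "finite R" "R \<subseteq> H" "\<forall>h\<in>H. \<exists>g\<in>generate A R. \<exists>l\<in>H \<inter> T. h = g \<otimes> l"
    using finitely_generated_mod_subgroup[OF S(1,2) torsion_subgroup H subset_trans[OF Hc S(3)]] by blast
  have Rc: "R \<subseteq> carrier A" using R Hc by blast
  obtain C where C: "finite C" "C \<subseteq> carrier A" "\<forall>g\<in>generate A R. \<exists>c\<in>C. g \<otimes> inv c \<in> M"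
    using finite_cover_generate_mod[OF R(1) Rc M(1)] tor R(2) by blast
  show ?thesis
  proof (rule finite_index_cover[OF M(1) Hc C(1,2)])
    fix h assume "h \<in> H"
    then obtain g l where gl: "g \<in> generate A R" "l \<in> H \<inter> T" "h = g \<otimes> l" using R(3) by blast
    obtain c where c: "c \<in> C" "g \<otimes> inv c \<in> M" using C(3) gl(1) by blast
    have cc: "g \<in> carrier A" "l \<in> carrier A" "c \<in> carrier A"
      using generate_in_carrier[OF Rc gl(1)] gl(2) Hc c C(2) by auto
    have "h \<otimes> inv c = (g \<otimes> inv c) \<otimes> l"
      unfolding gl(3) by (rule abelian_normal_form3[of g l c]) (use cc in simp_all)
    moreover have "(g \<otimes> inv c) \<otimes> l \<in> M" using subgroup.m_closed[OF M(1) c(2)] gl(2) M(3) by blast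
    ultimately have "h \<otimes> inv c \<in> M" by (simp only:)
    then show "\<exists>r\<in>C. h \<otimes> inv r \<in> M" using c(1) by blast
  qed
qed

lemma torsion_complement:
  obtains K where "subgroup K A" "K \<inter> T = {\<one>}" "carrier A \<subseteq> K <#> T"
proof -
  have one: "\<one> \<in> K \<inter> T" if "subgroup K A" for K
    using subgroup.one_closed[OF that] subgroup.one_closed[OF torsion_subgroup] by blast
  show thesis
    using cases
  proof
    assume "\<exists>n::int. n \<noteq> 0 \<and> (\<forall>t\<in>T. t [^] n = \<one>)"
    then obtain n :: int where n: "n \<noteq> 0" "\<forall>t\<in>T. t [^] n = \<one>" by blast
    obtain K where K: "subgroup K A" "carrier A \<subseteq> K <#> (carrier A \<inter> T)" "K \<inter> T \<subseteq> (\<lambda>x. x [^] n) ` (carrier A \<inter> T)"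
      using split_mod_powers[OF n(1) subgroup_self] by blast
    have "carrier A \<inter> T = T" using T_closed by blast
    then have "carrier A \<subseteq> K <#> T" using K(2) by simp
    moreover have "K \<inter> T \<subseteq> {\<one>}" using K(3) n(2) by auto
    ultimately show thesis using that[OF K(1)] one[OF K(1)] by blast
  next
    assume "\<exists>S. finite S \<and> S \<subseteq> carrier A \<and> carrier A \<subseteq> generate A S <#> T"
    then obtain S where S: "finite S" "S \<subseteq> carrier A" "carrier A \<subseteq> generate A S <#> T" by blast
    \<comment> \<open>\<open>B\<close> has a finite torsion subgroup, so this is a direct summand; its complement in \<open>B\<close> is one of
      \<open>T\<close> in \<open>A\<close>.\<close>
    define B where "B = generate A S"
    have B: "subgroup B A" unfolding B_def using generate_is_subgroup[OF S(2)] .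
    have BT: "subgroup (B \<inter> T) A" using subgroups_Inter_pair[OF B torsion_subgroup] .
    have "B \<inter> T \<subseteq> generate A S <#> {\<one>}"
      using subset_set_mult_left[OF B triv_subgroup] unfolding B_def by blast
    from finitely_generated_mod_subgroup[OF S(1,2) triv_subgroup BT this]
    obtain R where R: "finite R" "R \<subseteq> B \<inter> T" "\<forall>h\<in>B \<inter> T. \<exists>g\<in>generate A R. \<exists>l\<in>B \<inter> T \<inter> {\<one>}. h = g \<otimes> l"
      by blast
    obtain W where W: "subgroup W A" "finite W" "R \<subseteq> W" "W \<subseteq> B \<inter> T"
      using finite_subgroup_cover[OF R(1) _ BT R(2)] R(2) by blast
    have "B \<inter> T \<subseteq> W"
    proof
      fix h assume "h \<in> B \<inter> T"
      then obtain g where g: "g \<in> generate A R" "h = g \<otimes> \<one>" using R(3) by blast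
      have "g \<in> W" using generate_subgroup_incl[OF W(3,1)] g(1) by blast
      then show "h \<in> W" using g(2) subgroup.mem_carrier[OF W(1)] by simp
    qed
    then have "B \<inter> T = W" using W(4) by blast
    then obtain n :: int where n: "n \<noteq> 0" "\<forall>w\<in>B \<inter> T. w [^] n = \<one>"
      using finite_exponent[OF W(2)] W(4) by blast
    obtain K where K: "subgroup K A" "B \<subseteq> K <#> (B \<inter> T)" "K \<inter> T \<subseteq> (\<lambda>x. x [^] n) ` (B \<inter> T)"
      using split_mod_powers[OF n(1) B] by blast
    have "carrier A \<subseteq> K <#> T"
    proof
      fix a assume "a \<in> carrier A"
      then obtain b t where bt: "b \<in> B" "t \<in> T" "a = b \<otimes> t" using S(3) unfolding B_def set_mult_def by blast
      obtain k s where ks: "k \<in> K" "s \<in> B \<inter> T" "b = k \<otimes> s" using K(2) bt(1) unfolding set_mult_def by blast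
      have "a = k \<otimes> (s \<otimes> t)" unfolding bt(3) ks(3)
        using ks(1,2) bt(2) T_closed subgroup.mem_carrier[OF K(1)] by (simp add: m_assoc)
      moreover have "s \<otimes> t \<in> T" using subgroup.m_closed[OF torsion_subgroup] ks(2) bt(2) by blast
      ultimately show "a \<in> K <#> T" using ks(1) unfolding mem_set_mult by blast
    qed
    moreover have "K \<inter> T \<subseteq> {\<one>}" using K(3) n(2) by auto
    ultimately show thesis using that[OF K(1)] one[OF K(1)] by blast
  qed
qed

lemma torsion_valued_hom_finite_range:
  assumes f: "f \<in> hom A A" "\<And>t. t \<in> T \<Longrightarrow> f t = \<one>" "\<And>a. a \<in> carrier A \<Longrightarrow> f a \<in> T"
  shows "finite (f ` carrier A)"
proof -
  interpret f: group_hom A A f by unfold_locales (use f(1) in auto)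
  define M where "M = {a \<in> carrier A. f a = \<one>}"
  have M: "subgroup M A" unfolding M_def using f.subgroup_kernel unfolding kernel_def .
  have "finite_index (carrier A) M"
  proof (rule finite_index_of_torsion_quotient[OF subgroup_self M])
    show "M \<subseteq> carrier A" "carrier A \<inter> T \<subseteq> M" unfolding M_def using f(2) by auto
    show "\<exists>n::int. n \<noteq> 0 \<and> h [^] n \<in> M" if h: "h \<in> carrier A" for h
    proof -
      obtain n :: int where "n \<noteq> 0" "f h [^] n = \<one>" using f(3)[OF h] unfolding torsion_part_int by auto
      then show ?thesis using h f.hom_int_pow[OF h, of n] unfolding M_def by (intro exI[of _ n]) simp
    qed
    show "h [^] n \<in> M" if "\<forall>t\<in>T. t [^] (n::int) = \<one>" "h \<in> carrier A" for n h
      using that f(3) f.hom_int_pow[OF that(2), of n] unfolding M_def by simp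
  qed
  then obtain R where R: "finite R" "R \<subseteq> carrier A" "\<forall>a\<in>carrier A. \<exists>r\<in>R. a \<otimes> inv r \<in> M"
    unfolding finite_index_def by blast
  have "f ` carrier A \<subseteq> f ` R"
  proof clarify
    fix a assume a: "a \<in> carrier A"
    then obtain r where r: "r \<in> R" "a \<otimes> inv r \<in> M" using R(3) by blast
    have rc: "r \<in> carrier A" using r R by blast
    have "f a \<otimes> inv (f r) = \<one>" using r(2) a rc unfolding M_def by simp
    then have "f a = f r" using a rc by (metis f.hom_closed inv_equality inv_closed inv_inv)
    then show "f a \<in> f ` R" using r(1) by blast
  qed
  then show ?thesis using R(1) by (meson finite_imageI finite_subset)
qed

text \<open>
  Homomorphisms \<open>A/T \<rightarrow> T\<close> are determined by their values on a finite set.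
\<close>

lemma finite_detecting_set:
  obtains X0 where "finite X0" "X0 \<subseteq> carrier A"
    "\<And>f. f \<in> hom A A \<Longrightarrow> \<forall>t\<in>T. f t = \<one> \<Longrightarrow> \<forall>a\<in>carrier A. f a \<in> T \<Longrightarrow>
      \<forall>x\<in>X0. f x = \<one> \<Longrightarrow> \<forall>a\<in>carrier A. f a = \<one>"
  using cases
proof
  assume "\<exists>n::int. n \<noteq> 0 \<and> (\<forall>t\<in>T. t [^] n = \<one>)"
  then obtain n :: int where n: "n \<noteq> 0" "\<forall>t\<in>T. t [^] n = \<one>" by blast
  obtain S where S: "finite S" "S \<subseteq> carrier A" "\<forall>a\<in>carrier A. \<exists>n::int. n \<noteq> 0 \<and> a [^] n \<in> generate A S"
    using finite_rank_essential_subgroup[OF rank] by blast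
  have "finite_index (carrier A) ((carrier A \<inter> T) <#> (\<lambda>h. h [^] n) ` carrier A)"
    by (rule finite_index_torsion_powers[OF S(1,2) subgroup_self _ n(1)]) (use S(3) in blast)
  then obtain R where R: "finite R" "R \<subseteq> carrier A"
    "\<forall>a\<in>carrier A. \<exists>r\<in>R. a \<otimes> inv r \<in> (carrier A \<inter> T) <#> (\<lambda>h. h [^] n) ` carrier A"
    unfolding finite_index_def by blast
  show thesis
  proof (rule that[OF R(1,2)])
    fix f assume f: "f \<in> hom A A" "\<forall>t\<in>T. f t = \<one>" "\<forall>a\<in>carrier A. f a \<in> T" "\<forall>x\<in>R. f x = \<one>"
    interpret f: group_hom A A f by unfold_locales (use f(1) in auto)
    show "\<forall>a\<in>carrier A. f a = \<one>"
    proof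
      fix a assume a: "a \<in> carrier A"
      obtain r where r: "r \<in> R" "a \<otimes> inv r \<in> (carrier A \<inter> T) <#> (\<lambda>h. h [^] n) ` carrier A" using R(3) a by blast
      then obtain t b where tb: "t \<in> T" "b \<in> carrier A" "a \<otimes> inv r = t \<otimes> b [^] n" unfolding set_mult_def by blast
      have c: "r \<in> carrier A" "t \<in> carrier A" using r R(2) T_closed[OF tb(1)] by auto
      have "f a = f (a \<otimes> inv r) \<otimes> f r" using a c by (simp add: m_assoc)
      also have "f (a \<otimes> inv r) = f t \<otimes> f b [^] n" unfolding tb(3) using c tb(2) by (simp add: f.hom_int_pow)
      finally show "f a = \<one>" using bspec[OF f(2) tb(1)] bspec[OF n(2) bspec[OF f(3) tb(2)]] bspec[OF f(4) r(1)] by simp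
    qed
  qed
next
  assume "\<exists>S. finite S \<and> S \<subseteq> carrier A \<and> carrier A \<subseteq> generate A S <#> T"
  then obtain S where S: "finite S" "S \<subseteq> carrier A" "carrier A \<subseteq> generate A S <#> T" by blast
  show thesis
  proof (rule that[OF S(1,2)])
    fix f assume f: "f \<in> hom A A" "\<forall>t\<in>T. f t = \<one>" "\<forall>x\<in>S. f x = \<one>"
    interpret f: group_hom A A f by unfold_locales (use f(1) in auto)
    have ker: "subgroup {a \<in> carrier A. f a = \<one>} A" using f.subgroup_kernel unfolding kernel_def .
    have gen: "generate A S \<subseteq> {a \<in> carrier A. f a = \<one>}"
      by (rule generate_subgroup_incl[OF _ ker]) (use f(3) S(2) in auto)
    show "\<forall>a\<in>carrier A. f a = \<one>"
    proof
      fix a assume a: "a \<in> carrier A"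
      obtain g t where gt: "g \<in> generate A S" "t \<in> T" "a = g \<otimes> t" using S(3) a unfolding set_mult_def by blast
      have "g \<in> carrier A" "f g = \<one>" using gen gt(1) by auto
      then show "f a = \<one>" unfolding gt(3) using bspec[OF f(2) gt(2)] T_closed[OF gt(2)] by simp
    qed
  qed
qed

end

section \<open>Groups of automorphisms\<close>

lemma auto_closed: "\<gamma> \<in> auto A \<Longrightarrow> a \<in> carrier A \<Longrightarrow> \<gamma> a \<in> carrier A"
  by (auto simp: auto_def hom_def)

lemma auto_hom: "\<gamma> \<in> auto A \<Longrightarrow> \<gamma> \<in> hom A A"
  by (auto simp: auto_def)

lemma auto_bij: "\<gamma> \<in> auto A \<Longrightarrow> bij_betw \<gamma> (carrier A) (carrier A)"
  by (auto simp: auto_def Bij_def)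

lemma auto_ext:
  assumes "\<gamma> \<in> auto A" "\<delta> \<in> auto A" "\<And>a. a \<in> carrier A \<Longrightarrow> \<gamma> a = \<delta> a"
  shows "\<gamma> = \<delta>"
  using assms by (auto simp: auto_def Bij_def intro: extensionalityI)

lemma autoI:
  assumes "\<gamma> \<in> hom A A" "\<gamma> \<in> extensional (carrier A)" "bij_betw \<gamma> (carrier A) (carrier A)"
  shows "\<gamma> \<in> auto A"
  using assms by (auto simp: auto_def Bij_def)

lemma AutoGroup_simps:
  "carrier (AutoGroup A) = auto A"
  "\<one>\<^bsub>AutoGroup A\<^esub> = (\<lambda>x\<in>carrier A. x)"
  "\<gamma> \<in> auto A \<Longrightarrow> \<delta> \<in> auto A \<Longrightarrow> \<gamma> \<otimes>\<^bsub>AutoGroup A\<^esub> \<delta> = compose (carrier A) \<gamma> \<delta>"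
  by (auto simp: AutoGroup_def BijGroup_def auto_def)

lemma AutoGroup_mult_apply:
  "\<gamma> \<in> auto A \<Longrightarrow> \<delta> \<in> auto A \<Longrightarrow> a \<in> carrier A \<Longrightarrow> (\<gamma> \<otimes>\<^bsub>AutoGroup A\<^esub> \<delta>) a = \<gamma> (\<delta> a)"
  by (simp add: AutoGroup_simps compose_eq)

lemma (in group) AutoGroup_inv:
  assumes "\<gamma> \<in> auto G"
  shows "inv\<^bsub>AutoGroup G\<^esub> \<gamma> \<in> auto G"
    and "\<And>a. a \<in> carrier G \<Longrightarrow> \<gamma> ((inv\<^bsub>AutoGroup G\<^esub> \<gamma>) a) = a"
    and "\<And>a. a \<in> carrier G \<Longrightarrow> (inv\<^bsub>AutoGroup G\<^esub> \<gamma>) (\<gamma> a) = a"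
proof -
  interpret Aut: group "AutoGroup G" by (rule AutoGroup)
  show 1: "inv\<^bsub>AutoGroup G\<^esub> \<gamma> \<in> auto G" using Aut.inv_closed assms by (simp add: AutoGroup_simps)
  have g: "\<gamma> \<in> carrier (AutoGroup G)" using assms by (simp add: AutoGroup_simps)
  show "\<gamma> ((inv\<^bsub>AutoGroup G\<^esub> \<gamma>) a) = a" if "a \<in> carrier G" for a
    using AutoGroup_mult_apply[OF assms 1 that] Aut.r_inv[OF g] that by (simp add: AutoGroup_simps(2))
  show "(inv\<^bsub>AutoGroup G\<^esub> \<gamma>) (\<gamma> a) = a" if "a \<in> carrier G" for a
    using AutoGroup_mult_apply[OF 1 assms that] Aut.l_inv[OF g] that by (simp add: AutoGroup_simps(2))
qed

lemma (in comm_group) inertial_compose: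
  assumes "inertial G \<gamma>" "inertial G \<delta>"
  shows "inertial G (\<gamma> \<otimes>\<^bsub>AutoGroup G\<^esub> \<delta>)"
proof -
  have ax: "comm_group G" by unfold_locales
  interpret Aut: group "AutoGroup G" by (rule AutoGroup)
  have a: "\<gamma> \<in> auto G" "\<delta> \<in> auto G" using assms unfolding inertial_iff[OF ax] by auto
  have "almost_preserves G (\<gamma> \<otimes>\<^bsub>AutoGroup G\<^esub> \<delta>) H" if H: "subgroup H G" for H
  proof -
    have Hc: "H \<subseteq> carrier G" using subgroup.subset[OF H] .
    obtain F where F: "finite F" "F \<subseteq> carrier G" "\<forall>h\<in>H. \<exists>h'\<in>H. \<exists>f\<in>F. \<gamma> h = h' \<otimes> f"
      using assms(1) H unfolding inertial_iff[OF ax] almost_preserves_def by blast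
    obtain F' where F': "finite F'" "F' \<subseteq> carrier G" "\<forall>h\<in>H. \<exists>h'\<in>H. \<exists>f\<in>F'. \<delta> h = h' \<otimes> f"
      using assms(2) H unfolding inertial_iff[OF ax] almost_preserves_def by blast
    have gF': "\<gamma> ` F' \<subseteq> carrier G" using F'(2) auto_closed[OF a(1)] by blast
    show ?thesis unfolding almost_preserves_def
    proof (intro exI[of _ "F <#> \<gamma> ` F'"] conjI ballI)
      show "finite (F <#> \<gamma> ` F')" using finite_set_mult F F' by blast
      show "F <#> \<gamma> ` F' \<subseteq> carrier G" using setmult_subset_G[OF F(2) gF'] .
      fix h assume h: "h \<in> H"
      obtain h' f' where h': "h' \<in> H" "f' \<in> F'" "\<delta> h = h' \<otimes> f'" using F'(3) h by blast
      obtain h'' f where h'': "h'' \<in> H" "f \<in> F" "\<gamma> h' = h'' \<otimes> f" using F(3) h'(1) by blast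
      have c: "h \<in> carrier G" "h' \<in> carrier G" "f' \<in> carrier G" "h'' \<in> carrier G" "f \<in> carrier G" "\<gamma> f' \<in> carrier G"
        using h h'(1,2) h''(1,2) Hc F(2) F'(2) gF' by blast+
      have "(\<gamma> \<otimes>\<^bsub>AutoGroup G\<^esub> \<delta>) h = \<gamma> (h' \<otimes> f')" using AutoGroup_mult_apply[OF a c(1)] h'(3) by simp
      also have "\<dots> = \<gamma> h' \<otimes> \<gamma> f'" using hom_mult[OF auto_hom[OF a(1)]] c by blast
      also have "\<dots> = h'' \<otimes> (f \<otimes> \<gamma> f')" unfolding h''(3) using c by (simp add: m_assoc)
      finally have "(\<gamma> \<otimes>\<^bsub>AutoGroup G\<^esub> \<delta>) h = h'' \<otimes> (f \<otimes> \<gamma> f')" .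
      moreover have "f \<otimes> \<gamma> f' \<in> F <#> \<gamma> ` F'" using h'(2) h''(2) unfolding mem_set_mult by blast
      ultimately show "\<exists>h'\<in>H. \<exists>f\<in>F <#> \<gamma> ` F'. (\<gamma> \<otimes>\<^bsub>AutoGroup G\<^esub> \<delta>) h = h' \<otimes> f" using h''(1) by blast
    qed
  qed
  moreover have "\<gamma> \<otimes>\<^bsub>AutoGroup G\<^esub> \<delta> \<in> auto G" using Aut.m_closed a by (simp add: AutoGroup_simps(1))
  ultimately show ?thesis unfolding inertial_iff[OF ax] by blast
qed

lemma (in comm_group) inertial_id: "inertial G \<one>\<^bsub>AutoGroup G\<^esub>"
proof -
  have ax: "comm_group G" by unfold_locales
  have "almost_preserves G (\<lambda>x\<in>carrier G. x) H" if H: "subgroup H G" for H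
    unfolding almost_preserves_def
    using subgroup.mem_carrier[OF H] by (intro exI[of _ "{\<one>}"]) (auto intro: bexI)
  then show ?thesis unfolding inertial_iff[OF ax] AutoGroup_simps using id_in_auto by blast
qed

text \<open>
  For infinite subgroups this is not plain from the definition, and it fails for abelian groups in
  general. Local almost stability, applied with the identity as single coordinate, yields \<open>H \<subseteq> H\<gamma> + \<Phi>\<close>.
\<close>

lemma (in comm_group) inertial_inverse_torsion:
  assumes tor: "carrier G = torsion_part G" and "inertial G \<gamma>"
  shows "inertial G (inv\<^bsub>AutoGroup G\<^esub> \<gamma>)"
proof -
  have ax: "comm_group G" by unfold_locales
  have a: "\<gamma> \<in> auto G" and ap: "\<And>H. subgroup H G \<Longrightarrow> almost_preserves G \<gamma> H"
    using assms(2) unfolding inertial_iff[OF ax] by auto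
  note inv = AutoGroup_inv[OF a]
  interpret E: equivariant_embedding G G \<gamma> \<gamma> "{()}" "\<lambda>_ x. x"
    by unfold_locales (use tor auto_hom[OF a] ap in \<open>auto simp: hom_def\<close>)
  have "almost_preserves G (inv\<^bsub>AutoGroup G\<^esub> \<gamma>) H" if H: "subgroup H G" for H
  proof -
    have Hc: "H \<subseteq> carrier G" using subgroup.subset[OF H] .
    have "inj_on \<gamma> (carrier G)" using auto_bij[OF a] by (simp add: bij_betw_def)
    from locally_almost_stable_covers[OF auto_hom[OF a] this H E.all_stable[OF H]]
    obtain F where F: "finite F" "F \<subseteq> carrier G" "\<forall>x\<in>H. \<exists>y\<in>H. \<exists>f\<in>F. x = \<gamma> y \<otimes> f" by blast
    show ?thesis unfolding almost_preserves_def
    proof (intro exI[of _ "(inv\<^bsub>AutoGroup G\<^esub> \<gamma>) ` F"] conjI ballI)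
      show "finite ((inv\<^bsub>AutoGroup G\<^esub> \<gamma>) ` F)" using F by blast
      show "(inv\<^bsub>AutoGroup G\<^esub> \<gamma>) ` F \<subseteq> carrier G" using F(2) auto_closed[OF inv(1)] by blast
      fix x assume "x \<in> H"
      then obtain y f where yf: "y \<in> H" "f \<in> F" "x = \<gamma> y \<otimes> f" using F(3) by blast
      have c: "y \<in> carrier G" "f \<in> carrier G" using yf(1,2) Hc F(2) by auto
      have "(inv\<^bsub>AutoGroup G\<^esub> \<gamma>) x = y \<otimes> (inv\<^bsub>AutoGroup G\<^esub> \<gamma>) f"
        unfolding yf(3) using hom_mult[OF auto_hom[OF inv(1)] auto_closed[OF a c(1)] c(2)] inv(3)[OF c(1)] by simp
      then show "\<exists>h'\<in>H. \<exists>f\<in>(inv\<^bsub>AutoGroup G\<^esub> \<gamma>) ` F. (inv\<^bsub>AutoGroup G\<^esub> \<gamma>) x = h' \<otimes> f" using yf(1,2) by blast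
    qed
  qed
  then show ?thesis unfolding inertial_iff[OF ax] using inv(1) by blast
qed

lemma carrier_IAut:
  assumes "inertial A \<gamma>" shows "\<gamma> \<in> carrier (IAut A)"
  using assms unfolding IAut_def carrier_subgroup_generated
  by (intro generate.incl) (simp add: AutoGroup_simps inertial_def)

lemma (in comm_group) carrier_IAut_torsion:
  assumes "carrier G = torsion_part G"
  shows "carrier (IAut G) = {\<gamma>. inertial G \<gamma>}"
proof
  interpret Aut: group "AutoGroup G" by (rule AutoGroup)
  have "subgroup {\<gamma>. inertial G \<gamma>} (AutoGroup G)"
    by (rule Aut.subgroupI)
      (use inertial_compose inertial_id inertial_inverse_torsion[OF assms] in \<open>auto simp: AutoGroup_simps(1) inertial_def\<close>)
  then show "carrier (IAut G) \<subseteq> {\<gamma>. inertial G \<gamma>}"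
    unfolding IAut_def carrier_subgroup_generated
    by (intro Aut.generate_subgroup_incl) auto
  show "{\<gamma>. inertial G \<gamma>} \<subseteq> carrier (IAut G)" using carrier_IAut by blast
qed

lemma conj_on_auto:
  assumes "N \<lhd> G" "g \<in> carrier G"
  shows "conj_on G N g \<in> auto (G\<lparr>carrier := N\<rparr>)"
proof -
  interpret N: normal N G by fact
  have c: "g \<otimes>\<^bsub>G\<^esub> x \<otimes>\<^bsub>G\<^esub> inv\<^bsub>G\<^esub> g \<in> N" "inv\<^bsub>G\<^esub> g \<otimes>\<^bsub>G\<^esub> x \<otimes>\<^bsub>G\<^esub> g \<in> N" if "x \<in> N" for x
    using N.inv_op_closed1 N.inv_op_closed2 assms(2) that by auto
  have Nc: "x \<in> carrier G" if "x \<in> N" for x using that N.mem_carrier by auto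
  have cancel: "inv\<^bsub>G\<^esub> g \<otimes>\<^bsub>G\<^esub> (g \<otimes>\<^bsub>G\<^esub> z) = z" "g \<otimes>\<^bsub>G\<^esub> (inv\<^bsub>G\<^esub> g \<otimes>\<^bsub>G\<^esub> z) = z" if "z \<in> carrier G" for z
    using that assms(2) by (simp_all flip: N.m_assoc)
  show ?thesis
  proof (rule autoI)
    show "conj_on G N g \<in> extensional (carrier (G\<lparr>carrier := N\<rparr>))" unfolding conj_on_def by simp
    show "conj_on G N g \<in> hom (G\<lparr>carrier := N\<rparr>) (G\<lparr>carrier := N\<rparr>)"
    proof (rule homI)
      show "conj_on G N g x \<in> carrier (G\<lparr>carrier := N\<rparr>)" if "x \<in> carrier (G\<lparr>carrier := N\<rparr>)" for x
        using that c unfolding conj_on_def by simp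
      fix x y assume xy: "x \<in> carrier (G\<lparr>carrier := N\<rparr>)" "y \<in> carrier (G\<lparr>carrier := N\<rparr>)"
      then have xN: "x \<in> N" "y \<in> N" by auto
      have "g \<otimes>\<^bsub>G\<^esub> (x \<otimes>\<^bsub>G\<^esub> y) \<otimes>\<^bsub>G\<^esub> inv\<^bsub>G\<^esub> g = g \<otimes>\<^bsub>G\<^esub> x \<otimes>\<^bsub>G\<^esub> inv\<^bsub>G\<^esub> g \<otimes>\<^bsub>G\<^esub> (g \<otimes>\<^bsub>G\<^esub> y \<otimes>\<^bsub>G\<^esub> inv\<^bsub>G\<^esub> g)"
        using Nc[OF xN(1)] Nc[OF xN(2)] assms(2) by (simp add: N.m_assoc cancel)
      then show "conj_on G N g (x \<otimes>\<^bsub>G\<lparr>carrier := N\<rparr>\<^esub> y) =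
          conj_on G N g x \<otimes>\<^bsub>G\<lparr>carrier := N\<rparr>\<^esub> conj_on G N g y"
        using xN N.m_closed unfolding conj_on_def by simp
    qed
    show "bij_betw (conj_on G N g) (carrier (G\<lparr>carrier := N\<rparr>)) (carrier (G\<lparr>carrier := N\<rparr>))"
    proof (rule bij_betw_byWitness[where f' = "\<lambda>x. inv\<^bsub>G\<^esub> g \<otimes>\<^bsub>G\<^esub> x \<otimes>\<^bsub>G\<^esub> g"])
      have 1: "inv\<^bsub>G\<^esub> g \<otimes>\<^bsub>G\<^esub> (g \<otimes>\<^bsub>G\<^esub> x \<otimes>\<^bsub>G\<^esub> inv\<^bsub>G\<^esub> g) \<otimes>\<^bsub>G\<^esub> g = x" if "x \<in> N" for x
        using Nc[OF that] assms(2) by (simp add: N.m_assoc cancel)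
      have 2: "g \<otimes>\<^bsub>G\<^esub> (inv\<^bsub>G\<^esub> g \<otimes>\<^bsub>G\<^esub> x \<otimes>\<^bsub>G\<^esub> g) \<otimes>\<^bsub>G\<^esub> inv\<^bsub>G\<^esub> g = x" if "x \<in> N" for x
        using Nc[OF that] assms(2) by (simp add: N.m_assoc cancel)
      show "\<forall>a\<in>carrier (G\<lparr>carrier := N\<rparr>). inv\<^bsub>G\<^esub> g \<otimes>\<^bsub>G\<^esub> conj_on G N g a \<otimes>\<^bsub>G\<^esub> g = a"
        using 1 unfolding conj_on_def by simp
      show "\<forall>a'\<in>carrier (G\<lparr>carrier := N\<rparr>). conj_on G N g (inv\<^bsub>G\<^esub> g \<otimes>\<^bsub>G\<^esub> a' \<otimes>\<^bsub>G\<^esub> g) = a'"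
        using 2 c(2) unfolding conj_on_def by simp
    qed (use c in \<open>auto simp: conj_on_def\<close>)
  qed
qed

lemma mem_r_coset: "y \<in> H #>\<^bsub>G\<^esub> a \<longleftrightarrow> (\<exists>h\<in>H. y = h \<otimes>\<^bsub>G\<^esub> a)"
  by (auto simp: r_coset_def)

lemma (in comm_group) auto_trivial_mod_iff:
  assumes \<gamma>: "\<gamma> \<in> auto G" and T: "subgroup T G" "\<And>t. t \<in> T \<Longrightarrow> \<gamma> t \<in> T"
  shows "(\<forall>C\<in>carrier (G Mod T). \<gamma> ` C = C) \<longleftrightarrow> (\<forall>a\<in>carrier G. \<gamma> a \<otimes> inv a \<in> T)"
proof
  have Tc: "t \<in> carrier G" if "t \<in> T" for t using subgroup.mem_carrier[OF T(1) that] .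
  note gc = auto_closed[OF \<gamma>]
  show "\<forall>a\<in>carrier G. \<gamma> a \<otimes> inv a \<in> T" if L: "\<forall>C\<in>carrier (G Mod T). \<gamma> ` C = C"
  proof
    fix a assume a: "a \<in> carrier G"
    have "T #> a \<in> carrier (G Mod T)" using a unfolding FactGroup_def RCOSETS_def by auto
    then have eq: "\<gamma> ` (T #> a) = T #> a" using L by blast
    have "\<gamma> a \<in> T #> a" using imageI[OF rcos_self[OF a T(1)], of \<gamma>] unfolding eq .
    then obtain t where t: "t \<in> T" "\<gamma> a = t \<otimes> a" unfolding mem_r_coset by blast
    then have "\<gamma> a \<otimes> inv a = t" using Tc[OF t(1)] a by (simp add: m_assoc)
    then show "\<gamma> a \<otimes> inv a \<in> T" using t(1) by simp
  qed
  show "\<forall>C\<in>carrier (G Mod T). \<gamma> ` C = C" if R: "\<forall>a\<in>carrier G. \<gamma> a \<otimes> inv a \<in> T"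
  proof
    fix C assume "C \<in> carrier (G Mod T)"
    then obtain a where a: "a \<in> carrier G" "C = T #> a" unfolding FactGroup_def RCOSETS_def by auto
    have memC: "y \<in> C \<longleftrightarrow> y \<in> carrier G \<and> y \<otimes> inv a \<in> T" for y
    proof
      assume "y \<in> C"
      then obtain t where t: "t \<in> T" "y = t \<otimes> a" unfolding a(2) mem_r_coset by blast
      then show "y \<in> carrier G \<and> y \<otimes> inv a \<in> T" using Tc[OF t(1)] a(1) by (simp add: m_assoc)
    next
      assume y: "y \<in> carrier G \<and> y \<otimes> inv a \<in> T"
      have "y = (y \<otimes> inv a) \<otimes> a" by (rule abelian_normal_form2[of y a]) (use y a in simp_all)
      then show "y \<in> C" unfolding a(2) mem_r_coset using y by blast
    qed
    show "\<gamma> ` C = C"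
    proof
      show "\<gamma> ` C \<subseteq> C"
      proof clarify
        fix y assume "y \<in> C"
        then have y: "y \<in> carrier G" "y \<otimes> inv a \<in> T" using memC by auto
        then show "\<gamma> y \<in> C"
          using memC gc diff_trans[OF T(1) gc[OF y(1)] y(1) a(1)] R by blast
      qed
      show "C \<subseteq> \<gamma> ` C"
      proof
        fix y assume "y \<in> C"
        then have y: "y \<in> carrier G" "y \<otimes> inv a \<in> T" using memC by auto
        obtain z where z: "z \<in> carrier G" "y = \<gamma> z" using auto_bij[OF \<gamma>] y(1) unfolding bij_betw_def by blast
        have "z \<otimes> inv y \<in> T" using diff_sym[OF T(1) y(1) z(1)] R z by blast
        then have "z \<in> C" using memC z(1) diff_trans[OF T(1) z(1) y(1) a(1) _ y(2)] by blast
        then show "y \<in> \<gamma> ` C" using z(2) by blast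
      qed
    qed
  qed
qed

text \<open>
  A decomposition \<open>A = T \<oplus> K\<close>, with the projection \<open>\<tau>\<close> onto \<open>T\<close>.
\<close>

locale split_bounded_or_fg = bounded_or_fg A for A (structure) +
  fixes K :: "'a set" and \<tau> :: "'a \<Rightarrow> 'a"
  assumes K: "subgroup K A"
    and \<tau>_hom: "\<tau> \<in> hom A A"
    and \<tau>_T: "\<And>a. a \<in> carrier A \<Longrightarrow> \<tau> a \<in> T"
    and \<tau>_id: "\<And>t. t \<in> T \<Longrightarrow> \<tau> t = t"
    and \<tau>_K: "\<And>a. a \<in> carrier A \<Longrightarrow> a \<otimes> inv (\<tau> a) \<in> K"
    and \<tau>_one: "\<And>k. k \<in> K \<Longrightarrow> \<tau> k = \<one>"

lemma (in bounded_or_fg) ex_split: "\<exists>K \<tau>. split_bounded_or_fg A K \<tau>"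
proof -
  obtain K where K: "subgroup K A" "K \<inter> T = {\<one>}" "carrier A \<subseteq> K <#> T" by (rule torsion_complement)
  have Kc: "k \<in> carrier A" if "k \<in> K" for k using subgroup.mem_carrier[OF K(1) that] .
  have "\<forall>a. \<exists>t. a \<in> carrier A \<longrightarrow> t \<in> T \<and> a \<otimes> inv t \<in> K"
  proof
    fix a
    show "\<exists>t. a \<in> carrier A \<longrightarrow> t \<in> T \<and> a \<otimes> inv t \<in> K"
    proof (cases "a \<in> carrier A")
      case True
      then obtain k t where kt: "k \<in> K" "t \<in> T" "a = k \<otimes> t" using K(3) unfolding set_mult_def by blast
      have "a \<otimes> inv t = k" unfolding kt(3) using Kc[OF kt(1)] T_closed[OF kt(2)] by (simp add: m_assoc)
      then show ?thesis using kt by blast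
    qed blast
  qed
  then obtain \<tau> where \<tau>: "\<And>a. a \<in> carrier A \<Longrightarrow> \<tau> a \<in> T" "\<And>a. a \<in> carrier A \<Longrightarrow> a \<otimes> inv (\<tau> a) \<in> K" by metis
  have uniq: "\<tau> a = t" if a: "a \<in> carrier A" and t: "t \<in> T" "a \<otimes> inv t \<in> K" for a t
  proof -
    have c: "\<tau> a \<in> carrier A" "t \<in> carrier A" using \<tau>(1)[OF a] t(1) T_closed by auto
    have "\<tau> a \<otimes> inv t = (a \<otimes> inv t) \<otimes> inv (a \<otimes> inv (\<tau> a))"
      by (rule abelian_normal_form3[of a t "\<tau> a"]) (use a c in simp_all)
    then have "\<tau> a \<otimes> inv t \<in> K"
      using subgroup.m_closed[OF K(1) t(2) subgroup.m_inv_closed[OF K(1) \<tau>(2)[OF a]]] by simp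
    moreover have "\<tau> a \<otimes> inv t \<in> T"
      using subgroup.m_closed[OF torsion_subgroup \<tau>(1)[OF a] subgroup.m_inv_closed[OF torsion_subgroup t(1)]] .
    ultimately have "\<tau> a \<otimes> inv t = \<one>" using K(2) by blast
    then show ?thesis using c by (metis inv_equality inv_closed inv_inv)
  qed
  have "split_bounded_or_fg A K \<tau>"
  proof (intro split_bounded_or_fg.intro split_bounded_or_fg_axioms.intro)
    show "bounded_or_fg A" by (rule bounded_or_fg_axioms)
    show "subgroup K A" by fact
    show "\<tau> \<in> hom A A"
    proof (rule homI)
      show "\<tau> x \<in> carrier A" if "x \<in> carrier A" for x using \<tau>(1)[OF that] T_closed by blast
      fix x y assume xy: "x \<in> carrier A" "y \<in> carrier A"
      have c: "\<tau> x \<in> carrier A" "\<tau> y \<in> carrier A" using \<tau>(1) xy T_closed by auto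
      show "\<tau> (x \<otimes> y) = \<tau> x \<otimes> \<tau> y"
      proof (rule uniq)
        show "\<tau> x \<otimes> \<tau> y \<in> T" using subgroup.m_closed[OF torsion_subgroup] \<tau>(1) xy by blast
        have "x \<otimes> y \<otimes> inv (\<tau> x \<otimes> \<tau> y) = (x \<otimes> inv (\<tau> x)) \<otimes> (y \<otimes> inv (\<tau> y))"
          by (rule abelian_normal_form4[of x y "\<tau> x" "\<tau> y"]) (use xy c in simp_all)
        then show "x \<otimes> y \<otimes> inv (\<tau> x \<otimes> \<tau> y) \<in> K"
          using subgroup.m_closed[OF K(1) \<tau>(2)[OF xy(1)] \<tau>(2)[OF xy(2)]] by simp
      qed (use xy in simp)
    qed
    show "\<tau> a \<in> T" if "a \<in> carrier A" for a using \<tau>(1)[OF that] .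
    show "a \<otimes> inv (\<tau> a) \<in> K" if "a \<in> carrier A" for a using \<tau>(2)[OF that] .
    show "\<tau> t = t" if "t \<in> T" for t
      using uniq[of t t] that T_closed[OF that] subgroup.one_closed[OF K(1)] by simp
    show "\<tau> k = \<one>" if "k \<in> K" for k
      using uniq[of k \<one>] that Kc[OF that] subgroup.one_closed[OF torsion_subgroup] by simp
  qed
  then show ?thesis by blast
qed

section \<open>Inertial automorphisms that are trivial modulo the torsion subgroup\<close>

context split_bounded_or_fg
begin

abbreviation TG where "TG \<equiv> A\<lparr>carrier := T\<rparr>"

lemma comm_group_A: "comm_group A" by unfold_locales

lemma comm_group_TG: "comm_group TG"
proof -
  have "group TG" using subgroup_imp_group[OF torsion_subgroup] .
  then show ?thesis
    by (rule group.group_comm_groupI) (use T_closed m_comm in simp)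
qed

lemma torsion_TG: "carrier TG = torsion_part TG"
proof -
  have "T \<subseteq> torsion_part TG"
    unfolding torsion_part_def by (auto simp: nat_pow_consistent[symmetric])
  then show ?thesis unfolding torsion_part_def[of TG] by auto
qed

lemma subgroup_TG_iff: "subgroup H TG \<longleftrightarrow> subgroup H A \<and> H \<subseteq> T"
  using incl_subgroup[OF torsion_subgroup] subgroup_incl[OF _ torsion_subgroup] subgroup.subset[of H TG] by auto

lemma auto_T:
  assumes "\<gamma> \<in> auto A" "t \<in> T" shows "\<gamma> t \<in> T"
proof -
  interpret g: group_hom A A \<gamma> by unfold_locales (use auto_hom[OF assms(1)] in auto)
  obtain n :: int where n: "n \<noteq> 0" "t [^] n = \<one>" and t: "t \<in> carrier A" using assms(2) unfolding torsion_part_int by auto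
  have "\<gamma> t [^] n = \<one>" using g.hom_int_pow[OF t, of n] n by simp
  then show ?thesis using n t unfolding torsion_part_int by auto
qed

text \<open>
  Restriction of an automorphism to \<open>T\<close>.
\<close>

definition res :: "('a \<Rightarrow> 'a) \<Rightarrow> 'a \<Rightarrow> 'a" where
  "res \<gamma> = restrict \<gamma> T"

lemma res_apply [simp]: "t \<in> T \<Longrightarrow> res \<gamma> t = \<gamma> t"
  by (simp add: res_def)

lemma res_auto:
  assumes \<gamma>: "\<gamma> \<in> auto A" shows "res \<gamma> \<in> auto TG"
proof (rule autoI)
  note inv = AutoGroup_inv[OF \<gamma>]
  show "res \<gamma> \<in> hom TG TG"
    by (rule homI)
      (use auto_T[OF \<gamma>] hom_mult[OF auto_hom[OF \<gamma>]] T_closed subgroup.m_closed[OF torsion_subgroup] in auto)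
  show "res \<gamma> \<in> extensional (carrier TG)" by (simp add: res_def)
  show "bij_betw (res \<gamma>) (carrier TG) (carrier TG)"
    by (rule bij_betw_byWitness[where f' = "inv\<^bsub>AutoGroup A\<^esub> \<gamma>"])
      (use auto_T[OF \<gamma>] auto_T[OF inv(1)] inv(2,3) T_closed in auto)
qed

text \<open>
  The extension of an automorphism of \<open>T\<close> that is the identity on \<open>K\<close>. It is meaningful for automorphisms of
  \<open>T\<close> only.
\<close>

definition ext :: "('a \<Rightarrow> 'a) \<Rightarrow> 'a \<Rightarrow> 'a" where
  "ext \<gamma> = (\<lambda>a\<in>carrier A. a \<otimes> inv (\<tau> a) \<otimes> \<gamma> (\<tau> a))"

lemma ext_apply: "a \<in> carrier A \<Longrightarrow> ext \<gamma> a = a \<otimes> inv (\<tau> a) \<otimes> \<gamma> (\<tau> a)"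
  by (simp add: ext_def)

lemma \<tau>_closed: "a \<in> carrier A \<Longrightarrow> \<tau> a \<in> carrier A"
  using \<tau>_T T_closed by blast

lemma TG_auto_T: "\<gamma> \<in> auto TG \<Longrightarrow> t \<in> T \<Longrightarrow> \<gamma> t \<in> T"
  using auto_closed[of \<gamma> TG t] by simp

lemma TG_auto_mult: "\<gamma> \<in> auto TG \<Longrightarrow> s \<in> T \<Longrightarrow> t \<in> T \<Longrightarrow> \<gamma> (s \<otimes> t) = \<gamma> s \<otimes> \<gamma> t"
  using hom_mult[OF auto_hom, of \<gamma> TG s t] by simp

lemma TG_auto_one: "\<gamma> \<in> auto TG \<Longrightarrow> \<gamma> \<one> = \<one>"
  using hom_one[OF auto_hom, of \<gamma> TG] comm_group_TG by (simp add: comm_group_def)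

lemma \<tau>_ext:
  assumes "\<gamma> \<in> auto TG" "a \<in> carrier A" shows "\<tau> (ext \<gamma> a) = \<gamma> (\<tau> a)"
proof -
  interpret t: group_hom A A \<tau> by unfold_locales (rule \<tau>_hom)
  have "\<gamma> (\<tau> a) \<in> T" using TG_auto_T[OF assms(1) \<tau>_T[OF assms(2)]] .
  then show ?thesis
    unfolding ext_apply[OF assms(2)] using assms(2) T_closed \<tau>_id \<tau>_T by simp
qed

lemma ext_closed: "\<gamma> \<in> auto TG \<Longrightarrow> a \<in> carrier A \<Longrightarrow> ext \<gamma> a \<in> carrier A"
  unfolding ext_apply using \<tau>_closed T_closed[OF TG_auto_T[OF _ \<tau>_T]] by auto

lemma ext_inverse:
  assumes \<gamma>: "\<gamma> \<in> auto TG" and \<delta>: "\<delta> \<in> auto TG" and inv: "\<And>t. t \<in> T \<Longrightarrow> \<delta> (\<gamma> t) = t" and a: "a \<in> carrier A"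
  shows "ext \<delta> (ext \<gamma> a) = a"
proof -
  have c: "\<tau> a \<in> carrier A" "\<gamma> (\<tau> a) \<in> carrier A"
    using \<tau>_closed[OF a] T_closed[OF TG_auto_T[OF \<gamma> \<tau>_T[OF a]]] by auto
  have "ext \<delta> (ext \<gamma> a) = ext \<gamma> a \<otimes> inv (\<gamma> (\<tau> a)) \<otimes> \<tau> a"
    using ext_apply[OF ext_closed[OF \<gamma> a], of \<delta>] by (simp only: \<tau>_ext[OF \<gamma> a] inv[OF \<tau>_T[OF a]])
  also have "\<dots> = (a \<otimes> inv (\<tau> a) \<otimes> \<gamma> (\<tau> a)) \<otimes> inv (\<gamma> (\<tau> a)) \<otimes> \<tau> a"
    by (simp only: ext_apply[OF a])
  also have "\<dots> = a"
    by (rule abelian_normal_form3[of a "\<tau> a" "\<gamma> (\<tau> a)"]) (use a c in simp_all)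
  finally show ?thesis .
qed

lemma ext_auto:
  assumes \<gamma>: "\<gamma> \<in> auto TG" shows "ext \<gamma> \<in> auto A"
proof (rule autoI)
  interpret TG: comm_group TG by (rule comm_group_TG)
  note inv = TG.AutoGroup_inv[OF \<gamma>]
  have cT: "carrier TG = T" by simp
  show "ext \<gamma> \<in> extensional (carrier A)" by (simp add: ext_def)
  show "ext \<gamma> \<in> hom A A"
  proof (rule homI)
    show "ext \<gamma> x \<in> carrier A" if "x \<in> carrier A" for x using ext_closed[OF \<gamma> that] .
    fix x y assume xy: "x \<in> carrier A" "y \<in> carrier A"
    have t: "\<tau> (x \<otimes> y) = \<tau> x \<otimes> \<tau> y" using hom_mult[OF \<tau>_hom xy] .
    have g: "\<gamma> (\<tau> x \<otimes> \<tau> y) = \<gamma> (\<tau> x) \<otimes> \<gamma> (\<tau> y)" using TG_auto_mult[OF \<gamma> \<tau>_T[OF xy(1)] \<tau>_T[OF xy(2)]] .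
    have c: "\<tau> x \<in> carrier A" "\<tau> y \<in> carrier A" "\<gamma> (\<tau> x) \<in> carrier A" "\<gamma> (\<tau> y) \<in> carrier A"
      using \<tau>_closed xy T_closed[OF TG_auto_T[OF \<gamma> \<tau>_T]] by auto
    have xyc: "x \<otimes> y \<in> carrier A" using xy by simp
    show "ext \<gamma> (x \<otimes> y) = ext \<gamma> x \<otimes> ext \<gamma> y"
      unfolding ext_apply[OF xy(1)] ext_apply[OF xy(2)] ext_apply[OF xyc] t g
      using xy c by (simp add: inv_mult m_ac)
  qed
  show "bij_betw (ext \<gamma>) (carrier A) (carrier A)"
    by (rule bij_betw_byWitness[where f' = "ext (inv\<^bsub>AutoGroup TG\<^esub> \<gamma>)"])
      (use ext_inverse[OF \<gamma> inv(1) inv(3)[unfolded cT]] ext_inverse[OF inv(1) \<gamma> inv(2)[unfolded cT]]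
        ext_closed[OF \<gamma>] ext_closed[OF inv(1)] in auto)
qed

lemma ext_trivial: "\<gamma> \<in> auto TG \<Longrightarrow> a \<in> carrier A \<Longrightarrow> ext \<gamma> a \<otimes> inv a \<in> T"
proof -
  assume \<gamma>: "\<gamma> \<in> auto TG" and a: "a \<in> carrier A"
  have g: "\<gamma> (\<tau> a) \<in> T" using TG_auto_T[OF \<gamma> \<tau>_T[OF a]] .
  have "ext \<gamma> a \<otimes> inv a = inv (\<tau> a) \<otimes> \<gamma> (\<tau> a)"
    unfolding ext_apply[OF a]
    by (rule abelian_normal_form3[of a "\<tau> a" "\<gamma> (\<tau> a)"]) (use a \<tau>_closed T_closed g in simp_all)
  then show ?thesis
    using subgroup.m_closed[OF torsion_subgroup subgroup.m_inv_closed[OF torsion_subgroup \<tau>_T[OF a]] g] by simp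
qed

lemma ext_on_K: "\<gamma> \<in> auto TG \<Longrightarrow> k \<in> K \<Longrightarrow> ext \<gamma> k = k"
  using ext_apply[of k \<gamma>] subgroup.mem_carrier[OF K] \<tau>_one TG_auto_one[of \<gamma>] by simp

lemma ext_on_T: "\<gamma> \<in> auto TG \<Longrightarrow> t \<in> T \<Longrightarrow> ext \<gamma> t = \<gamma> t"
  using ext_apply[of t \<gamma>] T_closed \<tau>_id T_closed[OF TG_auto_T] by simp

lemma res_ext: "\<gamma> \<in> auto TG \<Longrightarrow> res (ext \<gamma>) = \<gamma>"
  by (rule auto_ext[of _ TG]) (use res_auto[OF ext_auto] ext_on_T in auto)

lemma fixes_T_and_K:
  assumes \<gamma>: "\<gamma> \<in> auto A" and "\<And>t. t \<in> T \<Longrightarrow> \<gamma> t = t" "\<And>k. k \<in> K \<Longrightarrow> \<gamma> k = k"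
  shows "\<gamma> = \<one>\<^bsub>AutoGroup A\<^esub>"
proof (rule auto_ext[OF \<gamma>])
  show "\<one>\<^bsub>AutoGroup A\<^esub> \<in> auto A" using id_in_auto by (simp add: AutoGroup_simps)
  fix a assume a: "a \<in> carrier A"
  have k: "a \<otimes> inv (\<tau> a) \<in> carrier A" using a \<tau>_closed by simp
  have d: "a = (a \<otimes> inv (\<tau> a)) \<otimes> \<tau> a"
    by (rule abelian_normal_form2[of a "\<tau> a"]) (use a \<tau>_closed in simp_all)
  have "\<gamma> a = \<gamma> (a \<otimes> inv (\<tau> a)) \<otimes> \<gamma> (\<tau> a)"
    using hom_mult[OF auto_hom[OF \<gamma>] k \<tau>_closed[OF a]] d by simp
  also have "\<dots> = a" using assms(2)[OF \<tau>_T[OF a]] assms(3)[OF \<tau>_K[OF a]] d by simp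
  finally show "\<gamma> a = \<one>\<^bsub>AutoGroup A\<^esub> a" using a by (simp add: AutoGroup_simps)
qed

lemma difference_hom:
  assumes \<gamma>: "\<gamma> \<in> auto A"
  shows "(\<lambda>a. \<gamma> a \<otimes> inv a) \<in> hom A A"
proof (rule homI)
  show "\<gamma> x \<otimes> inv x \<in> carrier A" if "x \<in> carrier A" for x using auto_closed[OF \<gamma> that] that by simp
  fix x y assume xy: "x \<in> carrier A" "y \<in> carrier A"
  show "\<gamma> (x \<otimes> y) \<otimes> inv (x \<otimes> y) = \<gamma> x \<otimes> inv x \<otimes> (\<gamma> y \<otimes> inv y)"
    unfolding hom_mult[OF auto_hom[OF \<gamma>] xy]
    by (rule abelian_normal_form4[of x y "\<gamma> x" "\<gamma> y"]) (use xy auto_closed[OF \<gamma>] in simp_all)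
qed

lemma inertial_res:
  assumes "inertial A \<gamma>" shows "inertial TG (res \<gamma>)"
proof -
  have \<gamma>: "\<gamma> \<in> auto A" and ap: "\<And>H. subgroup H A \<Longrightarrow> almost_preserves A \<gamma> H"
    using assms unfolding inertial_iff[OF comm_group_A] by auto
  have "almost_preserves TG (res \<gamma>) H" if "subgroup H TG" for H
  proof -
    have H: "subgroup H A" "H \<subseteq> T" using that subgroup_TG_iff by auto
    obtain F where F: "finite F" "F \<subseteq> carrier A" "\<forall>h\<in>H. \<exists>h'\<in>H. \<exists>f\<in>F. \<gamma> h = h' \<otimes> f"
      using ap[OF H(1)] unfolding almost_preserves_def by blast
    show ?thesis unfolding almost_preserves_def
    proof (intro exI[of _ "F \<inter> T"] conjI ballI)
      fix h assume h: "h \<in> H"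
      then obtain h' f where hf: "h' \<in> H" "f \<in> F" "\<gamma> h = h' \<otimes> f" using F(3) by blast
      have c: "h' \<in> carrier A" "f \<in> carrier A" using hf(1,2) H(2) T_closed F(2) by auto
      have "f = inv h' \<otimes> \<gamma> h" unfolding hf(3) by (rule abelian_normal_form2[of h' f]) (use c in simp_all)
      then have "f \<in> T"
        using subgroup.m_closed[OF torsion_subgroup subgroup.m_inv_closed[OF torsion_subgroup] auto_T[OF \<gamma>], of h' h]
          H(2) h hf(1) by auto
      moreover have "res \<gamma> h = h' \<otimes>\<^bsub>TG\<^esub> f" using hf(3) res_apply[OF subsetD[OF H(2) h]] by simp
      ultimately show "\<exists>h'\<in>H. \<exists>f\<in>F \<inter> T. res \<gamma> h = h' \<otimes>\<^bsub>TG\<^esub> f" using hf(1,2) by blast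
    qed (use F in auto)
  qed
  then show ?thesis unfolding inertial_iff[OF comm_group_TG] using res_auto[OF \<gamma>] by blast
qed

text \<open>
  For an automorphism \<open>\<gamma>\<close> that is trivial modulo \<open>T\<close>, being inertial depends on \<open>T\<close> only. Up to finite index,
  a subgroup \<open>H\<close> is \<open>(H \<inter> T) + (H \<inter> K)\<close>. On the first summand \<open>\<gamma>\<close> is inertial, and on the second it differs
  from the identity by a homomorphism \<open>\<phi>\<close> from \<open>A/T\<close> to \<open>T\<close>, whose image is finite.
\<close>

lemma inertial_of_res:
  assumes \<gamma>: "\<gamma> \<in> auto A" and triv: "\<And>a. a \<in> carrier A \<Longrightarrow> \<gamma> a \<otimes> inv a \<in> T" and "inertial TG (res \<gamma>)"
  shows "inertial A \<gamma>"
proof -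
  have ap: "\<And>H. subgroup H TG \<Longrightarrow> almost_preserves TG (res \<gamma>) H"
    using assms(3) unfolding inertial_iff[OF comm_group_TG] by auto
  define \<phi> where "\<phi> a = \<gamma> (a \<otimes> inv (\<tau> a)) \<otimes> inv (a \<otimes> inv (\<tau> a))" for a
  interpret t: group_hom A A \<tau> by unfold_locales (rule \<tau>_hom)
  have kc: "a \<otimes> inv (\<tau> a) \<in> carrier A" if "a \<in> carrier A" for a using that \<tau>_closed by simp
  have \<phi>_hom: "\<phi> \<in> hom A A"
  proof (rule homI)
    show "\<phi> x \<in> carrier A" if "x \<in> carrier A" for x
      unfolding \<phi>_def using hom_in_carrier[OF difference_hom[OF \<gamma>] kc[OF that]] .
    fix x y assume xy: "x \<in> carrier A" "y \<in> carrier A"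
    have "x \<otimes> y \<otimes> inv (\<tau> (x \<otimes> y)) = (x \<otimes> inv (\<tau> x)) \<otimes> (y \<otimes> inv (\<tau> y))"
      unfolding t.hom_mult[OF xy]
      by (rule abelian_normal_form4[of x y "\<tau> x" "\<tau> y"]) (use xy \<tau>_closed in simp_all)
    then show "\<phi> (x \<otimes> y) = \<phi> x \<otimes> \<phi> y"
      unfolding \<phi>_def using hom_mult[OF difference_hom[OF \<gamma>] kc[OF xy(1)] kc[OF xy(2)]] by simp
  qed
  have \<phi>_T: "\<phi> a \<in> T" if "a \<in> carrier A" for a unfolding \<phi>_def using triv[OF kc[OF that]] .
  have \<phi>_ker: "\<phi> t = \<one>" if "t \<in> T" for t
  proof -
    interpret g: group_hom A A \<gamma> by unfold_locales (use auto_hom[OF \<gamma>] in auto)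
    show ?thesis unfolding \<phi>_def using \<tau>_id[OF that] T_closed[OF that] by simp
  qed
  have \<phi>_fin: "finite (\<phi> ` carrier A)" by (rule torsion_valued_hom_finite_range[OF \<phi>_hom \<phi>_ker \<phi>_T])
  have \<phi>_K: "\<gamma> k = k \<otimes> \<phi> k" if "k \<in> K" for k
  proof -
    have c: "k \<in> carrier A" using subgroup.mem_carrier[OF K that] .
    have "\<phi> k = \<gamma> k \<otimes> inv k" unfolding \<phi>_def using \<tau>_one[OF that] c by simp
    moreover have "k \<otimes> (\<gamma> k \<otimes> inv k) = \<gamma> k"
      by (rule abelian_normal_form2[of k "\<gamma> k"]) (use c auto_closed[OF \<gamma> c] in simp_all)
    ultimately show ?thesis by (simp only:)
  qed
  have "almost_preserves A \<gamma> H" if H: "subgroup H A" for H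
  proof -
    have Hc: "H \<subseteq> carrier A" using subgroup.subset[OF H] .
    have HT: "subgroup (H \<inter> T) A" using subgroups_Inter_pair[OF H torsion_subgroup] .
    have HK: "subgroup (H \<inter> K) A" using subgroups_Inter_pair[OF H K] .
    define M where "M = (H \<inter> T) <#> (H \<inter> K)"
    have M: "subgroup M A" unfolding M_def using mult_subgroups[OF HT HK] .
    \<comment> \<open>An exponent of the component of \<open>h\<close> in \<open>T\<close> maps \<open>h\<close> into \<open>K\<close>.\<close>
    have pow: "h [^] n \<in> H \<inter> K" if h: "h \<in> H" and n: "\<tau> h [^] (n::int) = \<one>" for h n
    proof -
      have hc: "h \<in> carrier A" using h Hc by auto
      have "(h \<otimes> inv (\<tau> h)) [^] n = h [^] n \<otimes> inv (\<tau> h [^] n)"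
        by (rule abelian_normal_form2[of h "\<tau> h"]) (use hc \<tau>_closed in simp_all)
      also have "\<dots> = h [^] n" using n hc by simp
      finally have "h [^] n \<in> K" using subgroup_int_pow_closed[OF K \<tau>_K[OF hc], of n] by simp
      then show ?thesis using subgroup_int_pow_closed[OF H h] by blast
    qed
    have MK: "H \<inter> K \<subseteq> M" unfolding M_def using subset_set_mult_right[OF HT HK] .
    have "finite_index H M"
    proof (rule finite_index_of_torsion_quotient[OF H M])
      show "M \<subseteq> H" unfolding M_def by (rule set_mult_least[OF H]) auto
      show "H \<inter> T \<subseteq> M" unfolding M_def using subset_set_mult_left[OF HT HK] .
      show "\<exists>n::int. n \<noteq> 0 \<and> h [^] n \<in> M" if h: "h \<in> H" for h
      proof -
        have "\<tau> h \<in> T" using \<tau>_T h Hc by blast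
        then obtain n :: int where "n \<noteq> 0" "\<tau> h [^] n = \<one>" unfolding torsion_part_int by auto
        then show ?thesis using pow[OF h] MK by blast
      qed
      show "h [^] n \<in> M" if n: "\<forall>t\<in>T. t [^] (n::int) = \<one>" and h: "h \<in> H" for n h
      proof -
        have "\<tau> h \<in> T" using \<tau>_T h Hc by blast
        then show ?thesis using pow[OF h] n MK by blast
      qed
    qed
    then obtain R where R: "finite R" "R \<subseteq> H" "\<forall>h\<in>H. \<exists>r\<in>R. h \<otimes> inv r \<in> M"
      unfolding finite_index_def by blast
    have "subgroup (H \<inter> T) TG" using HT subgroup_TG_iff by blast
    from ap[OF this] obtain F where F: "finite F" "F \<subseteq> T" "\<forall>h\<in>H \<inter> T. \<exists>h'\<in>H \<inter> T. \<exists>f\<in>F. \<gamma> h = h' \<otimes> f"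
      unfolding almost_preserves_def by auto
    let ?F = "F <#> (\<phi> ` carrier A <#> \<gamma> ` R)"
    have gR: "\<gamma> ` R \<subseteq> carrier A" using R(2) Hc auto_closed[OF \<gamma>] by blast
    have Fc: "F \<subseteq> carrier A" using F(2) T_closed by blast
    have phc: "\<phi> ` carrier A \<subseteq> carrier A" using \<phi>_T T_closed by blast
    show ?thesis unfolding almost_preserves_def
    proof (intro exI[of _ ?F] conjI ballI)
      show "finite ?F" using finite_set_mult[OF F(1) finite_set_mult[OF \<phi>_fin finite_imageI[OF R(1)]]] .
      show "?F \<subseteq> carrier A" using setmult_subset_G[OF Fc setmult_subset_G[OF phc gR]] .
      fix h assume h: "h \<in> H"
      obtain r where r: "r \<in> R" "h \<otimes> inv r \<in> M" using R(3) h by blast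
      obtain t k where tk: "t \<in> H \<inter> T" "k \<in> H \<inter> K" "h \<otimes> inv r = t \<otimes> k" using r(2) unfolding M_def set_mult_def by blast
      obtain t' f where t': "t' \<in> H \<inter> T" "f \<in> F" "\<gamma> t = t' \<otimes> f" using F(3) tk(1) by blast
      have c: "h \<in> carrier A" "r \<in> carrier A" "t \<in> carrier A" "k \<in> carrier A" "t' \<in> carrier A" "f \<in> carrier A"
        using h r(1) tk(1,2) t'(1,2) R(2) Hc Fc by blast+
      have c2: "\<phi> k \<in> carrier A" "\<gamma> r \<in> carrier A" using phc c auto_closed[OF \<gamma>] by blast+
      have "h = (h \<otimes> inv r) \<otimes> r" by (rule abelian_normal_form2[of h r]) (use c in simp_all)
      then have "\<gamma> h = \<gamma> (t \<otimes> k \<otimes> r)" unfolding tk(3) by simp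
      also have "\<dots> = \<gamma> t \<otimes> \<gamma> k \<otimes> \<gamma> r" using hom_mult[OF auto_hom[OF \<gamma>]] c by simp
      also have "\<dots> = (t' \<otimes> f) \<otimes> (k \<otimes> \<phi> k) \<otimes> \<gamma> r" using t'(3) \<phi>_K tk(2) by simp
      also have "\<dots> = (t' \<otimes> k) \<otimes> (f \<otimes> (\<phi> k \<otimes> \<gamma> r))" using c c2 by (simp add: m_ac)
      finally have "\<gamma> h = (t' \<otimes> k) \<otimes> (f \<otimes> (\<phi> k \<otimes> \<gamma> r))" .
      moreover have "\<phi> k \<otimes> \<gamma> r \<in> \<phi> ` carrier A <#> \<gamma> ` R"
        using imageI[OF c(4), of \<phi>] imageI[OF r(1), of \<gamma>] unfolding mem_set_mult by blast
      then have "f \<otimes> (\<phi> k \<otimes> \<gamma> r) \<in> ?F" using t'(2) unfolding mem_set_mult[of _ F] by blast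
      moreover have "t' \<otimes> k \<in> H" using subgroup.m_closed[OF H] t'(1) tk(2) by blast
      ultimately show "\<exists>h'\<in>H. \<exists>f\<in>?F. \<gamma> h = h' \<otimes> f" by blast
    qed
  qed
  then show ?thesis unfolding inertial_iff[OF comm_group_A] using \<gamma> by blast
qed

lemma carrier_IAut1:
  "carrier (IAut1 A) = {\<gamma> \<in> auto A. (\<forall>a\<in>carrier A. \<gamma> a \<otimes> inv a \<in> T) \<and> inertial TG (res \<gamma>)}"
proof -
  have "carrier (IAut1 A) = {\<gamma>. inertial A \<gamma> \<and> (\<forall>C\<in>carrier (A Mod T). \<gamma> ` C = C)}"
    unfolding IAut1_def using carrier_IAut by auto
  also have "\<dots> = {\<gamma> \<in> auto A. (\<forall>a\<in>carrier A. \<gamma> a \<otimes> inv a \<in> T) \<and> inertial TG (res \<gamma>)}"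
  proof (rule Collect_cong)
    fix \<gamma>
    show "inertial A \<gamma> \<and> (\<forall>C\<in>carrier (A Mod T). \<gamma> ` C = C) \<longleftrightarrow>
      \<gamma> \<in> auto A \<and> (\<forall>a\<in>carrier A. \<gamma> a \<otimes> inv a \<in> T) \<and> inertial TG (res \<gamma>)"
    proof (cases "\<gamma> \<in> auto A")
      case True
      note iff = auto_trivial_mod_iff[OF True torsion_subgroup auto_T[OF True]]
      show ?thesis using True inertial_res[of \<gamma>] inertial_of_res[OF True] by (simp only: iff) blast
    next
      case False
      then show ?thesis by (simp add: inertial_def)
    qed
  qed
  finally show ?thesis .
qed

lemma IAut1D:
  assumes "\<gamma> \<in> carrier (IAut1 A)"
  shows "\<gamma> \<in> auto A" "a \<in> carrier A \<Longrightarrow> \<gamma> a \<otimes> inv a \<in> T" "inertial TG (res \<gamma>)"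
  using assms[unfolded carrier_IAut1] by simp_all

lemma IAut1I:
  assumes "\<gamma> \<in> auto A" "\<And>a. a \<in> carrier A \<Longrightarrow> \<gamma> a \<otimes> inv a \<in> T" "inertial TG (res \<gamma>)"
  shows "\<gamma> \<in> carrier (IAut1 A)"
  unfolding carrier_IAut1 using assms by simp

lemma IAut1_eq: "IAut1 A = (AutoGroup A)\<lparr>carrier := carrier (IAut1 A)\<rparr>"
  unfolding IAut1_def IAut_def subgroup_generated_def by simp

lemma res_mult:
  assumes "\<gamma> \<in> auto A" "\<delta> \<in> auto A"
  shows "res (\<gamma> \<otimes>\<^bsub>AutoGroup A\<^esub> \<delta>) = res \<gamma> \<otimes>\<^bsub>AutoGroup TG\<^esub> res \<delta>"
proof -
  interpret Aut: group "AutoGroup A" by (rule AutoGroup)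
  interpret TG: comm_group TG by (rule comm_group_TG)
  interpret AutT: group "AutoGroup TG" by (rule TG.AutoGroup)
  show ?thesis
  proof (rule auto_ext[of _ TG])
    show "res (\<gamma> \<otimes>\<^bsub>AutoGroup A\<^esub> \<delta>) \<in> auto TG"
      using res_auto Aut.m_closed assms by (simp add: AutoGroup_simps(1))
    show "res \<gamma> \<otimes>\<^bsub>AutoGroup TG\<^esub> res \<delta> \<in> auto TG"
      using res_auto[OF assms(1)] res_auto[OF assms(2)] AutT.m_closed by (simp add: AutoGroup_simps(1))
    fix t assume "t \<in> carrier TG"
    then show "res (\<gamma> \<otimes>\<^bsub>AutoGroup A\<^esub> \<delta>) t = (res \<gamma> \<otimes>\<^bsub>AutoGroup TG\<^esub> res \<delta>) t"
      using AutoGroup_mult_apply[OF assms, of t] AutoGroup_mult_apply[OF res_auto[OF assms(1)] res_auto[OF assms(2)], of t]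
        T_closed auto_T[OF assms(2)] by simp
  qed
qed

lemma res_one: "res \<one>\<^bsub>AutoGroup A\<^esub> = \<one>\<^bsub>AutoGroup TG\<^esub>"
  unfolding AutoGroup_simps res_def using T_closed by (auto simp: restrict_def)

lemma subgroup_IAut1: "subgroup (carrier (IAut1 A)) (AutoGroup A)"
proof -
  interpret Aut: group "AutoGroup A" by (rule AutoGroup)
  interpret TG: comm_group TG by (rule comm_group_TG)
  interpret AutT: group "AutoGroup TG" by (rule TG.AutoGroup)
  show ?thesis
  proof (rule Aut.subgroupI)
    show "carrier (IAut1 A) \<subseteq> carrier (AutoGroup A)" unfolding carrier_IAut1 AutoGroup_simps(1) by blast
    have "\<one>\<^bsub>AutoGroup A\<^esub> \<in> carrier (IAut1 A)"
      unfolding carrier_IAut1 mem_Collect_eq res_one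
      using TG.inertial_id id_in_auto subgroup.one_closed[OF torsion_subgroup] by (simp add: AutoGroup_simps(2))
    then show "carrier (IAut1 A) \<noteq> {}" by blast
  next
    fix \<gamma> assume "\<gamma> \<in> carrier (IAut1 A)"
    note \<gamma> = IAut1D[OF this]
    note inv = AutoGroup_inv[OF \<gamma>(1)]
    let ?i = "inv\<^bsub>AutoGroup A\<^esub> \<gamma>"
    have triv: "?i a \<otimes> inv a \<in> T" if a: "a \<in> carrier A" for a
      using diff_sym[OF torsion_subgroup a auto_closed[OF inv(1) a]] \<gamma>(2)[OF auto_closed[OF inv(1) a]] inv(2)[OF a] by simp
    have eq: "res ?i = inv\<^bsub>AutoGroup TG\<^esub> (res \<gamma>)"
    proof -
      have "\<gamma> \<in> carrier (AutoGroup A)" using \<gamma>(1) by (simp only: AutoGroup_simps(1))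
      then have 1: "res ?i \<otimes>\<^bsub>AutoGroup TG\<^esub> res \<gamma> = \<one>\<^bsub>AutoGroup TG\<^esub>"
        by (simp only: res_mult[OF inv(1) \<gamma>(1), symmetric] Aut.l_inv res_one)
      have "res \<gamma> \<in> carrier (AutoGroup TG)" "res ?i \<in> carrier (AutoGroup TG)"
        unfolding AutoGroup_simps(1) by (rule res_auto[OF \<gamma>(1)], rule res_auto[OF inv(1)])
      from AutT.inv_equality[OF 1 this] show ?thesis by (rule sym)
    qed
    have "inertial TG (res ?i)" unfolding eq by (rule TG.inertial_inverse_torsion[OF torsion_TG \<gamma>(3)])
    from IAut1I[OF inv(1) triv this] show "?i \<in> carrier (IAut1 A)" .
  next
    fix \<gamma> \<delta> assume g: "\<gamma> \<in> carrier (IAut1 A)" and d: "\<delta> \<in> carrier (IAut1 A)"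
    note \<gamma> = IAut1D[OF g] and \<delta> = IAut1D[OF d]
    have triv: "(\<gamma> \<otimes>\<^bsub>AutoGroup A\<^esub> \<delta>) a \<otimes> inv a \<in> T" if a: "a \<in> carrier A" for a
    proof -
      have c: "\<delta> a \<in> carrier A" "\<gamma> (\<delta> a) \<in> carrier A"
        using auto_closed[OF \<delta>(1) a] auto_closed[OF \<gamma>(1) auto_closed[OF \<delta>(1) a]] .
      show ?thesis
        unfolding AutoGroup_mult_apply[OF \<gamma>(1) \<delta>(1) a]
        using diff_trans[OF torsion_subgroup c(2,1) a \<gamma>(2)[OF c(1)] \<delta>(2)[OF a]] .
    qed
    have "\<gamma> \<otimes>\<^bsub>AutoGroup A\<^esub> \<delta> \<in> auto A"
      using Aut.m_closed[of \<gamma> \<delta>] \<gamma>(1) \<delta>(1) unfolding AutoGroup_simps(1) by blast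
    moreover have "inertial TG (res (\<gamma> \<otimes>\<^bsub>AutoGroup A\<^esub> \<delta>))"
      unfolding res_mult[OF \<gamma>(1) \<delta>(1)] by (rule TG.inertial_compose[OF \<gamma>(3) \<delta>(3)])
    ultimately show "\<gamma> \<otimes>\<^bsub>AutoGroup A\<^esub> \<delta> \<in> carrier (IAut1 A)" using IAut1I triv by blast
  qed
qed

lemma group_IAut1: "group (IAut1 A)"
  by (subst IAut1_eq) (rule group.subgroup_imp_group[OF AutoGroup subgroup_IAut1])

end

section \<open>The semidirect decomposition\<close>

context split_bounded_or_fg
begin

lemma IAut1_mult: "monoid.mult (IAut1 A) = monoid.mult (AutoGroup A)" "\<one>\<^bsub>IAut1 A\<^esub> = \<one>\<^bsub>AutoGroup A\<^esub>"
  unfolding IAut1_def IAut_def by simp_all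

lemma IAut1_apply:
  assumes "\<gamma> \<in> carrier (IAut1 A)" "\<delta> \<in> carrier (IAut1 A)" "a \<in> carrier A"
  shows "(\<gamma> \<otimes>\<^bsub>IAut1 A\<^esub> \<delta>) a = \<gamma> (\<delta> a)"
  unfolding IAut1_mult using AutoGroup_mult_apply[OF IAut1D(1)[OF assms(1)] IAut1D(1)[OF assms(2)] assms(3)] .

lemma IAut1_one_apply: "a \<in> carrier A \<Longrightarrow> \<one>\<^bsub>IAut1 A\<^esub> a = a"
  unfolding IAut1_mult AutoGroup_simps by simp

lemma IAut1_inv:
  assumes "\<gamma> \<in> carrier (IAut1 A)"
  shows "inv\<^bsub>IAut1 A\<^esub> \<gamma> \<in> carrier (IAut1 A)"
    and "a \<in> carrier A \<Longrightarrow> \<gamma> ((inv\<^bsub>IAut1 A\<^esub> \<gamma>) a) = a"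
    and "a \<in> carrier A \<Longrightarrow> (inv\<^bsub>IAut1 A\<^esub> \<gamma>) (\<gamma> a) = a"
proof -
  interpret M: group "IAut1 A" by (rule group_IAut1)
  show i: "inv\<^bsub>IAut1 A\<^esub> \<gamma> \<in> carrier (IAut1 A)" by (rule M.inv_closed[OF assms])
  show "\<gamma> ((inv\<^bsub>IAut1 A\<^esub> \<gamma>) a) = a" if "a \<in> carrier A"
    using IAut1_apply[OF assms i that] unfolding M.r_inv[OF assms] IAut1_one_apply[OF that] by (rule sym)
  show "(inv\<^bsub>IAut1 A\<^esub> \<gamma>) (\<gamma> a) = a" if "a \<in> carrier A"
    using IAut1_apply[OF i assms that] unfolding M.l_inv[OF assms] IAut1_one_apply[OF that] by (rule sym)
qed

lemma IAut1_closed: "\<gamma> \<in> carrier (IAut1 A) \<Longrightarrow> a \<in> carrier A \<Longrightarrow> \<gamma> a \<in> carrier A"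
  using auto_closed[OF IAut1D(1)] .

lemma IAut1_hom: "\<gamma> \<in> carrier (IAut1 A) \<Longrightarrow> a \<in> carrier A \<Longrightarrow> b \<in> carrier A \<Longrightarrow> \<gamma> (a \<otimes> b) = \<gamma> a \<otimes> \<gamma> b"
  using hom_mult[OF auto_hom[OF IAut1D(1)]] .

lemma IAut1_ext:
  assumes "\<gamma> \<in> carrier (IAut1 A)" "\<delta> \<in> carrier (IAut1 A)" "\<And>a. a \<in> carrier A \<Longrightarrow> \<gamma> a = \<delta> a"
  shows "\<gamma> = \<delta>"
  by (rule auto_ext[OF IAut1D(1)[OF assms(1)] IAut1D(1)[OF assms(2)] assms(3)])

text \<open>
  The automorphisms in \<open>IAut\<^sub>1(A)\<close> that act trivially on \<open>T\<close>, and so on both factors of \<open>0 \<le> T \<le> A\<close>.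
\<close>

definition Sigma_T :: "('a \<Rightarrow> 'a) set" where
  "Sigma_T = {\<gamma> \<in> carrier (IAut1 A). \<forall>t\<in>T. \<gamma> t = t}"

text \<open>
  The automorphisms in \<open>IAut\<^sub>1(A)\<close> that act trivially on the complement \<open>K\<close>.
\<close>

definition Gamma_K :: "('a \<Rightarrow> 'a) set" where
  "Gamma_K = {\<gamma> \<in> carrier (IAut1 A). \<forall>k\<in>K. \<gamma> k = k}"

lemma Sigma_TD: "\<sigma> \<in> Sigma_T \<Longrightarrow> \<sigma> \<in> carrier (IAut1 A)" "\<sigma> \<in> Sigma_T \<Longrightarrow> t \<in> T \<Longrightarrow> \<sigma> t = t"
  by (simp_all add: Sigma_T_def)

lemma Gamma_KD: "\<sigma> \<in> Gamma_K \<Longrightarrow> \<sigma> \<in> carrier (IAut1 A)" "\<sigma> \<in> Gamma_K \<Longrightarrow> k \<in> K \<Longrightarrow> \<sigma> k = k"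
  by (simp_all add: Gamma_K_def)

lemma subgroup_pointwise_stabilizer:
  assumes "B \<subseteq> carrier A"
  shows "subgroup {\<gamma> \<in> carrier (IAut1 A). \<forall>b\<in>B. \<gamma> b = b} (IAut1 A)"
proof -
  interpret M: group "IAut1 A" by (rule group_IAut1)
  have Bc: "b \<in> carrier A" if "b \<in> B" for b using that assms by blast
  show ?thesis
  proof (rule M.subgroupI)
    show "{\<gamma> \<in> carrier (IAut1 A). \<forall>b\<in>B. \<gamma> b = b} \<noteq> {}"
      using M.one_closed IAut1_one_apply Bc by blast
  next
    fix \<gamma> assume "\<gamma> \<in> {\<gamma> \<in> carrier (IAut1 A). \<forall>b\<in>B. \<gamma> b = b}"
    then have g: "\<gamma> \<in> carrier (IAut1 A)" "\<forall>b\<in>B. \<gamma> b = b" by simp_all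
    have "(inv\<^bsub>IAut1 A\<^esub> \<gamma>) b = b" if "b \<in> B" for b using IAut1_inv(3)[OF g(1) Bc[OF that]] g(2) that by simp
    then show "inv\<^bsub>IAut1 A\<^esub> \<gamma> \<in> {\<gamma> \<in> carrier (IAut1 A). \<forall>b\<in>B. \<gamma> b = b}" using IAut1_inv(1)[OF g(1)] by simp
  next
    fix \<gamma> \<delta> assume "\<gamma> \<in> {\<gamma> \<in> carrier (IAut1 A). \<forall>b\<in>B. \<gamma> b = b}" "\<delta> \<in> {\<gamma> \<in> carrier (IAut1 A). \<forall>b\<in>B. \<gamma> b = b}"
    then have g: "\<gamma> \<in> carrier (IAut1 A)" "\<forall>b\<in>B. \<gamma> b = b" and d: "\<delta> \<in> carrier (IAut1 A)" "\<forall>b\<in>B. \<delta> b = b" by simp_all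
    have "(\<gamma> \<otimes>\<^bsub>IAut1 A\<^esub> \<delta>) b = b" if "b \<in> B" for b using IAut1_apply[OF g(1) d(1) Bc[OF that]] g(2) d(2) that by simp
    then show "\<gamma> \<otimes>\<^bsub>IAut1 A\<^esub> \<delta> \<in> {\<gamma> \<in> carrier (IAut1 A). \<forall>b\<in>B. \<gamma> b = b}" using M.m_closed[OF g(1) d(1)] by simp
  qed auto
qed

lemma subgroup_Sigma_T: "subgroup Sigma_T (IAut1 A)"
  unfolding Sigma_T_def by (rule subgroup_pointwise_stabilizer) (use T_closed in blast)

lemma subgroup_Gamma_K: "subgroup Gamma_K (IAut1 A)"
  unfolding Gamma_K_def by (rule subgroup_pointwise_stabilizer[OF subgroup.subset[OF K]])

lemma normal_Sigma_T: "Sigma_T \<lhd> IAut1 A"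
proof -
  interpret M: group "IAut1 A" by (rule group_IAut1)
  have "\<gamma> \<otimes>\<^bsub>IAut1 A\<^esub> \<sigma> \<otimes>\<^bsub>IAut1 A\<^esub> inv\<^bsub>IAut1 A\<^esub> \<gamma> \<in> Sigma_T" if g: "\<gamma> \<in> carrier (IAut1 A)" and s: "\<sigma> \<in> Sigma_T" for \<gamma> \<sigma>
  proof -
    note sM = Sigma_TD(1)[OF s]
    note i = IAut1_inv[OF g]
    have gs: "\<gamma> \<otimes>\<^bsub>IAut1 A\<^esub> \<sigma> \<in> carrier (IAut1 A)" using M.m_closed[OF g sM] .
    have "(\<gamma> \<otimes>\<^bsub>IAut1 A\<^esub> \<sigma> \<otimes>\<^bsub>IAut1 A\<^esub> inv\<^bsub>IAut1 A\<^esub> \<gamma>) t = t" if t: "t \<in> T" for t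
    proof -
      have it: "(inv\<^bsub>IAut1 A\<^esub> \<gamma>) t \<in> T" using auto_T[OF IAut1D(1)[OF i(1)] t] .
      show ?thesis
        using IAut1_apply[OF gs i(1) T_closed[OF t]] IAut1_apply[OF g sM T_closed[OF it]] Sigma_TD(2)[OF s it]
          i(2)[OF T_closed[OF t]] by simp
    qed
    then show ?thesis unfolding Sigma_T_def using M.m_closed[OF gs i(1)] by simp
  qed
  then show ?thesis unfolding M.normal_inv_iff using subgroup_Sigma_T by simp
qed

lemma ext_in_Gamma_K:
  assumes "inertial TG \<gamma>" shows "ext \<gamma> \<in> Gamma_K"
proof -
  have \<gamma>: "\<gamma> \<in> auto TG" using assms by (simp add: inertial_def)
  have "ext \<gamma> \<in> carrier (IAut1 A)"
    by (rule IAut1I[OF ext_auto[OF \<gamma>] ext_trivial[OF \<gamma>]]) (use res_ext[OF \<gamma>] assms in simp_all)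
  then show ?thesis unfolding Gamma_K_def using ext_on_K[OF \<gamma>] by simp
qed

lemma Sigma_Int_Gamma: "Sigma_T \<inter> Gamma_K = {\<one>\<^bsub>IAut1 A\<^esub>}"
proof
  show "{\<one>\<^bsub>IAut1 A\<^esub>} \<subseteq> Sigma_T \<inter> Gamma_K"
    using subgroup.one_closed[OF subgroup_Sigma_T] subgroup.one_closed[OF subgroup_Gamma_K] by simp
  show "Sigma_T \<inter> Gamma_K \<subseteq> {\<one>\<^bsub>IAut1 A\<^esub>}"
  proof
    fix \<gamma> assume "\<gamma> \<in> Sigma_T \<inter> Gamma_K"
    then have g: "\<gamma> \<in> Sigma_T" "\<gamma> \<in> Gamma_K" by simp_all
    show "\<gamma> \<in> {\<one>\<^bsub>IAut1 A\<^esub>}"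
      unfolding IAut1_mult(2)
      using fixes_T_and_K[OF IAut1D(1)[OF Sigma_TD(1)[OF g(1)]] Sigma_TD(2)[OF g(1)] Gamma_KD(2)[OF g(2)]] by simp
  qed
qed

lemma Sigma_mult_Gamma: "Sigma_T <#>\<^bsub>IAut1 A\<^esub> Gamma_K = carrier (IAut1 A)"
proof
  interpret M: group "IAut1 A" by (rule group_IAut1)
  show "Sigma_T <#>\<^bsub>IAut1 A\<^esub> Gamma_K \<subseteq> carrier (IAut1 A)"
    by (rule M.setmult_subset_G[OF subgroup.subset[OF subgroup_Sigma_T] subgroup.subset[OF subgroup_Gamma_K]])
  show "carrier (IAut1 A) \<subseteq> Sigma_T <#>\<^bsub>IAut1 A\<^esub> Gamma_K"
  proof
    fix \<gamma> assume g: "\<gamma> \<in> carrier (IAut1 A)"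
    let ?e = "ext (res \<gamma>)"
    have e: "?e \<in> Gamma_K" by (rule ext_in_Gamma_K[OF IAut1D(3)[OF g]])
    note eM = Gamma_KD(1)[OF e]
    note i = IAut1_inv[OF eM]
    let ?s = "\<gamma> \<otimes>\<^bsub>IAut1 A\<^esub> inv\<^bsub>IAut1 A\<^esub> ?e"
    have "?s t = t" if t: "t \<in> T" for t
    proof -
      have it: "(inv\<^bsub>IAut1 A\<^esub> ?e) t \<in> T" using auto_T[OF IAut1D(1)[OF i(1)] t] .
      have "?s t = \<gamma> ((inv\<^bsub>IAut1 A\<^esub> ?e) t)" using IAut1_apply[OF g i(1) T_closed[OF t]] .
      also have "\<dots> = ?e ((inv\<^bsub>IAut1 A\<^esub> ?e) t)"
        using ext_on_T[OF res_auto[OF IAut1D(1)[OF g]] it] res_apply[OF it, of \<gamma>] by simp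
      also have "\<dots> = t" using i(2)[OF T_closed[OF t]] .
      finally show ?thesis .
    qed
    then have "?s \<in> Sigma_T" unfolding Sigma_T_def using M.m_closed[OF g i(1)] by simp
    moreover have "\<gamma> = ?s \<otimes>\<^bsub>IAut1 A\<^esub> ?e" using M.m_assoc[OF g i(1) eM] M.l_inv[OF eM] M.r_one[OF g] by simp
    ultimately show "\<gamma> \<in> Sigma_T <#>\<^bsub>IAut1 A\<^esub> Gamma_K" using e unfolding set_mult_def by blast
  qed
qed

abbreviation SG where "SG \<equiv> (IAut1 A)\<lparr>carrier := Sigma_T\<rparr>"

text \<open>
  The map \<open>\<sigma> \<mapsto> \<sigma> - 1\<close> turns composition into addition of homomorphisms.
\<close>

lemma Sigma_T_apply:
  assumes \<sigma>: "\<sigma> \<in> Sigma_T" and \<sigma>': "\<sigma>' \<in> Sigma_T" and a: "a \<in> carrier A"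
  shows "(\<sigma> \<otimes>\<^bsub>IAut1 A\<^esub> \<sigma>') a \<otimes> inv a = (\<sigma> a \<otimes> inv a) \<otimes> (\<sigma>' a \<otimes> inv a)"
proof -
  note s = Sigma_TD(1)[OF \<sigma>] and s' = Sigma_TD(1)[OF \<sigma>']
  have d: "\<sigma>' a \<otimes> inv a \<in> T" using IAut1D(2)[OF s' a] .
  have c: "\<sigma> a \<in> carrier A" "\<sigma>' a \<in> carrier A" using IAut1_closed s s' a by simp_all
  have e: "\<sigma>' a = (\<sigma>' a \<otimes> inv a) \<otimes> a"
    by (rule abelian_normal_form2[of "\<sigma>' a" a]) (use c a in simp_all)
  have "(\<sigma> \<otimes>\<^bsub>IAut1 A\<^esub> \<sigma>') a = \<sigma> ((\<sigma>' a \<otimes> inv a) \<otimes> a)"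
    using IAut1_apply[OF s s' a] e by simp
  also have "\<dots> = (\<sigma>' a \<otimes> inv a) \<otimes> \<sigma> a"
    using IAut1_hom[OF s T_closed[OF d] a] Sigma_TD(2)[OF \<sigma> d] by simp
  finally show ?thesis using a c by (simp add: m_ac)
qed

lemma comm_group_SG: "comm_group SG"
proof -
  interpret M: group "IAut1 A" by (rule group_IAut1)
  have "\<sigma> \<otimes>\<^bsub>IAut1 A\<^esub> \<sigma>' = \<sigma>' \<otimes>\<^bsub>IAut1 A\<^esub> \<sigma>" if s: "\<sigma> \<in> Sigma_T" and s': "\<sigma>' \<in> Sigma_T" for \<sigma> \<sigma>'
  proof (rule IAut1_ext)
    show ss': "\<sigma> \<otimes>\<^bsub>IAut1 A\<^esub> \<sigma>' \<in> carrier (IAut1 A)" "\<sigma>' \<otimes>\<^bsub>IAut1 A\<^esub> \<sigma> \<in> carrier (IAut1 A)"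
      using M.m_closed Sigma_TD(1) s s' by simp_all
    fix a assume a: "a \<in> carrier A"
    have c: "\<sigma> a \<otimes> inv a \<in> carrier A" "\<sigma>' a \<otimes> inv a \<in> carrier A"
      using IAut1_closed[OF Sigma_TD(1)[OF s] a] IAut1_closed[OF Sigma_TD(1)[OF s'] a] a by simp_all
    have eq: "(\<sigma> \<otimes>\<^bsub>IAut1 A\<^esub> \<sigma>') a \<otimes> inv a = (\<sigma>' \<otimes>\<^bsub>IAut1 A\<^esub> \<sigma>) a \<otimes> inv a"
      unfolding Sigma_T_apply[OF s s' a] Sigma_T_apply[OF s' s a] using m_comm[OF c] .
    show "(\<sigma> \<otimes>\<^bsub>IAut1 A\<^esub> \<sigma>') a = (\<sigma>' \<otimes>\<^bsub>IAut1 A\<^esub> \<sigma>) a"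
      by (rule r_cancel[OF eq IAut1_closed[OF ss'(1) a] IAut1_closed[OF ss'(2) a] inv_closed[OF a]])
  qed
  then show ?thesis
    by (intro group.group_comm_groupI M.subgroup_imp_group[OF subgroup_Sigma_T]) simp
qed

text \<open>
  The values \<open>x\<sigma> - x\<close>, for \<open>x\<close> in a finite detecting set, embed \<open>\<Sigma>\<close> in a finite power of \<open>T\<close>, and conjugation
  by \<open>\<gamma>\<close> becomes the coordinatewise action of the restriction of \<open>\<gamma>\<close> to \<open>T\<close>.
\<close>

lemma equivariant_Sigma_T:
  assumes g: "\<gamma> \<in> carrier (IAut1 A)"
  obtains X0 where "equivariant_embedding SG TG (conj_on (IAut1 A) Sigma_T \<gamma>) (res \<gamma>) X0 (\<lambda>x \<sigma>. \<sigma> x \<otimes> inv x)"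
proof -
  interpret M: group "IAut1 A" by (rule group_IAut1)
  obtain X0 where X0: "finite X0" "X0 \<subseteq> carrier A"
    and det: "\<And>f. f \<in> hom A A \<Longrightarrow> \<forall>t\<in>T. f t = \<one> \<Longrightarrow> \<forall>a\<in>carrier A. f a \<in> T \<Longrightarrow>
      \<forall>x\<in>X0. f x = \<one> \<Longrightarrow> \<forall>a\<in>carrier A. f a = \<one>"
    by (rule finite_detecting_set) (rule that, assumption, assumption, blast)
  have conj: "conj_on (IAut1 A) Sigma_T \<gamma> \<in> auto SG" by (rule conj_on_auto[OF normal_Sigma_T g])
  note i = IAut1_inv[OF g]
  have "equivariant_embedding SG TG (conj_on (IAut1 A) Sigma_T \<gamma>) (res \<gamma>) X0 (\<lambda>x \<sigma>. \<sigma> x \<otimes> inv x)"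
  proof (intro equivariant_embedding.intro equivariant_embedding_axioms.intro)
    show "comm_group SG" by (rule comm_group_SG)
    show "comm_group TG" by (rule comm_group_TG)
    show "carrier TG = torsion_part TG" by (rule torsion_TG)
    show "res \<gamma> \<in> hom TG TG" using auto_hom[OF res_auto[OF IAut1D(1)[OF g]]] .
    show "almost_preserves TG (res \<gamma>) H" if "subgroup H TG" for H
      using IAut1D(3)[OF g] that unfolding inertial_iff[OF comm_group_TG] by simp
    show "conj_on (IAut1 A) Sigma_T \<gamma> \<in> hom SG SG" using auto_hom[OF conj] .
    show "finite X0" by fact
    show "(\<lambda>\<sigma>. \<sigma> x \<otimes> inv x) \<in> hom SG TG" if "x \<in> X0" for x
    proof (rule homI)
      have x: "x \<in> carrier A" using that X0(2) by auto
      show "\<sigma> x \<otimes> inv x \<in> carrier TG" if "\<sigma> \<in> carrier SG" for \<sigma>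
        using that IAut1D(2)[OF Sigma_TD(1) x, of \<sigma>] by simp
      show "(\<sigma> \<otimes>\<^bsub>SG\<^esub> \<sigma>') x \<otimes> inv x = (\<sigma> x \<otimes> inv x) \<otimes>\<^bsub>TG\<^esub> (\<sigma>' x \<otimes> inv x)"
        if "\<sigma> \<in> carrier SG" "\<sigma>' \<in> carrier SG" for \<sigma> \<sigma>'
        using that Sigma_T_apply[OF _ _ x, of \<sigma> \<sigma>'] by simp
    qed
  next
    fix \<sigma> assume "\<sigma> \<in> carrier SG" and ker: "\<And>x. x \<in> X0 \<Longrightarrow> \<sigma> x \<otimes> inv x = \<one>\<^bsub>TG\<^esub>"
    then have s: "\<sigma> \<in> Sigma_T" by simp
    note sM = Sigma_TD(1)[OF s]
    have "\<forall>a\<in>carrier A. \<sigma> a \<otimes> inv a = \<one>"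
    proof (rule det[OF difference_hom[OF IAut1D(1)[OF sM]]])
      show "\<forall>t\<in>T. \<sigma> t \<otimes> inv t = \<one>" using Sigma_TD(2)[OF s] T_closed by simp
      show "\<forall>a\<in>carrier A. \<sigma> a \<otimes> inv a \<in> T" using IAut1D(2)[OF sM] by simp
      show "\<forall>x\<in>X0. \<sigma> x \<otimes> inv x = \<one>" using ker by simp
    qed
    note d = bspec[OF this]
    have "\<sigma> = \<one>\<^bsub>IAut1 A\<^esub>"
    proof (rule IAut1_ext[OF sM M.one_closed])
      fix a assume a: "a \<in> carrier A"
      have "\<sigma> a = (\<sigma> a \<otimes> inv a) \<otimes> a"
        by (rule abelian_normal_form2[of "\<sigma> a" a]) (use a IAut1_closed[OF sM a] in simp_all)
      then show "\<sigma> a = \<one>\<^bsub>IAut1 A\<^esub> a" using d[OF a] a IAut1_one_apply by simp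
    qed
    then show "\<sigma> = \<one>\<^bsub>SG\<^esub>" by simp
  next
    fix x \<sigma> assume "x \<in> X0" and "\<sigma> \<in> carrier SG"
    then have x: "x \<in> carrier A" and s: "\<sigma> \<in> Sigma_T" using X0(2) by auto
    note sM = Sigma_TD(1)[OF s]
    \<comment> \<open>As \<open>\<sigma> - 1\<close> vanishes on \<open>T\<close>, it takes the same value at \<open>x\<close> and at its preimage under \<open>\<gamma>\<close>.\<close>
    let ?y = "(inv\<^bsub>IAut1 A\<^esub> \<gamma>) x"
    have y: "?y \<in> carrier A" using IAut1_closed[OF i(1) x] .
    have sy: "\<sigma> ?y \<in> carrier A" "\<sigma> x \<in> carrier A" using IAut1_closed[OF sM y] IAut1_closed[OF sM x] .
    have dT: "\<sigma> x \<otimes> inv x \<in> T" using IAut1D(2)[OF sM x] .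
    have yx: "?y \<otimes> inv x \<in> T" using IAut1D(2)[OF i(1) x] .
    have "?y = (?y \<otimes> inv x) \<otimes> x"
      by (rule abelian_normal_form2[of ?y x]) (use y x in simp_all)
    then have "\<sigma> ?y = (?y \<otimes> inv x) \<otimes> \<sigma> x"
      using IAut1_hom[OF sM T_closed[OF yx] x] Sigma_TD(2)[OF s yx] by metis
    also have "\<dots> = (\<sigma> x \<otimes> inv x) \<otimes> ?y"
      by (rule abelian_normal_form3[of ?y x "\<sigma> x"]) (use y x sy in simp_all)
    finally have e: "\<sigma> ?y = (\<sigma> x \<otimes> inv x) \<otimes> ?y" .
    have "conj_on (IAut1 A) Sigma_T \<gamma> \<sigma> x = \<gamma> (\<sigma> ?y)"
      unfolding conj_on_def using s IAut1_apply[OF M.m_closed[OF g sM] i(1) x] IAut1_apply[OF g sM y] by simp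
    also have "\<dots> = \<gamma> (\<sigma> x \<otimes> inv x) \<otimes> x"
      unfolding e IAut1_hom[OF g T_closed[OF dT] y] i(2)[OF x] ..
    finally show "conj_on (IAut1 A) Sigma_T \<gamma> \<sigma> x \<otimes> inv x = res \<gamma> (\<sigma> x \<otimes> inv x)"
      using res_apply[OF dT, of \<gamma>] IAut1_closed[OF g T_closed[OF dT]] x by (simp add: m_assoc)
  qed
  then show thesis by (rule that)
qed

lemma periodic_SG: "periodic SG"
proof -
  interpret M: group "IAut1 A" by (rule group_IAut1)
  obtain X0 where "equivariant_embedding SG TG (conj_on (IAut1 A) Sigma_T \<one>\<^bsub>IAut1 A\<^esub>) (res \<one>\<^bsub>IAut1 A\<^esub>) X0 (\<lambda>x \<sigma>. \<sigma> x \<otimes> inv x)"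
    by (rule equivariant_Sigma_T[OF M.one_closed])
  from equivariant_embedding.torsion_G[OF this] show ?thesis unfolding periodic_def by (rule sym)
qed

lemma inertial_conj:
  assumes g: "\<gamma> \<in> carrier (IAut1 A)"
  shows "inertial SG (conj_on (IAut1 A) Sigma_T \<gamma>)"
proof -
  obtain X0 where E: "equivariant_embedding SG TG (conj_on (IAut1 A) Sigma_T \<gamma>) (res \<gamma>) X0 (\<lambda>x \<sigma>. \<sigma> x \<otimes> inv x)"
    by (rule equivariant_Sigma_T[OF g])
  have "almost_preserves SG (conj_on (IAut1 A) Sigma_T \<gamma>) U" if "subgroup U SG" for U
    using comm_group.locally_almost_stable_imp_almost_preserves[OF comm_group_SG equivariant_embedding.all_stable[OF E that]] .
  then show ?thesis
    unfolding inertial_iff[OF comm_group_SG] using conj_on_auto[OF normal_Sigma_T g] by simp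
qed

lemma Gamma_K_iso: "(IAut1 A)\<lparr>carrier := Gamma_K\<rparr> \<cong> IAut TG"
proof -
  interpret M: group "IAut1 A" by (rule group_IAut1)
  interpret TG: comm_group TG by (rule comm_group_TG)
  have cI: "carrier (IAut TG) = {\<gamma>. inertial TG \<gamma>}" by (rule TG.carrier_IAut_torsion[OF torsion_TG])
  have mI: "monoid.mult (IAut TG) = monoid.mult (AutoGroup TG)" unfolding IAut_def by simp
  have "res \<in> iso ((IAut1 A)\<lparr>carrier := Gamma_K\<rparr>) (IAut TG)"
  proof (rule isoI)
    show "res \<in> hom ((IAut1 A)\<lparr>carrier := Gamma_K\<rparr>) (IAut TG)"
    proof (rule homI)
      show "res \<gamma> \<in> carrier (IAut TG)" if "\<gamma> \<in> carrier ((IAut1 A)\<lparr>carrier := Gamma_K\<rparr>)" for \<gamma>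
        unfolding cI using that IAut1D(3)[OF Gamma_KD(1), of \<gamma>] by simp
      fix \<gamma> \<delta> assume "\<gamma> \<in> carrier ((IAut1 A)\<lparr>carrier := Gamma_K\<rparr>)" "\<delta> \<in> carrier ((IAut1 A)\<lparr>carrier := Gamma_K\<rparr>)"
      then have "\<gamma> \<in> auto A" "\<delta> \<in> auto A" using IAut1D(1) Gamma_KD(1) by simp_all
      then show "res (\<gamma> \<otimes>\<^bsub>(IAut1 A)\<lparr>carrier := Gamma_K\<rparr>\<^esub> \<delta>) = res \<gamma> \<otimes>\<^bsub>IAut TG\<^esub> res \<delta>"
        unfolding mI by (simp add: IAut1_mult res_mult)
    qed
    have "bij_betw res Gamma_K (carrier (IAut TG))"
    proof (rule bij_betw_byWitness[where f' = ext])
      show "\<forall>\<gamma>\<in>Gamma_K. ext (res \<gamma>) = \<gamma>"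
      proof
        fix \<gamma> assume g: "\<gamma> \<in> Gamma_K"
        note gM = Gamma_KD(1)[OF g]
        note r = res_auto[OF IAut1D(1)[OF gM]]
        have e: "ext (res \<gamma>) \<in> carrier (IAut1 A)" using Gamma_KD(1)[OF ext_in_Gamma_K[OF IAut1D(3)[OF gM]]] .
        show "ext (res \<gamma>) = \<gamma>"
        proof (rule IAut1_ext[OF e gM])
          fix a assume a: "a \<in> carrier A"
          have k: "a \<otimes> inv (\<tau> a) \<in> carrier A" using subgroup.mem_carrier[OF K \<tau>_K[OF a]] .
          have d: "a = (a \<otimes> inv (\<tau> a)) \<otimes> \<tau> a"
            by (rule abelian_normal_form2[of a "\<tau> a"]) (use a \<tau>_closed in simp_all)
          have "\<gamma> a = \<gamma> (a \<otimes> inv (\<tau> a)) \<otimes> \<gamma> (\<tau> a)"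
            using IAut1_hom[OF gM k \<tau>_closed[OF a]] d by simp
          then show "ext (res \<gamma>) a = \<gamma> a"
            using ext_apply[OF a, of "res \<gamma>"] res_apply[OF \<tau>_T[OF a], of \<gamma>] Gamma_KD(2)[OF g \<tau>_K[OF a]] by simp
        qed
      qed
      show "\<forall>\<gamma>\<in>carrier (IAut TG). res (ext \<gamma>) = \<gamma>" unfolding cI using res_ext by (simp add: inertial_def)
      show "res ` Gamma_K \<subseteq> carrier (IAut TG)"
      proof (rule image_subsetI)
        show "res \<gamma> \<in> carrier (IAut TG)" if "\<gamma> \<in> Gamma_K" for \<gamma>
          unfolding cI using IAut1D(3)[OF Gamma_KD(1)[OF that]] by simp
      qed
      show "ext ` carrier (IAut TG) \<subseteq> Gamma_K"
      proof (rule image_subsetI)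
        show "ext \<gamma> \<in> Gamma_K" if "\<gamma> \<in> carrier (IAut TG)" for \<gamma>
          using that ext_in_Gamma_K unfolding cI by simp
      qed
    qed
    then show "bij_betw res (carrier ((IAut1 A)\<lparr>carrier := Gamma_K\<rparr>)) (carrier (IAut TG))" by simp
  qed
  then show ?thesis by (rule is_isoI)
qed

end

theorem theoremC:
  fixes A :: "('a, 'b) monoid_scheme" and T :: "'a set"
  defines "T \<equiv> torsion_part A"
  assumes "comm_group A"
    and "finite_torsion_free_rank A"
    and "bounded_group (A\<lparr>carrier := T\<rparr>) \<or> finitely_generated (A Mod T)"
  shows "\<exists>\<Sigma> \<Gamma>\<^sub>1. subgroup \<Sigma> (IAut1 A) \<and> subgroup \<Gamma>\<^sub>1 (IAut1 A) \<and>
      internal_semidirect (IAut1 A) \<Sigma> \<Gamma>\<^sub>1 \<and>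
      comm_group ((IAut1 A)\<lparr>carrier := \<Sigma>\<rparr>) \<and>
      periodic ((IAut1 A)\<lparr>carrier := \<Sigma>\<rparr>) \<and>
      (IAut1 A)\<lparr>carrier := \<Gamma>\<^sub>1\<rparr> \<cong> IAut (A\<lparr>carrier := T\<rparr>) \<and>
      (\<forall>\<gamma>\<in>\<Gamma>\<^sub>1. inertial ((IAut1 A)\<lparr>carrier := \<Sigma>\<rparr>) (conj_on (IAut1 A) \<Sigma> \<gamma>))"
proof -
  interpret A: comm_group A by fact
  have "(\<exists>n::int. n \<noteq> 0 \<and> (\<forall>t\<in>T. t [^]\<^bsub>A\<^esub> n = \<one>\<^bsub>A\<^esub>)) \<or>
      (\<exists>S. finite S \<and> S \<subseteq> carrier A \<and> carrier A \<subseteq> generate A S <#>\<^bsub>A\<^esub> T)"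
    using assms(4)
  proof
    assume "bounded_group (A\<lparr>carrier := T\<rparr>)"
    then obtain n :: nat where n: "n > 0" "\<forall>t\<in>T. t [^]\<^bsub>A\<^esub> n = \<one>\<^bsub>A\<^esub>"
      unfolding bounded_group_def by (auto simp: A.nat_pow_consistent[symmetric])
    then have "int n \<noteq> 0 \<and> (\<forall>t\<in>T. t [^]\<^bsub>A\<^esub> int n = \<one>\<^bsub>A\<^esub>)" by (simp add: int_pow_int)
    then show ?thesis by blast
  next
    assume "finitely_generated (A Mod T)"
    then show ?thesis using A.fg_mod_torsion unfolding T_def by simp
  qed
  then have "bounded_or_fg A"
    by (intro bounded_or_fg.intro bounded_or_fg_axioms.intro assms(2,3)) (simp only: T_def)
  then obtain K \<tau> where "split_bounded_or_fg A K \<tau>" using bounded_or_fg.ex_split by blast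
  then interpret split_bounded_or_fg A K \<tau> .
  show ?thesis
    unfolding T_def
  proof (rule exI[of _ Sigma_T], rule exI[of _ Gamma_K], intro conjI ballI)
    show "internal_semidirect (IAut1 A) Sigma_T Gamma_K"
      unfolding internal_semidirect_def
      using normal_Sigma_T subgroup_Gamma_K Sigma_Int_Gamma Sigma_mult_Gamma by simp
    show "inertial SG (conj_on (IAut1 A) Sigma_T \<gamma>)" if "\<gamma> \<in> Gamma_K" for \<gamma>
      using inertial_conj[OF Gamma_KD(1)[OF that]] .
  qed (fact subgroup_Sigma_T subgroup_Gamma_K comm_group_SG periodic_SG Gamma_K_iso)+
qed

end
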